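(* Let $0<\kappa_1<\kappa_2$, and consider, with parameters $(\mu,\eta)\in\mathbb{R}^2$, the piecewise-smooth system $(\dot x,\dot y)^T=f_1(x,y)$ for $y<x+\eta$, $(\dot x,\dot y)^T=f_2(x,y)$ for $y>x+\eta$, where $f_i(x,y)=\binom{1-(1+\kappa_i)x}{\mu-\kappa_i y}$, with switching manifold $\Sigma=\{y=x+\eta\}$. It has the following codimension-two bifurcations. 1. Fold-boundary equilibrium bifurcations $$\mathrm{FB}_1:\ (\mu,\eta)=\left(\frac{\kappa_1}{1+\kappa_1},0\right),\qquad \mathrm{FB}_2:\ (\mu,\eta)=\left(\frac{\kappa_2}{1+\kappa_2},0\right)$$ occur at the intersection points of the curve $\mathrm{FF}$ with the curves $\mathrm{BE}_1$ and $\mathrm{BE}_2$, respectively. At the point $\mathrm{FB}_i$ the equilibrium $p_i$ collides with the singular tangency point $F^*$. The points $\mathrm{FB}_i$ divide the curve $\mathrm{FF}$ locally into the segments $\mathrm{FF}_1$ and $\mathrm{FF}_2$, along which there is a fold-fold bifurcation of type VI$_1$, and the segment $\mathrm{FU}$ of fused-focus bifurcation, along which the (crossing) periodic orbit $\Gamma$ (dis)appears. Both of these fold-fold bifurcations result in the sliding segment changing between being repelling and attracting, and the quadratic tangency points $F_1,F_2$ switching places as the sliding segment boundaries. The point $\mathrm{FB}_i$ also divides the curve $\mathrm{BE}_i$ locally into the segment $\mathrm{BE}_i^P$, where there is a standard persistence boundary equilibrium bifurcation with a nodal equilibrium, and the segment $\widehat{\mathrm{BE}}_i^P$, along which a stable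 (crossing) periodic orbit $\Gamma$ (dis)appears in a homoclinic-like persistence boundary equilibrium bifurcation. 2. A double-boundary equilibrium bifurcation $$\mathrm{BB}:\ (\mu,\eta)=\left(\frac{\kappa_1\kappa_2}{(\kappa_1+1)(\kappa_2+1)},\ \frac{-1}{(\kappa_1+1)(\kappa_2+1)}\right)$$ occurs at the intersection of the curves $\mathrm{BE}_1$ and $\mathrm{BE}_2$. At the point $\mathrm{BB}$ the equilibria $p_1$ and $p_2$ simultaneously collide with the two different quadratic tangency points $F_1$ and $F_2$, respectively. The point $\mathrm{BB}$ divides the curve $\mathrm{BE}_1$ locally into the segment $\widehat{\mathrm{BE}}_1^P$, along which a stable (crossing) periodic orbit $\Gamma$ (dis)appears, and the segment $\widetilde{\mathrm{BE}}_1^P$, where there is a standard persistence boundary equilibrium bifurcation with a nodal equilibrium. Similarly, the curve $\mathrm{BE}_2$ is divided locally by $\mathrm{BB}$ into the segment $\widehat{\mathrm{BE}}_2^F$, along which the (crossing) periodic orbit $\Gamma$ (dis)appears, and the segment $\mathrm{BE}_2^F$, where there is the standard non-smooth fold boundary equilibrium bifurcation with a nodal equilibrium. 3. Generalised boundary equilibrium bifurcations $$\mathrm{GB}_1:\ (\mu,\eta)=\left(\frac{\kappa_1^2}{(\kappa_1+1)^2},\ -\frac{1}{(\kappa_1+1)^2}\right),\qquad \mathrm{GB}_2:\ (\mu,\eta)=\left(\frac{\kappa_2^2}{(\kappa_2+1)^2},\ -\frac{1}{(\kappa_2+1)^2}\right)$$ occur at the end points of the curve $\mathrm{PS}$, respectively,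 on the curves $\mathrm{BE}_1$ and $\mathrm{BE}_2$. At the point $\mathrm{GB}_i$ the equilibrium $p_i$ collides with the quadratic tangency point $F_i$. At the same time, a pseudo-saddle-node bifurcation takes place at $F_i$, resulting in a generalised boundary equilibrium bifurcation with respect to $f_i$. The point $\mathrm{GB}_1$ separates the curve $\mathrm{BE}_1$ locally into the segment $\widetilde{\mathrm{BE}}_1^P$ and the segment $\mathrm{BE}_1^F$ of boundary equilibrium bifurcations. Similarly, the point $\mathrm{GB}_2$ separates the curve $\mathrm{BE}_2$ locally into the segment $\widehat{\mathrm{BE}}_2^P$ and the segment $\widehat{\mathrm{BE}}_2^F$ of boundary equilibrium bifurcations.
   Context: Notation. $R_1=\{y<x+\eta\}$, $R_2=\{y>x+\eta\}$, $\mathbf{n}=\binom{-1}{1}$. The equilibrium of $f_i$ is $p_i=\left(\frac{1}{1+\kappa_i},\frac{\mu}{\kappa_i}\right)$, admissible if $p_i\in R_i$. The crossing segment $\Sigma_c$ (sliding segment $\Sigma_s$) is the set of points of $\Sigma$ where $f_1\cdot\mathbf n$ and $f_2\cdot\mathbf n$ are non-zero with the same sign (opposite signs); $\Sigma_s$ is attracting if both vector fields point towards $\Sigma$ and repelling if both point away. The tangency point $F_i=\binom{1-\mu+\eta\kappa_i}{1-\mu+(1+\kappa_i)\eta}$ is the point of $\Sigma$ where $f_i\cdot\mathbf n=0$; $F_1,F_2$ bound $\Sigma_s$. A quadratic tangency $F_i$ (second Lie derivative $f_i\cdot\nabla(f_i\cdot\mathbf n)\neq0$) is visible if the orbit of $f_i$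 through it lies locally in $R_i$, and invisible otherwise. For $\eta=0$, $F^*=F_1=F_2$ is called a singular tangency point. On $\Sigma_s$ the sliding vector field $f_s$ is Filippov's convex combination $(1-\lambda)f_1+\lambda f_2$, $\lambda\in[0,1]$, tangent to $\Sigma$. Its zeros (with the formula extended to $\Sigma$) are the pseudo-equilibria $q^{\pm}=\frac12\left(1-\mu-\eta\pm\sqrt{(\eta+\mu+1)^2-4\mu}\right)\binom11+\binom0\eta$, admissible if they lie on $\Sigma_s$. Piecewise-smooth orbits consist of orbit segments of $f_1$ in $R_1$, of $f_2$ in $R_2$, and of $f_s$ on $\Sigma_s$. A crossing periodic orbit is a periodic orbit composed of an orbit segment of $f_1$ in $R_1$ and one of $f_2$ in $R_2$ that join on $\Sigma_c$. $\Gamma$ denotes the stable crossing periodic orbit, encircling the repelling sliding segment, which exists for $(\mu,\eta)$ in the open region V given by $\eta<0$ and $\frac{\mu}{\kappa_2}-\frac{1}{1+\kappa_2}<\eta<\frac{\mu}{\kappa_1}-\frac{1}{1+\kappa_1}$; "(dis)appears" means that $\Gamma$ is created or destroyed when the respective bifurcation segment, which is part of the boundary of region V, is crossed. Codimension-one curves. $\mathrm{BE}_i$ is the line $\eta=\frac{\mu}{\kappa_i}-\frac{1}{1+\kappa_i}$ (where $p_i=F_i\in\Sigma$: boundary equilibrium bifurcation); $\mathrm{FF}$ is the line $\eta=0$ (where $F_1=F_2$: fold-fold bifurcation); $\mathrm{PS}$ is the curve segment $\eta=-(\mu+1)+2\sqrt\mu$, $\frac{\kappa_1^2}{(\kappa_1+1)^2}<\mu<\frac{\kappa_2^2}{(\kappa_2+1)^2}$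 (pseudo-saddle-node bifurcation: $q^-$ and $q^+$ form a saddle-node on $\Sigma_s$). Segments. $\mathrm{FF}$: $\mathrm{FF}_1$ is the part with $\mu<\frac{\kappa_1}{1+\kappa_1}$, $\mathrm{FU}$ the part between $\mathrm{FB}_1$ and $\mathrm{FB}_2$, $\mathrm{FF}_2$ the part with $\mu>\frac{\kappa_2}{1+\kappa_2}$. $\mathrm{BE}_1$, in order of decreasing $\eta$: $\mathrm{BE}_1^P$ (with $\eta>0$), $\widehat{\mathrm{BE}}_1^P$ (between $\mathrm{FB}_1$ and $\mathrm{BB}$), $\widetilde{\mathrm{BE}}_1^P$ (between $\mathrm{BB}$ and $\mathrm{GB}_1$), $\mathrm{BE}_1^F$ (below $\mathrm{GB}_1$). $\mathrm{BE}_2$, in order of decreasing $\eta$: $\mathrm{BE}_2^P$ (with $\eta>0$), $\widehat{\mathrm{BE}}_2^P$ (between $\mathrm{FB}_2$ and $\mathrm{GB}_2$), $\widehat{\mathrm{BE}}_2^F$ (between $\mathrm{GB}_2$ and $\mathrm{BB}$), $\mathrm{BE}_2^F$ (below $\mathrm{BB}$). Superscript $P$ denotes persistence type and $F$ non-smooth fold type. Bifurcation types. A boundary equilibrium bifurcation of $p_i$ at $F_i$ is of persistence type if, as $p_i$ changes from admissible to non-admissible through $F_i$, a pseudo-equilibrium changes from non-admissible to admissible through $F_i$; it is of non-smooth fold type if $p_i$ and a pseudo-equilibrium become (non-)admissible simultaneously on the same side of the bifurcation. It is called homoclinic-like if at the bifurcation the boundary equilibrium $p_i$ has a non-sliding homoclinic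 orbit crossing $\Sigma$, from which $\Gamma$ bifurcates. A fold-fold bifurcation is of type VI$_1$ if at $F^*$ one of the two quadratic tangencies is visible and the other invisible, with $f_1(F^* )$ and $f_2(F^* )$ pointing in the same direction; it is a fused-focus bifurcation if both quadratic tangencies at $F^*$ are invisible and $f_1(F^* )$, $f_2(F^* )$ point in opposite directions. A fold-boundary equilibrium bifurcation is the coincidence of $p_i$ with $F^*$; a double-boundary equilibrium bifurcation is the simultaneous occurrence of boundary equilibrium bifurcations of $p_1\neq p_2$; a generalised boundary equilibrium bifurcation with respect to $f_i$ is a boundary equilibrium bifurcation of $p_i$ at $F_i$ that coincides with a pseudo-saddle-node bifurcation at $F_i$. *)

theory Defs
  imports "HOL-Analysis.Analysis"
begin

(* A parameter point is P = (mu, eta), a point of the phase plane is (x, y).  The decay rates are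
   kappa_1 = \<kappa> 1 and kappa_2 = \<kappa> 2; everything indexed by i is meant for i = 1 and i = 2 only,
   and 3 - i is the other index. *)

section \<open>The piecewise-smooth system\<close>

definition vf :: "(nat \<Rightarrow> real) \<Rightarrow> nat \<Rightarrow> real \<times> real \<Rightarrow> real \<times> real \<Rightarrow> real \<times> real" where
  "vf \<kappa> i = (\<lambda>(\<mu>, \<eta>) (x, y). (1 - (1 + \<kappa> i) * x, \<mu> - \<kappa> i * y))"

definition switching :: "real \<times> real \<Rightarrow> (real \<times> real) set" where
  "switching = (\<lambda>(\<mu>, \<eta>). {(x, y). y = x + \<eta>})"

definition region :: "nat \<Rightarrow> real \<times> real \<Rightarrow> (real \<times> real) set" where
  "region i = (\<lambda>(\<mu>, \<eta>). if i = 1 then {(x, y). y < x + \<eta>} else {(x, y). y > x + \<eta>})"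

definition nvec :: "real \<times> real" where
  "nvec = (-1, 1)"

definition equil :: "(nat \<Rightarrow> real) \<Rightarrow> nat \<Rightarrow> real \<times> real \<Rightarrow> real \<times> real" where
  "equil \<kappa> i = (\<lambda>(\<mu>, \<eta>). (1 / (1 + \<kappa> i), \<mu> / \<kappa> i))"

definition equil_admissible :: "(nat \<Rightarrow> real) \<Rightarrow> nat \<Rightarrow> real \<times> real \<Rightarrow> bool" where
  "equil_admissible \<kappa> i P \<longleftrightarrow> equil \<kappa> i P \<in> region i P"

definition crossing :: "(nat \<Rightarrow> real) \<Rightarrow> real \<times> real \<Rightarrow> (real \<times> real) set" where
  "crossing \<kappa> P = {z \<in> switching P. (vf \<kappa> 1 P z \<bullet> nvec) * (vf \<kappa> 2 P z \<bullet> nvec) > 0}"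

definition sliding :: "(nat \<Rightarrow> real) \<Rightarrow> real \<times> real \<Rightarrow> (real \<times> real) set" where
  "sliding \<kappa> P = {z \<in> switching P. (vf \<kappa> 1 P z \<bullet> nvec) * (vf \<kappa> 2 P z \<bullet> nvec) < 0}"

(* nvec points from R_1 into R_2. *)
definition attracting :: "(nat \<Rightarrow> real) \<Rightarrow> real \<times> real \<Rightarrow> bool" where
  "attracting \<kappa> P \<longleftrightarrow> sliding \<kappa> P \<noteq> {} \<and>
     (\<forall>z\<in>sliding \<kappa> P. vf \<kappa> 1 P z \<bullet> nvec > 0 \<and> vf \<kappa> 2 P z \<bullet> nvec < 0)"

definition repelling :: "(nat \<Rightarrow> real) \<Rightarrow> real \<times> real \<Rightarrow> bool" where
  "repelling \<kappa> P \<longleftrightarrow> sliding \<kappa> P \<noteq> {} \<and>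
     (\<forall>z\<in>sliding \<kappa> P. vf \<kappa> 1 P z \<bullet> nvec < 0 \<and> vf \<kappa> 2 P z \<bullet> nvec > 0)"


section \<open>Orbit segments and tangencies\<close>

definition solves :: "(real \<times> real \<Rightarrow> real \<times> real) \<Rightarrow> (real \<Rightarrow> real \<times> real) \<Rightarrow> real set \<Rightarrow> bool" where
  "solves v \<phi> T \<longleftrightarrow> (\<forall>t\<in>T. (\<phi> has_vector_derivative v (\<phi> t)) (at t within T))"

definition tangency :: "(nat \<Rightarrow> real) \<Rightarrow> nat \<Rightarrow> real \<times> real \<Rightarrow> real \<times> real" where
  "tangency \<kappa> i = (\<lambda>(\<mu>, \<eta>). (1 - \<mu> + \<eta> * \<kappa> i, 1 - \<mu> + (1 + \<kappa> i) * \<eta>))"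

definition lie_derivative ::
    "(real \<times> real \<Rightarrow> real \<times> real) \<Rightarrow> (real \<times> real \<Rightarrow> real) \<Rightarrow> real \<times> real \<Rightarrow> real" where
  "lie_derivative v h z = frechet_derivative h (at z) (v z)"

definition quadratic_tangency :: "(nat \<Rightarrow> real) \<Rightarrow> nat \<Rightarrow> real \<times> real \<Rightarrow> real \<times> real \<Rightarrow> bool" where
  "quadratic_tangency \<kappa> i P z \<longleftrightarrow>
     z \<in> switching P \<and> vf \<kappa> i P z \<bullet> nvec = 0 \<and>
     lie_derivative (vf \<kappa> i P) (\<lambda>w. vf \<kappa> i P w \<bullet> nvec) z \<noteq> 0"

definition visible :: "(nat \<Rightarrow> real) \<Rightarrow> nat \<Rightarrow> real \<times> real \<Rightarrow> real \<times> real \<Rightarrow> bool" where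
  "visible \<kappa> i P z \<longleftrightarrow>
     (\<exists>\<phi> \<epsilon>. \<epsilon> > 0 \<and> \<phi> 0 = z \<and> solves (vf \<kappa> i P) \<phi> {-\<epsilon><..<\<epsilon>} \<and>
        (\<forall>t. 0 < \<bar>t\<bar> \<and> \<bar>t\<bar> < \<epsilon> \<longrightarrow> \<phi> t \<in> region i P))"

abbreviation invisible :: "(nat \<Rightarrow> real) \<Rightarrow> nat \<Rightarrow> real \<times> real \<Rightarrow> real \<times> real \<Rightarrow> bool" where
  "invisible \<kappa> i P z \<equiv> \<not> visible \<kappa> i P z"


section \<open>Sliding vector field and pseudo-equilibria\<close>

definition sliding_weight :: "(nat \<Rightarrow> real) \<Rightarrow> real \<times> real \<Rightarrow> real \<times> real \<Rightarrow> real" where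
  "sliding_weight \<kappa> P z =
     (vf \<kappa> 1 P z \<bullet> nvec) / ((vf \<kappa> 1 P z - vf \<kappa> 2 P z) \<bullet> nvec)"

definition sliding_vf :: "(nat \<Rightarrow> real) \<Rightarrow> real \<times> real \<Rightarrow> real \<times> real \<Rightarrow> real \<times> real" where
  "sliding_vf \<kappa> P z =
     (1 - sliding_weight \<kappa> P z) *\<^sub>R vf \<kappa> 1 P z + sliding_weight \<kappa> P z *\<^sub>R vf \<kappa> 2 P z"

(* Zero of the sliding vector field, with its formula extended to all of the switching manifold;
   the second conjunct says that this formula makes sense. *)
definition pseudo_equilibrium :: "(nat \<Rightarrow> real) \<Rightarrow> real \<times> real \<Rightarrow> real \<times> real \<Rightarrow> bool" where
  "pseudo_equilibrium \<kappa> P z \<longleftrightarrow>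
     z \<in> switching P \<and> (vf \<kappa> 1 P z - vf \<kappa> 2 P z) \<bullet> nvec \<noteq> 0 \<and> sliding_vf \<kappa> P z = 0"

definition discr :: "real \<times> real \<Rightarrow> real" where
  "discr = (\<lambda>(\<mu>, \<eta>). (\<eta> + \<mu> + 1)\<^sup>2 - 4 * \<mu>)"

(* q^+ is pseudo_eq 1 and q^- is pseudo_eq (-1); meaningful only if the discriminant is
   non-negative. *)
definition pseudo_eq :: "real \<Rightarrow> real \<times> real \<Rightarrow> real \<times> real" where
  "pseudo_eq s = (\<lambda>(\<mu>, \<eta>).
     (1 / 2 * (1 - \<mu> - \<eta> + s * sqrt (discr (\<mu>, \<eta>)))) *\<^sub>R (1, 1) + (0, \<eta>))"

definition pseudo_admissible :: "(nat \<Rightarrow> real) \<Rightarrow> real \<Rightarrow> real \<times> real \<Rightarrow> bool" where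
  "pseudo_admissible \<kappa> s P \<longleftrightarrow>
     pseudo_equilibrium \<kappa> P (pseudo_eq s P) \<and> pseudo_eq s P \<in> sliding \<kappa> P"

lemma vf_eq_0_iff:
  assumes "\<kappa> i > 0"
  shows "vf \<kappa> i P z = 0 \<longleftrightarrow> z = equil \<kappa> i P"
  using assms by (auto simp: vf_def equil_def zero_prod_def field_simps split: prod.splits)

lemma tangency_iff:
  "z \<in> switching P \<and> vf \<kappa> i P z \<bullet> nvec = 0 \<longleftrightarrow> z = tangency \<kappa> i P"
proof -
  obtain \<mu> \<eta> x y where "P = (\<mu>, \<eta>)" "z = (x, y)" by (metis surj_pair)
  moreover have "vf \<kappa> i (\<mu>, \<eta>) (x, x + \<eta>) \<bullet> nvec = x - (1 - \<mu> + \<eta> * \<kappa> i)"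
    by (simp add: vf_def nvec_def algebra_simps)
  ultimately show ?thesis
    by (cases "y = x + \<eta>") (auto simp: switching_def tangency_def algebra_simps)
qed

lemma sliding_weight_bounds:
  assumes "z \<in> sliding \<kappa> P"
  shows "sliding_weight \<kappa> P z \<in> {0..1}" and "sliding_vf \<kappa> P z \<bullet> nvec = 0"
proof -
  define a b where "a = vf \<kappa> 1 P z \<bullet> nvec" and "b = vf \<kappa> 2 P z \<bullet> nvec"
  have ab: "a * b < 0" using assms by (simp add: sliding_def a_def b_def)
  have w: "sliding_weight \<kappa> P z = a / (a - b)"
    by (simp add: sliding_weight_def a_def b_def inner_diff_left)
  show "sliding_weight \<kappa> P z \<in> {0..1}"
    using ab unfolding w by (auto simp: mult_less_0_iff divide_simps)
  have "sliding_vf \<kappa> P z \<bullet> nvec = (1 - a / (a - b)) * a + a / (a - b) * b"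
    by (simp add: sliding_vf_def w inner_add_left del: One_nat_def flip: a_def b_def)
  also have "\<dots> = 0"
  proof -
    have "a - b \<noteq> 0" using ab by (auto simp: mult_less_0_iff)
    then show ?thesis by (simp add: field_simps)
  qed
  finally show "sliding_vf \<kappa> P z \<bullet> nvec = 0" .
qed

lemma pseudo_equilibrium_iff:
  assumes "\<kappa> 1 \<noteq> \<kappa> 2" "snd P \<noteq> 0"
  shows "pseudo_equilibrium \<kappa> P z \<longleftrightarrow>
           discr P \<ge> 0 \<and> (z = pseudo_eq 1 P \<or> z = pseudo_eq (-1) P)"
proof -
  obtain \<mu> \<eta> where P: "P = (\<mu>, \<eta>)" by force
  obtain x y where z: "z = (x, y)" by force
  have \<eta>: "\<eta> \<noteq> 0" using assms P by simp
  show ?thesis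
  proof (cases "y = x + \<eta>")
    case False
    then show ?thesis
      by (auto simp: P z pseudo_equilibrium_def switching_def pseudo_eq_def)
  next
    case True
    have a: "vf \<kappa> 1 P z \<bullet> nvec = x - 1 + \<mu> - \<kappa> 1 * \<eta>"
      and b: "vf \<kappa> 2 P z \<bullet> nvec = x - 1 + \<mu> - \<kappa> 2 * \<eta>"
      by (simp_all add: P z True vf_def nvec_def algebra_simps del: One_nat_def)
    have d: "(vf \<kappa> 1 P z - vf \<kappa> 2 P z) \<bullet> nvec = (\<kappa> 2 - \<kappa> 1) * \<eta>"
      by (simp add: inner_diff_left a b algebra_simps del: One_nat_def)
    define D where "D = (\<kappa> 2 - \<kappa> 1) * \<eta>"
    have D: "D \<noteq> 0" using assms \<eta> by (simp add: D_def)
    define w where "w = sliding_weight \<kappa> P z"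
    have w: "w * D = x - 1 + \<mu> - \<kappa> 1 * \<eta>"
      using D by (simp add: w_def sliding_weight_def a d del: One_nat_def flip: D_def)
    define G where "G = x\<^sup>2 - (1 - \<mu> - \<eta>) * x - \<eta>"
    have sv: "sliding_vf \<kappa> P z =
        ((1 - w) * (1 - (1 + \<kappa> 1) * x) + w * (1 - (1 + \<kappa> 2) * x),
         (1 - w) * (\<mu> - \<kappa> 1 * y) + w * (\<mu> - \<kappa> 2 * y))"
      by (simp add: sliding_vf_def P z vf_def w_def)
    have s1: "D * fst (sliding_vf \<kappa> P z) = - (\<kappa> 2 - \<kappa> 1) * G"
    proof -
      have "D * fst (sliding_vf \<kappa> P z) =
          D * (1 - (1 + \<kappa> 1) * x) - (w * D) * ((\<kappa> 2 - \<kappa> 1) * x)"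
        unfolding sv by (simp add: algebra_simps)
      also have "\<dots> = D * (1 - (1 + \<kappa> 1) * x) -
          (x - 1 + \<mu> - \<kappa> 1 * \<eta>) * ((\<kappa> 2 - \<kappa> 1) * x)"
        by (simp only: w)
      also have "\<dots> = - (\<kappa> 2 - \<kappa> 1) * G"
        by (simp add: D_def G_def algebra_simps power2_eq_square)
      finally show ?thesis .
    qed
    have s2: "D * snd (sliding_vf \<kappa> P z) = - (\<kappa> 2 - \<kappa> 1) * G"
    proof -
      have "D * snd (sliding_vf \<kappa> P z) =
          D * (\<mu> - \<kappa> 1 * y) - (w * D) * ((\<kappa> 2 - \<kappa> 1) * y)"
        unfolding sv by (simp add: algebra_simps)
      also have "\<dots> = D * (\<mu> - \<kappa> 1 * y) -
          (x - 1 + \<mu> - \<kappa> 1 * \<eta>) * ((\<kappa> 2 - \<kappa> 1) * y)"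
        by (simp only: w)
      also have "\<dots> = - (\<kappa> 2 - \<kappa> 1) * G"
        by (simp add: D_def G_def True algebra_simps power2_eq_square)
      finally show ?thesis .
    qed
    have zero: "sliding_vf \<kappa> P z = 0 \<longleftrightarrow> G = 0"
    proof
      assume "sliding_vf \<kappa> P z = 0"
      then show "G = 0" using s1 assms(1) by (auto simp: zero_prod_def)
    next
      assume "G = 0"
      then show "sliding_vf \<kappa> P z = 0" using s1 s2 D by (simp add: prod_eq_iff)
    qed
    have "4 * G = (2 * x - (1 - \<mu> - \<eta>))\<^sup>2 - discr P"
      by (simp add: P discr_def G_def power2_eq_square algebra_simps)
    then have "G = 0 \<longleftrightarrow> (2 * x - (1 - \<mu> - \<eta>))\<^sup>2 = discr P" by auto
    also have "\<dots> \<longleftrightarrow> discr P \<ge> 0 \<and>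
        (2 * x - (1 - \<mu> - \<eta>) = sqrt (discr P) \<or> 2 * x - (1 - \<mu> - \<eta>) = - sqrt (discr P))"
    proof (cases "discr P \<ge> 0")
      case True
      then have "(2 * x - (1 - \<mu> - \<eta>))\<^sup>2 = discr P \<longleftrightarrow>
          (2 * x - (1 - \<mu> - \<eta>))\<^sup>2 = (sqrt (discr P))\<^sup>2" by simp
      then show ?thesis using True by (simp only: power2_eq_iff simp_thms)
    next
      case False
      have "(2 * x - (1 - \<mu> - \<eta>))\<^sup>2 \<ge> 0" by simp
      then show ?thesis using False by linarith
    qed
    finally have "G = 0 \<longleftrightarrow> discr P \<ge> 0 \<and>
        (2 * x - (1 - \<mu> - \<eta>) = sqrt (discr P) \<or> 2 * x - (1 - \<mu> - \<eta>) = - sqrt (discr P))" .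
    moreover have "pseudo_equilibrium \<kappa> P z \<longleftrightarrow> sliding_vf \<kappa> P z = 0"
      using D True unfolding pseudo_equilibrium_def d D_def[symmetric]
      by (simp add: switching_def P z)
    moreover have "z = pseudo_eq s P \<longleftrightarrow> 2 * x - (1 - \<mu> - \<eta>) = s * sqrt (discr P)" for s
      by (simp add: P z True pseudo_eq_def field_simps)
    ultimately show ?thesis
      using zero by simp
  qed
qed


section \<open>Piecewise-smooth orbits and the periodic orbit\<close>

definition traverses ::
    "(real \<times> real \<Rightarrow> real \<times> real) \<Rightarrow> (real \<times> real) set \<Rightarrow> (real \<Rightarrow> real \<times> real) \<Rightarrow> real set \<Rightarrow> bool" where
  "traverses v A \<phi> T \<longleftrightarrow> \<phi> ` T \<subseteq> A \<and> solves v \<phi> T"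

(* Forward orbit; T contains the times at which one orbit segment is followed by the next. *)
definition pws_orbit :: "(nat \<Rightarrow> real) \<Rightarrow> real \<times> real \<Rightarrow> (real \<Rightarrow> real \<times> real) \<Rightarrow> bool" where
  "pws_orbit \<kappa> P \<phi> \<longleftrightarrow>
     continuous_on {0..} \<phi> \<and>
     (\<exists>T. (\<forall>t. finite (T \<inter> {0..t})) \<and>
        (\<forall>s t. 0 \<le> s \<and> s < t \<and> T \<inter> {s<..<t} = {} \<longrightarrow>
           traverses (vf \<kappa> 1 P) (region 1 P) \<phi> {s<..<t} \<or>
           traverses (vf \<kappa> 2 P) (region 2 P) \<phi> {s<..<t} \<or>
           traverses (sliding_vf \<kappa> P) (sliding \<kappa> P) \<phi> {s<..<t}))"

definition crossing_periodic_orbit ::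
    "(nat \<Rightarrow> real) \<Rightarrow> real \<times> real \<Rightarrow> (real \<times> real) set \<Rightarrow> bool" where
  "crossing_periodic_orbit \<kappa> P G \<longleftrightarrow>
     (\<exists>\<phi>\<^sub>1 \<phi>\<^sub>2 \<tau>\<^sub>1 \<tau>\<^sub>2. \<tau>\<^sub>1 > 0 \<and> \<tau>\<^sub>2 > 0 \<and>
        solves (vf \<kappa> 1 P) \<phi>\<^sub>1 {0..\<tau>\<^sub>1} \<and> \<phi>\<^sub>1 ` {0<..<\<tau>\<^sub>1} \<subseteq> region 1 P \<and>
        solves (vf \<kappa> 2 P) \<phi>\<^sub>2 {0..\<tau>\<^sub>2} \<and> \<phi>\<^sub>2 ` {0<..<\<tau>\<^sub>2} \<subseteq> region 2 P \<and>
        \<phi>\<^sub>1 \<tau>\<^sub>1 = \<phi>\<^sub>2 0 \<and> \<phi>\<^sub>1 \<tau>\<^sub>1 \<in> crossing \<kappa> P \<and>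
        \<phi>\<^sub>2 \<tau>\<^sub>2 = \<phi>\<^sub>1 0 \<and> \<phi>\<^sub>2 \<tau>\<^sub>2 \<in> crossing \<kappa> P \<and>
        G = \<phi>\<^sub>1 ` {0..\<tau>\<^sub>1} \<union> \<phi>\<^sub>2 ` {0..\<tau>\<^sub>2})"

(* Asymptotic orbital stability. *)
definition stable_set :: "(nat \<Rightarrow> real) \<Rightarrow> real \<times> real \<Rightarrow> (real \<times> real) set \<Rightarrow> bool" where
  "stable_set \<kappa> P G \<longleftrightarrow>
     (\<forall>\<epsilon>>0. \<exists>\<delta>>0. \<forall>\<phi>. pws_orbit \<kappa> P \<phi> \<and> infdist (\<phi> 0) G < \<delta> \<longrightarrow>
        (\<forall>t\<ge>0. infdist (\<phi> t) G < \<epsilon>)) \<and>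
     (\<exists>\<delta>>0. \<forall>\<phi>. pws_orbit \<kappa> P \<phi> \<and> infdist (\<phi> 0) G < \<delta> \<longrightarrow>
        ((\<lambda>t. infdist (\<phi> t) G) \<longlongrightarrow> 0) at_top)"

definition is_Gamma :: "(nat \<Rightarrow> real) \<Rightarrow> real \<times> real \<Rightarrow> (real \<times> real) set \<Rightarrow> bool" where
  "is_Gamma \<kappa> P G \<longleftrightarrow>
     crossing_periodic_orbit \<kappa> P G \<and> stable_set \<kappa> P G \<and>
     repelling \<kappa> P \<and> sliding \<kappa> P \<subseteq> inside G"

definition Gamma_region :: "(nat \<Rightarrow> real) \<Rightarrow> (real \<times> real) set" where
  "Gamma_region \<kappa> =
     {(\<mu>, \<eta>). \<eta> < 0 \<and> \<mu> / \<kappa> 2 - 1 / (1 + \<kappa> 2) < \<eta> \<and> \<eta> < \<mu> / \<kappa> 1 - 1 / (1 + \<kappa> 1)}"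

(* Next to the boundary point P of the region, the periodic orbit exists, and is unique, on the
   side of the region, while there is no crossing periodic orbit at all on the other side. *)
definition Gamma_disappears :: "(nat \<Rightarrow> real) \<Rightarrow> real \<times> real \<Rightarrow> bool" where
  "Gamma_disappears \<kappa> P \<longleftrightarrow>
     P \<in> frontier (Gamma_region \<kappa>) \<and>
     (\<forall>\<^sub>F Q in nhds P.
        (Q \<in> Gamma_region \<kappa> \<longrightarrow> (\<exists>!G. is_Gamma \<kappa> Q G)) \<and>
        (Q \<notin> Gamma_region \<kappa> \<longrightarrow> (\<nexists>G. crossing_periodic_orbit \<kappa> Q G)))"


section \<open>Fold-fold bifurcations\<close>

definition fold_fold :: "(nat \<Rightarrow> real) \<Rightarrow> real \<times> real \<Rightarrow> bool" where
  "fold_fold \<kappa> P \<longleftrightarrow> tangency \<kappa> 1 P = tangency \<kappa> 2 P \<and>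
     (\<forall>i\<in>{1, 2}. quadratic_tangency \<kappa> i P (tangency \<kappa> i P))"

definition fold_fold_VI1 :: "(nat \<Rightarrow> real) \<Rightarrow> real \<times> real \<Rightarrow> bool" where
  "fold_fold_VI1 \<kappa> P \<longleftrightarrow> fold_fold \<kappa> P \<and>
     (\<exists>i\<in>{1, 2}. visible \<kappa> i P (tangency \<kappa> i P) \<and>
        invisible \<kappa> (3 - i) P (tangency \<kappa> (3 - i) P)) \<and>
     (\<exists>r>0. vf \<kappa> 1 P (tangency \<kappa> 1 P) = r *\<^sub>R vf \<kappa> 2 P (tangency \<kappa> 2 P))"

definition fused_focus :: "(nat \<Rightarrow> real) \<Rightarrow> real \<times> real \<Rightarrow> bool" where
  "fused_focus \<kappa> P \<longleftrightarrow> fold_fold \<kappa> P \<and>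
     (\<forall>i\<in>{1, 2}. invisible \<kappa> i P (tangency \<kappa> i P)) \<and>
     (\<exists>r<0. vf \<kappa> 1 P (tangency \<kappa> 1 P) = r *\<^sub>R vf \<kappa> 2 P (tangency \<kappa> 2 P))"

(* The two sides of the bifurcation are eta < 0 and eta > 0. *)
definition sliding_reversal :: "(nat \<Rightarrow> real) \<Rightarrow> real \<times> real \<Rightarrow> bool" where
  "sliding_reversal \<kappa> P \<longleftrightarrow>
     (\<forall>\<^sub>F Q in nhds P. snd Q \<noteq> 0 \<longrightarrow>
        (\<forall>i\<in>{1, 2}. quadratic_tangency \<kappa> i Q (tangency \<kappa> i Q)) \<and>
        sliding \<kappa> Q = open_segment (tangency \<kappa> 1 Q) (tangency \<kappa> 2 Q) \<and>
        (snd Q < 0 \<longrightarrow> repelling \<kappa> Q \<and> fst (tangency \<kappa> 2 Q) < fst (tangency \<kappa> 1 Q)) \<and>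
        (snd Q > 0 \<longrightarrow> attracting \<kappa> Q \<and> fst (tangency \<kappa> 1 Q) < fst (tangency \<kappa> 2 Q)))"


section \<open>Boundary equilibrium bifurcations\<close>

definition boundary_equilibrium :: "(nat \<Rightarrow> real) \<Rightarrow> nat \<Rightarrow> real \<times> real \<Rightarrow> bool" where
  "boundary_equilibrium \<kappa> i P \<longleftrightarrow> equil \<kappa> i P = tangency \<kappa> i P"

definition persistence :: "(nat \<Rightarrow> real) \<Rightarrow> nat \<Rightarrow> real \<times> real \<Rightarrow> bool" where
  "persistence \<kappa> i P \<longleftrightarrow> boundary_equilibrium \<kappa> i P \<and>
     (\<exists>\<^sub>F Q in at P. equil_admissible \<kappa> i Q) \<and>
     (\<exists>\<^sub>F Q in at P. \<not> boundary_equilibrium \<kappa> i Q \<and> \<not> equil_admissible \<kappa> i Q) \<and>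
     (\<exists>s\<in>{1, -1}. pseudo_eq s P = tangency \<kappa> i P \<and> isCont (pseudo_eq s) P \<and>
        (\<forall>\<^sub>F Q in at P. \<not> boundary_equilibrium \<kappa> i Q \<longrightarrow>
           (equil_admissible \<kappa> i Q \<longleftrightarrow> \<not> pseudo_admissible \<kappa> s Q)))"

definition nonsmooth_fold :: "(nat \<Rightarrow> real) \<Rightarrow> nat \<Rightarrow> real \<times> real \<Rightarrow> bool" where
  "nonsmooth_fold \<kappa> i P \<longleftrightarrow> boundary_equilibrium \<kappa> i P \<and>
     (\<exists>\<^sub>F Q in at P. equil_admissible \<kappa> i Q) \<and>
     (\<exists>\<^sub>F Q in at P. \<not> boundary_equilibrium \<kappa> i Q \<and> \<not> equil_admissible \<kappa> i Q) \<and>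
     (\<exists>s\<in>{1, -1}. pseudo_eq s P = tangency \<kappa> i P \<and> isCont (pseudo_eq s) P \<and>
        (\<forall>\<^sub>F Q in at P. \<not> boundary_equilibrium \<kappa> i Q \<longrightarrow>
           (equil_admissible \<kappa> i Q \<longleftrightarrow> pseudo_admissible \<kappa> s Q)))"

definition node :: "(nat \<Rightarrow> real) \<Rightarrow> nat \<Rightarrow> real \<times> real \<Rightarrow> bool" where
  "node \<kappa> i P \<longleftrightarrow>
     (\<exists>a b u w. a \<noteq> b \<and> a * b > 0 \<and> u \<noteq> 0 \<and> w \<noteq> 0 \<and>
        frechet_derivative (vf \<kappa> i P) (at (equil \<kappa> i P)) u = a *\<^sub>R u \<and>
        frechet_derivative (vf \<kappa> i P) (at (equil \<kappa> i P)) w = b *\<^sub>R w)"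

(* Time starts at the boundary equilibrium: it is a zero of f_i only, and the orbit leaves it
   along the other vector field in finite time. *)
definition homoclinic_orbit ::
    "(nat \<Rightarrow> real) \<Rightarrow> nat \<Rightarrow> real \<times> real \<Rightarrow> (real \<Rightarrow> real \<times> real) \<Rightarrow> bool" where
  "homoclinic_orbit \<kappa> i P \<phi> \<longleftrightarrow>
     pws_orbit \<kappa> P \<phi> \<and> \<phi> 0 = equil \<kappa> i P \<and> (\<forall>t>0. \<phi> t \<noteq> equil \<kappa> i P) \<and>
     (\<phi> \<longlongrightarrow> equil \<kappa> i P) at_top \<and>
     (\<forall>t\<ge>0. \<phi> t \<notin> sliding \<kappa> P) \<and> (\<exists>t>0. \<phi> t \<in> crossing \<kappa> P)"

(* The periodic orbits converge to the homoclinic orbit in the Hausdorff distance. *)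
definition homoclinic_like :: "(nat \<Rightarrow> real) \<Rightarrow> nat \<Rightarrow> real \<times> real \<Rightarrow> bool" where
  "homoclinic_like \<kappa> i P \<longleftrightarrow> boundary_equilibrium \<kappa> i P \<and>
     (\<exists>\<phi>. homoclinic_orbit \<kappa> i P \<phi> \<and>
        (\<forall>\<epsilon>>0. \<forall>\<^sub>F Q in at P within Gamma_region \<kappa>. \<exists>G. is_Gamma \<kappa> Q G \<and>
           (\<forall>z\<in>G. infdist z (\<phi> ` {0..}) < \<epsilon>) \<and> (\<forall>z\<in>\<phi> ` {0..}. infdist z G < \<epsilon>)))"

(* Generic boundary equilibrium bifurcation of a nodal equilibrium: the usual nondegeneracy
   conditions (the other vector field is transversal to the switching manifold; n . A^{-1} f_j
   is non-zero, A being the Jacobian matrix of f_i; the equilibrium passes through the switching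
   manifold with non-zero speed as the parameters vary), and, unlike in the homoclinic-like case,
   neither homoclinic nor crossing periodic orbits are involved. *)
definition standard_nodal :: "(nat \<Rightarrow> real) \<Rightarrow> nat \<Rightarrow> real \<times> real \<Rightarrow> bool" where
  "standard_nodal \<kappa> i P \<longleftrightarrow> boundary_equilibrium \<kappa> i P \<and> node \<kappa> i P \<and>
     vf \<kappa> (3 - i) P (equil \<kappa> i P) \<bullet> nvec \<noteq> 0 \<and>
     (\<exists>v. frechet_derivative (vf \<kappa> i P) (at (equil \<kappa> i P)) v = vf \<kappa> (3 - i) P (equil \<kappa> i P) \<and>
        v \<bullet> nvec \<noteq> 0) \<and>
     (\<exists>D. ((\<lambda>Q. equil \<kappa> i Q \<bullet> nvec - snd Q) has_derivative D) (at P) \<and> D \<noteq> (\<lambda>_. 0)) \<and>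
     (\<nexists>\<phi>. homoclinic_orbit \<kappa> i P \<phi>) \<and>
     (\<forall>\<^sub>F Q in nhds P. \<nexists>G. crossing_periodic_orbit \<kappa> Q G)"


section \<open>Codimension-two bifurcations\<close>

definition fold_boundary_equilibrium :: "(nat \<Rightarrow> real) \<Rightarrow> nat \<Rightarrow> real \<times> real \<Rightarrow> bool" where
  "fold_boundary_equilibrium \<kappa> i P \<longleftrightarrow>
     tangency \<kappa> 1 P = tangency \<kappa> 2 P \<and> equil \<kappa> i P = tangency \<kappa> i P"

definition double_boundary_equilibrium :: "(nat \<Rightarrow> real) \<Rightarrow> real \<times> real \<Rightarrow> bool" where
  "double_boundary_equilibrium \<kappa> P \<longleftrightarrow> equil \<kappa> 1 P \<noteq> equil \<kappa> 2 P \<and>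
     boundary_equilibrium \<kappa> 1 P \<and> boundary_equilibrium \<kappa> 2 P"

(* At the collision itself f_i vanishes at the tangency point, whose second Lie derivative is
   therefore zero there: it is a quadratic tangency for the nearby parameters without collision. *)
definition collides_with_quadratic_tangency :: "(nat \<Rightarrow> real) \<Rightarrow> nat \<Rightarrow> real \<times> real \<Rightarrow> bool" where
  "collides_with_quadratic_tangency \<kappa> i P \<longleftrightarrow> equil \<kappa> i P = tangency \<kappa> i P \<and>
     (\<exists>\<^sub>F Q in at P. equil \<kappa> i Q \<noteq> tangency \<kappa> i Q) \<and>
     (\<forall>\<^sub>F Q in at P. equil \<kappa> i Q \<noteq> tangency \<kappa> i Q \<longrightarrow>
        quadratic_tangency \<kappa> i Q (tangency \<kappa> i Q))"

(* The sliding vector field in the coordinate x of the switching manifold. *)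
definition sliding_speed :: "(nat \<Rightarrow> real) \<Rightarrow> real \<times> real \<Rightarrow> real \<Rightarrow> real" where
  "sliding_speed \<kappa> P x = fst (sliding_vf \<kappa> P (x, x + snd P))"

(* q^- and q^+ coalesce at z; nearby there are either exactly two pseudo-equilibria close to z,
   of opposite stability along the switching manifold, or none. *)
definition pseudo_saddle_node :: "(nat \<Rightarrow> real) \<Rightarrow> real \<times> real \<Rightarrow> real \<times> real \<Rightarrow> bool" where
  "pseudo_saddle_node \<kappa> P z \<longleftrightarrow>
     pseudo_equilibrium \<kappa> P z \<and> pseudo_eq 1 P = z \<and> pseudo_eq (-1) P = z \<and>
     (\<exists>\<^sub>F Q in at P. discr Q < 0) \<and> (\<exists>\<^sub>F Q in at P. discr Q > 0) \<and>
     (\<forall>\<epsilon>>0. \<forall>\<^sub>F Q in at P.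
        (discr Q < 0 \<longrightarrow> {w \<in> ball z \<epsilon>. pseudo_equilibrium \<kappa> Q w} = {}) \<and>
        (discr Q > 0 \<longrightarrow>
           {w \<in> ball z \<epsilon>. pseudo_equilibrium \<kappa> Q w} = {pseudo_eq 1 Q, pseudo_eq (-1) Q} \<and>
           pseudo_eq 1 Q \<noteq> pseudo_eq (-1) Q \<and>
           deriv (sliding_speed \<kappa> Q) (fst (pseudo_eq 1 Q)) *
             deriv (sliding_speed \<kappa> Q) (fst (pseudo_eq (-1) Q)) < 0))"

definition generalised_boundary_equilibrium :: "(nat \<Rightarrow> real) \<Rightarrow> nat \<Rightarrow> real \<times> real \<Rightarrow> bool" where
  "generalised_boundary_equilibrium \<kappa> i P \<longleftrightarrow>
     boundary_equilibrium \<kappa> i P \<and> pseudo_saddle_node \<kappa> P (tangency \<kappa> i P)"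


section \<open>Bifurcation points, curves and segments in the parameter plane\<close>

definition FB :: "(nat \<Rightarrow> real) \<Rightarrow> nat \<Rightarrow> real \<times> real" where
  "FB \<kappa> i = (\<kappa> i / (1 + \<kappa> i), 0)"

definition BB :: "(nat \<Rightarrow> real) \<Rightarrow> real \<times> real" where
  "BB \<kappa> = (\<kappa> 1 * \<kappa> 2 / ((\<kappa> 1 + 1) * (\<kappa> 2 + 1)), -1 / ((\<kappa> 1 + 1) * (\<kappa> 2 + 1)))"

definition GB :: "(nat \<Rightarrow> real) \<Rightarrow> nat \<Rightarrow> real \<times> real" where
  "GB \<kappa> i = ((\<kappa> i)\<^sup>2 / (\<kappa> i + 1)\<^sup>2, - (1 / (\<kappa> i + 1)\<^sup>2))"

definition BE :: "(nat \<Rightarrow> real) \<Rightarrow> nat \<Rightarrow> (real \<times> real) set" where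
  "BE \<kappa> i = {(\<mu>, \<eta>). \<eta> = \<mu> / \<kappa> i - 1 / (1 + \<kappa> i)}"

definition FF :: "(real \<times> real) set" where
  "FF = {(\<mu>, \<eta>). \<eta> = 0}"

definition PS :: "(nat \<Rightarrow> real) \<Rightarrow> (real \<times> real) set" where
  "PS \<kappa> = {(\<mu>, \<eta>). \<eta> = - (\<mu> + 1) + 2 * sqrt \<mu> \<and>
     (\<kappa> 1)\<^sup>2 / (\<kappa> 1 + 1)\<^sup>2 < \<mu> \<and> \<mu> < (\<kappa> 2)\<^sup>2 / (\<kappa> 2 + 1)\<^sup>2}"

definition FF1 :: "(nat \<Rightarrow> real) \<Rightarrow> (real \<times> real) set" where
  "FF1 \<kappa> = {P \<in> FF. fst P < \<kappa> 1 / (1 + \<kappa> 1)}"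

definition FU :: "(nat \<Rightarrow> real) \<Rightarrow> (real \<times> real) set" where
  "FU \<kappa> = {P \<in> FF. fst (FB \<kappa> 1) < fst P \<and> fst P < fst (FB \<kappa> 2)}"

definition FF2 :: "(nat \<Rightarrow> real) \<Rightarrow> (real \<times> real) set" where
  "FF2 \<kappa> = {P \<in> FF. fst P > \<kappa> 2 / (1 + \<kappa> 2)}"

(* Trailing P and F: persistence and non-smooth fold type; hat, tilde: decoration of BE. *)
definition BE_P :: "(nat \<Rightarrow> real) \<Rightarrow> nat \<Rightarrow> (real \<times> real) set" where
  "BE_P \<kappa> i = {P \<in> BE \<kappa> i. snd P > 0}"

definition BE_hat_P :: "(nat \<Rightarrow> real) \<Rightarrow> nat \<Rightarrow> (real \<times> real) set" where
  "BE_hat_P \<kappa> i =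
     {P \<in> BE \<kappa> i. snd (if i = 1 then BB \<kappa> else GB \<kappa> 2) < snd P \<and> snd P < snd (FB \<kappa> i)}"

definition BE1_tilde_P :: "(nat \<Rightarrow> real) \<Rightarrow> (real \<times> real) set" where
  "BE1_tilde_P \<kappa> = {P \<in> BE \<kappa> 1. snd (GB \<kappa> 1) < snd P \<and> snd P < snd (BB \<kappa>)}"

definition BE1_F :: "(nat \<Rightarrow> real) \<Rightarrow> (real \<times> real) set" where
  "BE1_F \<kappa> = {P \<in> BE \<kappa> 1. snd P < snd (GB \<kappa> 1)}"

definition BE2_hat_F :: "(nat \<Rightarrow> real) \<Rightarrow> (real \<times> real) set" where
  "BE2_hat_F \<kappa> = {P \<in> BE \<kappa> 2. snd (BB \<kappa>) < snd P \<and> snd P < snd (GB \<kappa> 2)}"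

definition BE2_F :: "(nat \<Rightarrow> real) \<Rightarrow> (real \<times> real) set" where
  "BE2_F \<kappa> = {P \<in> BE \<kappa> 2. snd P < snd (BB \<kappa>)}"

lemma BE_iff:
  assumes "\<kappa> i > 0"
  shows "P \<in> BE \<kappa> i \<longleftrightarrow> boundary_equilibrium \<kappa> i P"
proof -
  obtain \<mu> \<eta> where P: "P = (\<mu>, \<eta>)" by force
  define k where "k = \<kappa> i"
  have k: "k > 0" using assms by (simp add: k_def)
  define a where "a = 1 / (1 + k)"
  define m where "m = \<mu> / k"
  have ka: "k * a = 1 - a" and km: "k * m = \<mu>" using k by (simp_all add: a_def m_def field_simps)
  have "a = 1 - \<mu> + \<eta> * k \<longleftrightarrow> k * (\<eta> - (m - a)) = 0"
    using ka km unfolding right_diff_distrib by (simp only: mult.commute) linarith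
  moreover have "m = 1 - \<mu> + (1 + k) * \<eta> \<longleftrightarrow> (1 + k) * (\<eta> - (m - a)) = 0"
    using ka km unfolding right_diff_distrib distrib_right by linarith
  ultimately show ?thesis
    using k by (auto simp: P BE_def boundary_equilibrium_def equil_def tangency_def
        simp flip: k_def a_def m_def)
qed

lemma FF_iff:
  assumes "\<kappa> 1 \<noteq> \<kappa> 2"
  shows "P \<in> FF \<longleftrightarrow> tangency \<kappa> 1 P = tangency \<kappa> 2 P"
  using assms by (auto simp: FF_def tangency_def split: prod.splits)

(* Near P, removing P from the curve C leaves exactly the two pieces S and T. *)
definition divides_locally ::
    "real \<times> real \<Rightarrow> (real \<times> real) set \<Rightarrow> (real \<times> real) set \<Rightarrow> (real \<times> real) set \<Rightarrow> bool" where
  "divides_locally P C S T \<longleftrightarrow> P \<in> C \<and>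
     (\<forall>\<^sub>F \<epsilon> in at_right 0. S \<inter> ball P \<epsilon> \<noteq> T \<inter> ball P \<epsilon> \<and>
        components (C \<inter> ball P \<epsilon> - {P}) = {S \<inter> ball P \<epsilon>, T \<inter> ball P \<epsilon>})"

end

(* Reflecting region 1 in p_1 puts both fields into one normal form: a node with rates 1 + k and k,
   the half-plane Y - X > e, and e > 0 exactly when the equilibrium is not admissible.  An orbit
   leaving the line Y = X + e at X = a returns iff a = e g(t) for some t > 0, then after time t and at
   X = e g(-t), where g(t) = (exp (k t) - 1) / (1 - exp (-t)).  As g(t) + g(-t) + 1 =
   sinh ((2 k + 1) t / 2) / sinh (t / 2) is increasing, the half-return map h is decreasing while
   a + h(a) is increasing: the midpoint of a chord moves monotonically with its length, in opposite
   directions for the two fields.  Hence a crossing periodic orbit is unique, exists iff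
   k_1 e_1 + k_2 e_2 lies below the distance of the abscissae of the equilibria (that is, eta < 0),
   and attracts, because h is non-expanding.  When one e_i tends to 0 the return point of the other
   field is squeezed towards p_i, so the periodic orbit tends to the homoclinic one.
   For the boundary equilibrium bifurcations the quadratic equation of the pseudo-equilibria,
   evaluated at the tangency point F_i, equals a multiple of eta e_i. *)
theory Submission
  imports Defs
begin

text \<open>The flight time solves a transcendental equation. It therefore serves as the parameter:
  launch and landing become explicit functions of \<open>t\<close> and \<open>- t\<close>, and
  claims about the half-return map turn into monotonicity claims about exponentials, with slope
  bounds obtained without differentiating the map. Stability quantifies over all piecewise-smooth
  orbits, and these need not be unique forward in time on the switching manifold, above all on a
  repelling sliding segment. So orbits near the cycle have to be shown to launch only beyond the
  tangency of the other field, where the continuation is forced. Which arc a nearby point lies on is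
  read off from a first integral of each field. Enclosure of the sliding segment uses that x is
  monotone along each arc, so the cycle bounds the domain between two graphs. In the homoclinic
  limit nothing bounds the flight time of the field whose equilibrium reaches the boundary. That arc
  is compared with the homoclinic tail at equal times, where the flow does not expand
  distances.\<close>

(* simp would otherwise turn the index 1 into Suc 0 *)
declare One_nat_def [simp del, symmetric, simp]

text \<open>At \<open>t = 0\<close> this is the junk value 0, while the limit is \<open>k\<close>.\<close>
definition transit :: "real \<Rightarrow> real \<Rightarrow> real" where
  "transit k = (\<lambda>t. (exp (k * t) - 1) / (1 - exp (- t)))"

section \<open>Transit function, flight time and half-return map\<close>

lemma one_minus_exp_minus_less: "1 - exp (- t) < t" if "t \<noteq> 0" for t :: real
  using exp_minus_greater[of t] that by linarith

lemma exp_diff_one_gt: "t < exp t - 1" if "t \<noteq> 0" for t :: real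
  using exp_minus_greater[of "-t"] that by simp

text \<open>Both exponentials are compared with their tangent lines at 0: the denominator lies below
  \<open>t\<close>, the numerator above \<open>k * t\<close>. The bound \<open>k\<close> is the
  limit at 0 and will be the tangency coordinate divided by the excess.\<close>

lemma transit_gt:
  assumes "k > 0" "t > 0" shows "transit k t > k"
proof -
  have "k * (1 - exp (- t)) < k * t"
    using one_minus_exp_minus_less[of t] assms by simp
  also have "\<dots> < exp (k * t) - 1"
    using exp_diff_one_gt[of "k * t"] assms by simp
  finally show ?thesis using assms by (simp add: transit_def pos_less_divide_eq)
qed

text \<open>The factor \<open>exp (- (1 + k) * t)\<close> is the decay of the abscissa during time
  \<open>t\<close>; this is why a launch at \<open>e * transit k t\<close> lands at
  \<open>e * transit k (- t)\<close>.\<close>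

lemma transit_minus:
  assumes "t \<noteq> 0" shows "transit k (- t) = transit k t * exp (- (1 + k) * t)"
proof -
  have "1 - exp t \<noteq> 0" "1 - exp (-t) \<noteq> 0" using assms by auto
  moreover have "(exp (- (k * t)) - 1) * (1 - exp (- t)) =
      ((exp (k * t) - 1) * exp (- (1 + k) * t)) * (1 - exp t)"
    by (simp add: algebra_simps flip: exp_add)
  ultimately show ?thesis by (simp add: transit_def divide_simps)
qed

lemma transit_minus_bounds:
  assumes "k > 0" "t > 0" shows "0 < transit k (- t)" "transit k (- t) < k"
proof -
  have e: "exp t - 1 > 0" using assms by simp
  have eq: "transit k (- t) = (1 - exp (- (k * t))) / (exp t - 1)"
    using e by (simp add: transit_def divide_simps) (simp add: algebra_simps)
  show "0 < transit k (- t)" using assms e by (simp add: eq)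
  have "1 - exp (- (k * t)) < k * t"
    using one_minus_exp_minus_less[of "k * t"] assms by simp
  also have "\<dots> < k * (exp t - 1)"
    using exp_diff_one_gt[of t] assms by simp
  finally show "transit k (- t) < k" using e by (simp add: eq pos_divide_less_eq)
qed

text \<open>Up to the positive factor \<open>exp (k * t) * exp (- t)\<close> the numerator of the
  derivative is \<open>k * (exp t - 1) - (1 - exp (- (k * t)))\<close>, and \<open>k * t\<close>
  separates the two terms for times of either sign.\<close>

lemma transit_deriv_pos:
  assumes "k > 0" "t \<noteq> 0"
  shows "\<exists>D. (transit k has_real_derivative D) (at t) \<and> D > 0"
proof -
  let ?N = "k * exp (k * t) * (1 - exp (- t)) - (exp (k * t) - 1) * exp (- t)"
  let ?D = "?N / (1 - exp (- t))\<^sup>2"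
  have nz: "1 - exp (- t) \<noteq> 0" using assms by auto
  have "(transit k has_real_derivative ?D) (at t)"
    unfolding transit_def using nz
    by (auto intro!: derivative_eq_intros simp: power2_eq_square algebra_simps)
  moreover have "?N > 0"
  proof -
    have "1 - exp (- (k * t)) < k * t"
      using one_minus_exp_minus_less[of "k * t"] assms by simp
    also have "\<dots> < k * (exp t - 1)"
      using exp_diff_one_gt[of t] assms by simp
    finally have "exp (k * t) * exp (- t) * (1 - exp (- (k * t))) <
        exp (k * t) * exp (- t) * (k * (exp t - 1))"
      by (simp only: mult_less_cancel_left_pos exp_gt_zero mult_pos_pos)
    moreover have "exp (k * t) * exp (- t) * (1 - exp (- (k * t))) = (exp (k * t) - 1) * exp (- t)"
      by (simp add: algebra_simps flip: exp_add)
    moreover have "exp (k * t) * exp (- t) * (k * (exp t - 1)) = k * exp (k * t) * (1 - exp (- t))"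
      by (simp add: algebra_simps flip: exp_add)
    ultimately show ?thesis by linarith
  qed
  ultimately show ?thesis using nz by (intro exI[of _ ?D]) simp
qed

lemma transit_strict_mono:
  assumes "k > 0" "0 < s" "s < t" shows "transit k s < transit k t"
    using DERIV_pos_imp_increasing[OF assms(3), of "transit k"] transit_deriv_pos assms by force

lemma transit_minus_strict_antimono:
  assumes "k > 0" "0 < s" "s < t" shows "transit k (- t) < transit k (- s)"
  using DERIV_pos_imp_increasing[of "-t" "-s" "transit k"] transit_deriv_pos assms by force

text \<open>One summand increases with \<open>t\<close> and the other decreases, so the monotonicity
  of the sum is invisible term by term. In \<open>E = exp (t / 2)\<close> and
  \<open>K = exp (k * t)\<close> the sum becomes a rational expression that is symmetric under time
  reversal.\<close>

lemma transit_sum_eq_sinh: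
  assumes "t > 0"
  shows "transit k t + transit k (- t) = sinh ((2 * k + 1) * (t / 2)) / sinh (t / 2) - 1"
proof -
  define E K where "E = exp (t / 2)" and "K = exp (k * t)"
  have E: "E > 1" and K: "K > 0" using assms by (simp_all add: E_def K_def)
  have E2: "exp t = E\<^sup>2"
    using exp_add[of "t / 2" "t / 2"] by (simp add: E_def power2_eq_square)
  then have 1: "exp (- t) = 1 / E\<^sup>2" "exp (- (t / 2)) = 1 / E" "exp (- (k * t)) = 1 / K"
      "exp (t / 2) = E" "exp (k * t) = K"
    by (simp_all add: E_def K_def exp_minus inverse_eq_divide)
  have 2: "(2 * k + 1) * (t / 2) = k * t + t / 2" by (simp add: algebra_simps)
  have half: "x / y = (x / 2) / (y / 2)" for x y :: real by simp
  have 3: "E\<^sup>2 \<noteq> 1" using E by (simp add: power2_eq_1_iff)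
  have 4: "exp (k * t + t / 2) = K * E" by (simp only: exp_add 1)
  then have 5: "exp (- (k * t + t / 2)) = 1 / (K * E)"
    by (simp only: exp_minus inverse_eq_divide)
  have "transit k t + transit k (- t) = (K - 1) / (1 - 1 / E\<^sup>2) + (1/K - 1) / (1 - E\<^sup>2)"
    by (simp add: transit_def 1 E2)
  also have "\<dots> = ((K - 1) * E\<^sup>2 + 1 - 1 / K) / (E\<^sup>2 - 1)"
    using E 3 K by (simp add: divide_simps) (simp add: algebra_simps)
  also have "\<dots> = (K * E - 1 / (K * E)) / (E - 1 / E) - 1"
    using E 3 K by (simp add: divide_simps power2_eq_square) (simp add: algebra_simps)
  also have "\<dots> = sinh ((2 * k + 1) * (t / 2)) / sinh (t / 2) - 1"
    unfolding 2 sinh_field_def 4 5 1 by (rule arg_cong[of _ _ "\<lambda>x. x - 1"]) (rule half)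
  finally show ?thesis .
qed

text \<open>The numerator of the derivative vanishes at 0, and its own derivative is
  \<open>(c\<^sup>2 - 1) * sinh (c * v) * sinh v\<close>, positive because
  \<open>c > 1\<close>.\<close>

lemma sinh_quotient_strict_mono:
  fixes c s t :: real
  assumes "c > 1" "0 < s" "s < t"
  shows "sinh (c * s) / sinh s < sinh (c * t) / sinh t"
proof (rule DERIV_pos_imp_increasing[OF assms(3)])
  fix u assume "s \<le> u" "u \<le> t"
  then have u: "u > 0" using assms by simp
  let ?N = "\<lambda>u. c * cosh (c * u) * sinh u - sinh (c * u) * cosh u"
  have "?N 0 < ?N u"
  proof (rule DERIV_pos_imp_increasing_open[OF u])
    fix v :: real assume "0 < v" "v < u"
    moreover have "(?N has_real_derivative (c\<^sup>2 - 1) * sinh (c * v) * sinh v) (at v)"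
      by (auto intro!: derivative_eq_intros simp: power2_eq_square algebra_simps)
    moreover have "c\<^sup>2 > 1" using assms by (simp add: one_less_power)
    ultimately show "\<exists>y. (?N has_real_derivative y) (at v) \<and> 0 < y"
      using assms by (intro exI[of _ "(c\<^sup>2 - 1) * sinh (c * v) * sinh v"]) simp
  qed (auto intro!: continuous_intros)
  then have "?N u > 0" by simp
  moreover have "((\<lambda>u. sinh (c * u) / sinh u) has_real_derivative ?N u / (sinh u)\<^sup>2) (at u)"
    using u by (auto intro!: derivative_eq_intros simp: power2_eq_square algebra_simps)
  moreover have "0 < ?N u / (sinh u)\<^sup>2"
    using u \<open>?N u > 0\<close> by (intro divide_pos_pos) simp_all
  ultimately show "\<exists>y. ((\<lambda>u. sinh (c * u) / sinh u) has_real_derivative y) (at u) \<and> 0 < y"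
    by (intro exI conjI)
qed

lemma transit_sum_strict_mono:
  assumes "k > 0" "0 < s" "s < t"
  shows "transit k s + transit k (- s) < transit k t + transit k (- t)"
proof -
  have "sinh ((2 * k + 1) * (s / 2)) / sinh (s / 2) < sinh ((2 * k + 1) * (t / 2)) / sinh (t / 2)"
    by (rule sinh_quotient_strict_mono) (use assms in auto)
  moreover have "t > 0" using assms by simp
  ultimately show ?thesis
    unfolding transit_sum_eq_sinh[OF \<open>t > 0\<close>] transit_sum_eq_sinh[OF assms(2)] by linarith
qed

lemma continuous_on_transit: "continuous_on (- {0}) (transit k)"
  unfolding transit_def by (auto intro!: continuous_on_divide continuous_on_diff continuous_on_exp
      continuous_on_minus continuous_on_mult continuous_on_const continuous_on_id)

lemma transit_tendsto_0: "(transit k \<longlongrightarrow> k) (at 0)"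
proof -
  have "((\<lambda>t. ((exp (k * t) - 1) / t) / ((1 - exp (- t)) / t)) \<longlongrightarrow> k / 1) (at 0)"
  proof (rule tendsto_divide)
    have "((\<lambda>t. exp (k * t)) has_real_derivative k) (at 0)" by (auto intro!: derivative_eq_intros)
    then show "((\<lambda>t. (exp (k * t) - 1) / t) \<longlongrightarrow> k) (at 0)" by (simp add: DERIV_def)
    have "((\<lambda>t. - exp (- t)) has_real_derivative 1) (at 0)" by (auto intro!: derivative_eq_intros)
    then show "((\<lambda>t. (1 - exp (- t)) / t) \<longlongrightarrow> (1::real)) (at 0)" by (simp add: DERIV_def)
  qed simp
  then have "((\<lambda>t. ((exp (k * t) - 1) / t) / ((1 - exp (- t)) / t)) \<longlongrightarrow> k) (at 0)" by simp
  then show ?thesis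
    by (rule Lim_transform_eventually) (auto simp: eventually_at_filter transit_def)
qed

lemma transit_surj:
  assumes "k > 0" "r > k"
  shows "\<exists>t>0. transit k t = r"
proof -
  have "\<forall>\<^sub>F t in at 0. transit k t < r" using transit_tendsto_0[of k] assms by (simp add: order_tendstoD)
  then have "\<forall>\<^sub>F t in at_right 0. transit k t < r" by (simp add: eventually_at_split)
  moreover have "\<forall>\<^sub>F t in at_right 0. t < r / k \<and> t > 0" using assms
    by (auto simp: eventually_at_right intro!: exI[of _ "r / k"])
  ultimately obtain t where t: "transit k t < r" "t < r / k" "t > 0"
    by (metis (mono_tags, lifting) eventually_conj eventually_happens trivial_limit_at_right_real)
  \<comment> \<open>At time \<open>r / k\<close> the numerator is \<open>exp r - 1\<close>, which
    exceeds \<open>r\<close>, while the denominator stays below 1.\<close>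
  have "r < transit k (r / k)"
  proof -
    have p: "1 - exp (- (r/k)) > 0" using assms by simp
    have "r * (1 - exp (- (r / k))) < r" using assms by simp
    also have "\<dots> < exp r - 1" using exp_diff_one_gt[of r] assms by simp
    finally show ?thesis using assms p by (simp add: transit_def pos_less_divide_eq)
  qed
  moreover have "continuous_on {t..r/k} (transit k)"
    by (rule continuous_on_subset[OF continuous_on_transit]) (use t in auto)
  ultimately obtain u where "u \<ge> t" "u \<le> r / k" "transit k u = r"
    using IVT'[of "transit k" t r "r / k"] t by auto
  then show ?thesis using t by (intro exI[of _ u]) auto
qed

text \<open>Flight time as a function of the launch coordinate divided by the excess. The
  description has a genuine value only for arguments above \<open>k\<close>, the infimum of
  \<open>transit k\<close> over positive times.\<close>

definition transit_time :: "real \<Rightarrow> real \<Rightarrow> real" where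
  "transit_time k r = (THE t. t > 0 \<and> transit k t = r)"

lemma transit_inj:
  assumes "k > 0" "s > 0" "t > 0" "transit k s = transit k t" shows "s = t"
  using transit_strict_mono[of k s t] transit_strict_mono[of k t s] assms
  by (metis less_irrefl linorder_neqE_linordered_idom)

lemma transit_less_iff:
  assumes "k > 0" "s > 0" "t > 0" shows "transit k s < transit k t \<longleftrightarrow> s < t"
  using transit_strict_mono[of k s t] transit_strict_mono[of k t s] assms
  by (metis less_asym linorder_neqE_linordered_idom)

lemma transit_time_eq:
  assumes "k > 0" "t > 0" shows "transit_time k (transit k t) = t"
  unfolding transit_time_def using transit_inj assms by blast

lemma transit_time:
  assumes "k > 0" "r > k"
  shows "transit_time k r > 0" "transit k (transit_time k r) = r"
  using transit_surj[OF assms] transit_time_eq assms(1) by metis+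

lemma transit_time_strict_mono:
  assumes "k > 0" "k < r" "r < s" shows "transit_time k r < transit_time k s"
  using transit_time[of k r] transit_time[of k s] transit_less_iff[of k "transit_time k r" "transit_time k s"] assms
  by simp

text \<open>Continuity of the inverse of an increasing function. The filter is arbitrary because the
  launch point varies in the stability proof and the parameter point in the homoclinic
  limit.\<close>

lemma transit_time_tendsto:
  assumes "k > 0" "r > k" "(f \<longlongrightarrow> r) F"
  shows "((\<lambda>x. transit_time k (f x)) \<longlongrightarrow> transit_time k r) F"
proof (rule order_tendstoI)
  let ?t = "transit_time k r"
  note t = transit_time[OF assms(1,2)]
  fix a assume a: "a < ?t"
  \<comment> \<open>Raising \<open>a\<close> to a positive value keeps the comparison among positive
    times, where \<open>transit k\<close> is increasing.\<close>
  define b where "b = max a (?t / 2)"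
  have b: "b > 0" "b < ?t" "a \<le> b" using a t by (auto simp: b_def)
  have "transit k b < r" using transit_strict_mono[of k b ?t] b t assms by simp
  then have "\<forall>\<^sub>F x in F. transit k b < f x" using assms by (simp add: order_tendstoD)
  then show "\<forall>\<^sub>F x in F. a < transit_time k (f x)"
  proof eventually_elim
    case (elim x)
    then have "f x > k" using transit_gt[of k b] b assms by simp
    then show ?case using transit_time_strict_mono[of k "transit k b" "f x"] elim
        transit_gt[of k b] transit_time_eq[of k b] b assms by simp
  qed
next
  let ?t = "transit_time k r"
  note t = transit_time[OF assms(1,2)]
  fix a assume a: "?t < a"
  have "r < transit k a" using transit_strict_mono[of k ?t a] a t assms by simp
  then have "\<forall>\<^sub>F x in F. f x < transit k a \<and> k < f x"
    using assms by (simp add: order_tendstoD eventually_conj)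
  then show "\<forall>\<^sub>F x in F. transit_time k (f x) < a"
  proof eventually_elim
    case (elim x)
    then show ?case using transit_time_strict_mono[of k "f x" "transit k a"]
        transit_time_eq[of k a] a t assms by simp
  qed
qed

text \<open>Landing abscissa, in the coordinate of the same field, of an orbit launched at
  \<open>\<alpha>\<close>: the launch abscissa after decay at rate \<open>1 + k\<close> during the
  flight. It describes a return for \<open>\<alpha> > k * e\<close>, that is, beyond the
  tangency.\<close>

definition half_return :: "real \<Rightarrow> real \<Rightarrow> real \<Rightarrow> real" where
  "half_return k e \<alpha> = \<alpha> * exp (- (1 + k) * transit_time k (\<alpha> / e))"

lemma half_return_transit:
  assumes "k > 0" "e > 0" "t > 0"
  shows "half_return k e (e * transit k t) = e * transit k (- t)"
  using assms by (simp add: half_return_def transit_time_eq transit_minus)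

lemma transit_param:
  assumes "k > 0" "e > 0" "\<alpha> > k * e"
  obtains t where "t > 0" "\<alpha> = e * transit k t" "transit_time k (\<alpha> / e) = t"
proof
  have "\<alpha> / e > k" using assms by (simp add: pos_less_divide_eq)
  note t = transit_time[OF assms(1) this]
  show "transit_time k (\<alpha> / e) > 0" by (fact t)
  show "\<alpha> = e * transit k (transit_time k (\<alpha> / e))" using t assms by simp
qed simp

lemma half_return_bounds:
  assumes "k > 0" "e > 0" "\<alpha> > k * e"
  shows "0 < half_return k e \<alpha>" "half_return k e \<alpha> < k * e"
proof -
  obtain t where "t > 0" "\<alpha> = e * transit k t" using transit_param[OF assms(1-3)] by metis
  then show "0 < half_return k e \<alpha>" "half_return k e \<alpha> < k * e"
    using half_return_transit[of k e t] transit_minus_bounds[of k t] assms by simp_all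
qed

text \<open>In terms of the flight time, launch and landing are \<open>e * transit k t\<close> and
  \<open>e * transit k (- t)\<close>. The two claims say that all difference quotients lie strictly
  between -1 and 0.\<close>

lemma half_return_antimono:
  assumes "k > 0" "e > 0" "\<alpha> > k * e" "\<alpha> < \<beta>"
  shows "half_return k e \<beta> < half_return k e \<alpha>"
    and "\<alpha> + half_return k e \<alpha> < \<beta> + half_return k e \<beta>"
proof -
  obtain s where s: "s > 0" "\<alpha> = e * transit k s" using transit_param[OF assms(1-3)] by metis
  obtain t where t: "t > 0" "\<beta> = e * transit k t" using transit_param[of k e \<beta>] assms by (metis order.strict_trans)
  have st: "s < t" using transit_less_iff[of k s t] s t assms by simp
  show "half_return k e \<beta> < half_return k e \<alpha>"
    using half_return_transit[of k e s] half_return_transit[of k e t]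
      transit_minus_strict_antimono[of k s t] assms s t st by simp
  have "\<alpha> + half_return k e \<alpha> = e * (transit k s + transit k (- s))"
      "\<beta> + half_return k e \<beta> = e * (transit k t + transit k (- t))"
    using half_return_transit[of k e s] half_return_transit[of k e t] assms s t by (simp_all add: algebra_simps)
  then show "\<alpha> + half_return k e \<alpha> < \<beta> + half_return k e \<beta>"
    using transit_sum_strict_mono[of k s t] st assms s by simp
qed

lemma half_return_lipschitz:
  assumes "k > 0" "e > 0" "\<alpha> > k * e" "\<beta> > k * e"
  shows "\<bar>half_return k e \<alpha> - half_return k e \<beta>\<bar> \<le> \<bar>\<alpha> - \<beta>\<bar>"
  using half_return_antimono[of k e \<alpha> \<beta>] half_return_antimono[of k e \<beta> \<alpha>] assms
  by (cases \<alpha> \<beta> rule: linorder_cases) auto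

lemma continuous_on_half_return:
  assumes "k > 0" "e > 0"
  shows "continuous_on {k * e<..} (half_return k e)"
  unfolding continuous_on_iff dist_real_def
proof (intro ballI allI impI)
  fix x d :: real assume "x \<in> {k * e<..}" "d > 0"
  then show "\<exists>r>0. \<forall>y\<in>{k * e<..}. \<bar>y - x\<bar> < r \<longrightarrow> \<bar>half_return k e y - half_return k e x\<bar> < d"
    using half_return_lipschitz[OF assms] by (intro exI[of _ d]) force
qed

text \<open>The bound \<open>2 * k\<close> is the limit at time 0. It is strict because
  \<open>sinh (c * u) > c * sinh u\<close> for \<open>c = 2 * k + 1\<close>, by comparing the
  derivatives.\<close>

lemma transit_sum_gt:
  assumes "k > 0" "t > 0"
  shows "transit k t + transit k (- t) > 2 * k"
proof -
  have "1 < sinh ((2 * k + 1) * (t/2)) / ((2 * k + 1) * sinh (t / 2))"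
  proof -
    let ?N = "\<lambda>u. sinh ((2 * k + 1) * u) - (2 * k + 1) * sinh u"
    have "?N 0 < ?N (t/2)"
    proof (rule DERIV_pos_imp_increasing_open[of 0 "t/2" ?N])
      fix v :: real assume "0 < v" "v < t/2"
      moreover have "(?N has_real_derivative (2 * k + 1) * (cosh ((2 * k + 1) * v) - cosh v)) (at v)"
        by (auto intro!: derivative_eq_intros simp: algebra_simps)
      moreover have "cosh v < cosh ((2 * k + 1) * v)"
        using \<open>0 < v\<close> assms by (subst cosh_real_nonneg_less_iff) auto
      ultimately show "\<exists>y. (?N has_real_derivative y) (at v) \<and> 0 < y"
        using assms by (intro exI[of _ "(2 * k + 1) * (cosh ((2 * k + 1) * v) - cosh v)"]) simp
    qed (use assms in \<open>auto intro!: continuous_intros\<close>)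
    then show ?thesis using assms by (simp add: pos_less_divide_eq)
  qed
  then have "2 * k + 1 < sinh ((2 * k + 1) * (t/2)) / sinh (t / 2)"
    using assms by (simp add: pos_less_divide_eq)
  then show ?thesis unfolding transit_sum_eq_sinh[OF assms(2)] by linarith
qed

section \<open>The flows of the two vector fields\<close>

text \<open>The factor \<open>side 1 = - 1\<close> is the point reflection that brings the first field into the normal form
  of the second.\<close>
definition side :: "nat \<Rightarrow> real" where
  "side i = (if i = 1 then - 1 else 1)"

definition height :: "real \<times> real \<Rightarrow> real \<times> real \<Rightarrow> real" where
  "height P z = snd z - fst z - snd P"

text \<open>Positive if the equilibrium is not admissible.\<close>
definition excess :: "(nat \<Rightarrow> real) \<Rightarrow> nat \<Rightarrow> real \<times> real \<Rightarrow> real" where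
  "excess \<kappa> i P = - side i * height P (equil \<kappa> i P)"

definition flow :: "(nat \<Rightarrow> real) \<Rightarrow> nat \<Rightarrow> real \<times> real \<Rightarrow> real \<times> real \<Rightarrow> real \<Rightarrow> real \<times> real" where
  "flow \<kappa> i P z t = equil \<kappa> i P +
     (exp (- (1 + \<kappa> i) * t) * fst (z - equil \<kappa> i P), exp (- \<kappa> i * t) * snd (z - equil \<kappa> i P))"

text \<open>The switching manifold in the normal form coordinate of the \<open>i\<close>-th field.\<close>
definition sw_point :: "(nat \<Rightarrow> real) \<Rightarrow> nat \<Rightarrow> real \<times> real \<Rightarrow> real \<Rightarrow> real \<times> real" where
  "sw_point \<kappa> i P \<alpha> =
     (fst (equil \<kappa> i P) + side i * \<alpha>, fst (equil \<kappa> i P) + side i * \<alpha> + snd P)"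

lemma side_simps [simp]: "side 1 = - 1" "side 2 = 1" "side i * side i = 1" "side i \<noteq> 0"
    "side i * (side i * x) = x" "\<bar>side i\<bar> = 1"
  by (auto simp: side_def)

lemma height_sw_point [simp]: "height P (sw_point \<kappa> i P \<alpha>) = 0"
  by (simp add: height_def sw_point_def)

lemma switching_iff: "z \<in> switching P \<longleftrightarrow> height P z = 0"
  by (cases P; cases z) (auto simp: switching_def height_def)

lemma sw_point_in_switching [simp]: "sw_point \<kappa> i P \<alpha> \<in> switching P"
  by (simp add: switching_iff)

lemma sw_point_exhaust:
  assumes "height P z = 0"
  shows "z = sw_point \<kappa> i P (side i * (fst z - fst (equil \<kappa> i P)))"
  using assms by (cases z) (simp add: sw_point_def height_def)

lemma region_iff: "i \<in> {1, 2} \<Longrightarrow> z \<in> region i P \<longleftrightarrow> side i * height P z > 0"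
  by (cases P; cases z) (auto simp: region_def height_def)

lemma flow_0 [simp]: "flow \<kappa> i P z 0 = z"
  by (simp add: flow_def prod_eq_iff)

lemma flow_flow: "flow \<kappa> i P (flow \<kappa> i P z s) t = flow \<kappa> i P z (s + t)"
  by (simp add: flow_def algebra_simps exp_add[symmetric] prod_eq_iff)

lemma flow_equil [simp]: "flow \<kappa> i P (equil \<kappa> i P) t = equil \<kappa> i P"
  by (simp add: flow_def prod_eq_iff)

lemma continuous_on_flow: "continuous_on T (flow \<kappa> i P z)"
  unfolding flow_def[abs_def] by (intro continuous_intros)

lemma flow_vector_derivative:
  assumes "\<kappa> i > 0"
  shows "(flow \<kappa> i P z has_vector_derivative vf \<kappa> i P (flow \<kappa> i P z t)) (at t within T)"
proof -
  obtain \<mu> \<eta> where P: "P = (\<mu>, \<eta>)" by force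
  define X Y where "X = 1 / (1 + \<kappa> i)" and "Y = \<mu> / \<kappa> i"
  have XY: "(1 + \<kappa> i) * X = 1" "\<kappa> i * Y = \<mu>" using assms by (simp_all add: X_def Y_def)
  have e: "equil \<kappa> i P = (X, Y)" by (simp add: P equil_def X_def Y_def)
  have "((\<lambda>t. X + exp (- (1 + \<kappa> i) * t) * (fst z - X)) has_real_derivative
      - (1 + \<kappa> i) * (exp (- (1 + \<kappa> i) * t) * (fst z - X))) (at t within T)"
    by (auto intro!: derivative_eq_intros simp: algebra_simps)
  moreover have "- (1 + \<kappa> i) * (exp (- (1 + \<kappa> i) * t) * (fst z - X)) =
      1 - (1 + \<kappa> i) * (X + exp (- (1 + \<kappa> i) * t) * (fst z - X))"
  proof -
    have "(1 + \<kappa> i) * (X + q) = 1 + (1 + \<kappa> i) * q" for q by (simp only: distrib_left XY)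
    from this[of "exp (- (1 + \<kappa> i) * t) * (fst z - X)"] show ?thesis by linarith
  qed
  moreover have "((\<lambda>t. Y + exp (- \<kappa> i * t) * (snd z - Y)) has_real_derivative
      - \<kappa> i * (exp (- \<kappa> i * t) * (snd z - Y))) (at t within T)"
    by (auto intro!: derivative_eq_intros simp: algebra_simps)
  moreover have "- \<kappa> i * (exp (- \<kappa> i * t) * (snd z - Y)) =
      \<mu> - \<kappa> i * (Y + exp (- \<kappa> i * t) * (snd z - Y))"
  proof -
    have "\<kappa> i * (Y + q) = \<mu> + \<kappa> i * q" for q by (simp only: distrib_left XY)
    from this[of "exp (- \<kappa> i * t) * (snd z - Y)"] show ?thesis by linarith
  qed
  moreover have "flow \<kappa> i P z = (\<lambda>t. (X + exp (- (1 + \<kappa> i) * t) * (fst z - X),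
      Y + exp (- \<kappa> i * t) * (snd z - Y)))"
    by (simp add: flow_def e prod_eq_iff fun_eq_iff)
  moreover have "vf \<kappa> i P w = (1 - (1 + \<kappa> i) * fst w, \<mu> - \<kappa> i * snd w)" for w
    by (simp add: P vf_def split_beta)
  ultimately show ?thesis
    by (simp only: fst_conv snd_conv has_real_derivative_iff_has_vector_derivative has_vector_derivative_Pair)
qed

lemma solves_flow: "\<kappa> i > 0 \<Longrightarrow> solves (vf \<kappa> i P) (flow \<kappa> i P z) T"
  by (simp add: solves_def flow_vector_derivative)

text \<open>Each component, multiplied by its integrating factor \<open>exp (l * t)\<close>, has
  zero derivative inside the interval and is continuous up to the ends. Derivatives are demanded in
  the interior only, since the segments of a piecewise-smooth orbit are differentiable on open
  intervals.\<close>

lemma flow_unique: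
  assumes "\<kappa> i > 0" "continuous_on {a..b} \<phi>"
    and d: "\<And>t. a < t \<Longrightarrow> t < b \<Longrightarrow> (\<phi> has_vector_derivative vf \<kappa> i P (\<phi> t)) (at t)"
    and "a \<le> t" "t \<le> b"
  shows "\<phi> t = flow \<kappa> i P (\<phi> a) (t - a)"
proof (cases "a = t")
  case False
  then have at: "a < t" using assms by simp
  obtain \<mu> \<eta> where P: "P = (\<mu>, \<eta>)" by force
  define X Y where "X = 1 / (1 + \<kappa> i)" and "Y = \<mu> / \<kappa> i"
  have XY: "(1 + \<kappa> i) * X = 1" "\<kappa> i * Y = \<mu>" using assms by (simp_all add: X_def Y_def)
  have e: "equil \<kappa> i P = (X, Y)" by (simp add: P equil_def X_def Y_def)
  have vf: "vf \<kappa> i P z = (- (1 + \<kappa> i) * (fst z - X), - \<kappa> i * (snd z - Y))" for z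
    using XY by (cases z) (simp add: P vf_def algebra_simps)
  have cont: "continuous_on {a..t} \<phi>"
    using assms by (auto intro: continuous_on_subset)
  have gen: "exp (l * t) * (f t - c) = exp (l * a) * (f a - c)"
    if "continuous_on {a..t} f"
      and "\<And>s. a < s \<Longrightarrow> s < t \<Longrightarrow> (f has_real_derivative - l * (f s - c)) (at s)"
    for f :: "real \<Rightarrow> real" and l c
  proof (rule DERIV_isconst_end[OF at])
    show "continuous_on {a..t} (\<lambda>t. exp (l * t) * (f t - c))"
      by (intro continuous_intros that)
    fix s assume "a < s" "s < t"
    from that(2)[OF this] show "DERIV (\<lambda>t. exp (l * t) * (f t - c)) s :> 0"
      by (auto intro!: derivative_eq_intros simp: algebra_simps)
  qed
  have dfst: "((\<lambda>t. fst (\<phi> t)) has_real_derivative - (1 + \<kappa> i) * (fst (\<phi> s) - X)) (at s)"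
    and dsnd: "((\<lambda>t. snd (\<phi> t)) has_real_derivative - \<kappa> i * (snd (\<phi> s) - Y)) (at s)"
    if "a < s" "s < t" for s
    using bounded_linear.has_vector_derivative[OF bounded_linear_fst d[of s]]
      bounded_linear.has_vector_derivative[OF bounded_linear_snd d[of s]] that assms(5)
    by (simp_all add: vf has_real_derivative_iff_has_vector_derivative)
  have "exp ((1 + \<kappa> i) * t) * (fst (\<phi> t) - X) = exp ((1 + \<kappa> i) * a) * (fst (\<phi> a) - X)"
    by (rule gen) (use dfst cont in \<open>auto intro!: continuous_intros\<close>)
  then have 1: "fst (\<phi> t) - X = exp (- (1 + \<kappa> i) * (t - a)) * (fst (\<phi> a) - X)"
    by (simp add: exp_minus exp_diff right_diff_distrib field_simps exp_add)
  have "exp (\<kappa> i * t) * (snd (\<phi> t) - Y) = exp (\<kappa> i * a) * (snd (\<phi> a) - Y)"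
    by (rule gen) (use dsnd cont in \<open>auto intro!: continuous_intros\<close>)
  then have 2: "snd (\<phi> t) - Y = exp (- \<kappa> i * (t - a)) * (snd (\<phi> a) - Y)"
    by (simp add: exp_minus exp_diff right_diff_distrib field_simps exp_add)
  show ?thesis using 1 2 by (simp add: flow_def e prod_eq_iff algebra_simps)
qed simp

lemma flow_unique_traverses:
  assumes "\<kappa> i > 0" "continuous_on {a..b} \<phi>" "traverses (vf \<kappa> i P) A \<phi> {a<..<b}" "a \<le> t" "t \<le> b"
  shows "\<phi> t = flow \<kappa> i P (\<phi> a) (t - a)"
proof (rule flow_unique[where a = a and b = b and \<phi> = \<phi>])
  fix t assume "a < t" "t < b"
  then have "t \<in> {a<..<b}" by simp
  then have "(\<phi> has_vector_derivative vf \<kappa> i P (\<phi> t)) (at t within {a<..<b})"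
    using assms(3) by (auto simp: traverses_def solves_def)
  then show "(\<phi> has_vector_derivative vf \<kappa> i P (\<phi> t)) (at t)"
    by (simp only: at_within_open[OF \<open>t \<in> {a<..<b}\<close> open_greaterThanLessThan])
qed (use assms in auto)

text \<open>In the normal form the orbit is X = exp(-(1+k)t) \<alpha>, Y = exp(-kt) (\<alpha> + e),
  and the signed height is Y - X - e. Taking out exp(-kt) leaves a difference whose two terms have
  \<open>transit\<close> as their quotient.\<close>

lemma height_flow_sw_point:
  "side i * height P (flow \<kappa> i P (sw_point \<kappa> i P \<alpha>) t) =
     exp (- \<kappa> i * t) * (\<alpha> * (1 - exp (- t)) - excess \<kappa> i P * (exp (\<kappa> i * t) - 1))"
proof -
  obtain X Y where e: "equil \<kappa> i P = (X, Y)" by force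
  define d where "d = Y - X - snd P"
  have ex: "excess \<kappa> i P = - side i * d" by (simp add: excess_def e height_def d_def)
  have 1: "exp (- (1 + \<kappa> i) * t) = exp (- \<kappa> i * t) * exp (- t)"
    by (simp add: algebra_simps flip: exp_add)
  have 2: "exp (- \<kappa> i * t) * exp (\<kappa> i * t) = 1" by (simp flip: exp_add)
  have "height P (flow \<kappa> i P (sw_point \<kappa> i P \<alpha>) t) =
      d + exp (- \<kappa> i * t) * (side i * \<alpha> - d) - exp (- \<kappa> i * t) * exp (- t) * (side i * \<alpha>)"
    unfolding flow_def sw_point_def e height_def d_def fst_conv snd_conv fst_add snd_add fst_diff snd_diff 1
    by (simp add: algebra_simps)
  moreover have "q * (d + E * (q * \<alpha> - d) - E * F * (q * \<alpha>)) =
      q * d + E * ((q * q) * \<alpha> - q * d) - E * F * ((q * q) * \<alpha>)" for q E F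
    by (simp add: algebra_simps)
  ultimately have "side i * height P (flow \<kappa> i P (sw_point \<kappa> i P \<alpha>) t) =
      side i * d + exp (- \<kappa> i * t) * (\<alpha> - side i * d) - exp (- \<kappa> i * t) * exp (- t) * \<alpha>"
    by (simp only: side_simps mult_1)
  also have "\<dots> = exp (- \<kappa> i * t) * (\<alpha> * (1 - exp (- t)) + side i * d * (exp (\<kappa> i * t) - 1))"
    using 2 by (simp add: algebra_simps)
  finally show ?thesis by (simp add: ex)
qed

text \<open>No division by \<open>1 - exp (- t)\<close> here: the form holds for negative times as
  well, which the two-sided orbit through a tangency requires.\<close>

lemma flow_sw_point_in_region_iff:
  assumes "i \<in> {1, 2}"
  shows "flow \<kappa> i P (sw_point \<kappa> i P \<alpha>) t \<in> region i P \<longleftrightarrow>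
    excess \<kappa> i P * (exp (\<kappa> i * t) - 1) < \<alpha> * (1 - exp (- t))"
  unfolding region_iff[OF assms] height_flow_sw_point by (simp add: zero_less_mult_iff)

lemma flow_sw_point_in_region_iff_transit:
  assumes "i \<in> {1, 2}" "t > 0"
  shows "flow \<kappa> i P (sw_point \<kappa> i P \<alpha>) t \<in> region i P \<longleftrightarrow> excess \<kappa> i P * transit (\<kappa> i) t < \<alpha>"
  using assms by (simp add: flow_sw_point_in_region_iff transit_def pos_divide_less_eq)

lemma flow_sw_point_in_switching_iff_transit:
  assumes "t > 0"
  shows "flow \<kappa> i P (sw_point \<kappa> i P \<alpha>) t \<in> switching P \<longleftrightarrow> excess \<kappa> i P * transit (\<kappa> i) t = \<alpha>"
proof -
  have "flow \<kappa> i P (sw_point \<kappa> i P \<alpha>) t \<in> switching P \<longleftrightarrow>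
      side i * height P (flow \<kappa> i P (sw_point \<kappa> i P \<alpha>) t) = 0"
    by (simp add: switching_iff)
  also have "\<dots> \<longleftrightarrow> excess \<kappa> i P * (exp (\<kappa> i * t) - 1) = \<alpha> * (1 - exp (- t))"
    unfolding height_flow_sw_point by auto
  also have "\<dots> \<longleftrightarrow> excess \<kappa> i P * transit (\<kappa> i) t = \<alpha>"
    using assms by (simp add: transit_def divide_eq_eq)
  finally show ?thesis .
qed

text \<open>The landing point is on the line, so its abscissa determines it, and the decay of the
  abscissa is the factor in \<open>transit_minus\<close>.\<close>

lemma flow_sw_point_return:
  assumes "t > 0" "\<alpha> = excess \<kappa> i P * transit (\<kappa> i) t"
  shows "flow \<kappa> i P (sw_point \<kappa> i P \<alpha>) t = sw_point \<kappa> i P (excess \<kappa> i P * transit (\<kappa> i) (- t))"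
proof -
  let ?z = "flow \<kappa> i P (sw_point \<kappa> i P \<alpha>) t"
  have "height P ?z = 0"
    using assms flow_sw_point_in_switching_iff_transit by (auto simp: switching_iff)
  then have "?z = sw_point \<kappa> i P (side i * (fst ?z - fst (equil \<kappa> i P)))"
    by (rule sw_point_exhaust)
  also have "side i * (fst ?z - fst (equil \<kappa> i P)) = exp (- (1 + \<kappa> i) * t) * \<alpha>"
    by (simp add: flow_def sw_point_def algebra_simps)
  also have "\<dots> = excess \<kappa> i P * transit (\<kappa> i) (- t)"
    using assms by (simp add: transit_minus mult_ac)
  finally show ?thesis .
qed

section \<open>Piecewise-smooth orbits\<close>

locale rates =
  fixes \<kappa> :: "nat \<Rightarrow> real"
  assumes \<kappa>1: "0 < \<kappa> 1" and \<kappa>12: "\<kappa> 1 < \<kappa> 2"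
begin

lemma \<kappa>_pos: "i \<in> {1, 2} \<Longrightarrow> \<kappa> i > 0"
  using \<kappa>1 \<kappa>12 by auto

lemma \<kappa>1_pos [simp]: "\<kappa> 1 > 0" "\<kappa> 2 > 0" "\<kappa> 1 \<noteq> \<kappa> 2" "\<kappa> 2 \<noteq> \<kappa> 1"
  using \<kappa>1 \<kappa>12 by auto

text \<open>Segment times are locally finite, so immediately after any time the orbit is in a single
  mode; in the first mode uniqueness of solutions replaces the differential equation by the explicit
  flow.\<close>

lemma pws_initial:
  assumes "pws_orbit \<kappa> P \<phi>" "t \<ge> 0"
  obtains (flow) \<epsilon> i where "\<epsilon> > 0" "i \<in> {1, 2}" "\<And>s. 0 \<le> s \<Longrightarrow> s < \<epsilon> \<Longrightarrow> \<phi> (t + s) = flow \<kappa> i P (\<phi> t) s"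
      "\<And>s. 0 < s \<Longrightarrow> s < \<epsilon> \<Longrightarrow> \<phi> (t + s) \<in> region i P"
    | (sliding) \<epsilon> where "\<epsilon> > 0" "\<And>s. 0 < s \<Longrightarrow> s < \<epsilon> \<Longrightarrow> \<phi> (t + s) \<in> sliding \<kappa> P"
proof -
  from assms(1) have cont: "continuous_on {0..} \<phi>" by (simp add: pws_orbit_def)
  from assms(1) obtain T where T': "(\<forall>t. finite (T \<inter> {0..t})) \<and>
        (\<forall>s t. 0 \<le> s \<and> s < t \<and> T \<inter> {s<..<t} = {} \<longrightarrow>
           traverses (vf \<kappa> 1 P) (region 1 P) \<phi> {s<..<t} \<or>
           traverses (vf \<kappa> 2 P) (region 2 P) \<phi> {s<..<t} \<or>
           traverses (sliding_vf \<kappa> P) (sliding \<kappa> P) \<phi> {s<..<t})"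
    unfolding pws_orbit_def by blast
  have T: "finite (T \<inter> {0..t})" for t using T' by blast
  \<comment> \<open>Including \<open>t + 1\<close> makes the finite set nonempty, so its minimum
    ends an interval free of segment times.\<close>
  define A where "A = insert (t + 1) (T \<inter> {t<..<t + 1})"
  have "finite (T \<inter> {t<..<t + 1})"
    by (rule finite_subset[OF _ T[of "t + 1"]]) (use assms in auto)
  then have finA: "finite A" by (simp add: A_def)
  define r where "r = Min A"
  have "r \<in> A" unfolding r_def by (rule Min_in[OF finA]) (simp add: A_def)
  then have r: "r > t" "r \<le> t + 1" by (auto simp: A_def)
  have "T \<inter> {t<..<r} = {}"
  proof (rule ccontr)
    assume "T \<inter> {t<..<r} \<noteq> {}"
    then obtain x where x: "x \<in> T" "t < x" "x < r" by auto
    then have "x \<in> A" using r by (auto simp: A_def)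
    then show False using x finA by (simp add: r_def) (metis Min_le not_less)
  qed
  with T' assms(2) r(1)
  have "traverses (vf \<kappa> 1 P) (region 1 P) \<phi> {t<..<r} \<or>
      traverses (vf \<kappa> 2 P) (region 2 P) \<phi> {t<..<r} \<or>
      traverses (sliding_vf \<kappa> P) (sliding \<kappa> P) \<phi> {t<..<r}" by blast
  then consider (1) i where "i \<in> {1, 2}" "traverses (vf \<kappa> i P) (region i P) \<phi> {t<..<r}"
    | (2) "traverses (sliding_vf \<kappa> P) (sliding \<kappa> P) \<phi> {t<..<r}" by auto
  then show thesis
  proof cases
    case 1
    have c: "continuous_on {t..r} \<phi>" by (rule continuous_on_subset[OF cont]) (use assms in auto)
    show ?thesis
    proof (rule flow[of "r - t" i])
      fix s assume "0 \<le> s" "s < r - t"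
      then show "\<phi> (t + s) = flow \<kappa> i P (\<phi> t) s"
        using flow_unique_traverses[OF \<kappa>_pos[OF 1(1)] c 1(2), of "t + s"] by simp
    next
      fix s assume "0 < s" "s < r - t"
      then have "t + s \<in> {t<..<r}" by simp
      then show "\<phi> (t + s) \<in> region i P" using 1(2) by (auto simp: traverses_def)
    qed (use 1 r in auto)
  next
    case 2
    show ?thesis
    proof (rule sliding[of "r - t"])
      fix s assume "0 < s" "s < r - t"
      then have "t + s \<in> {t<..<r}" by simp
      then show "\<phi> (t + s) \<in> sliding \<kappa> P" using 2 by (auto simp: traverses_def)
    qed (use r in auto)
  qed
qed

lemma open_region: "open (region i P)"
proof -
  obtain \<mu> \<eta> where P: "P = (\<mu>, \<eta>)" by force
  have "region i P = (if i = 1 then {z. snd z < fst z + \<eta>} else {z. snd z > fst z + \<eta>})"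
    by (auto simp: region_def P split: prod.splits)
  then show ?thesis by (auto intro!: open_Collect_less continuous_intros)
qed

lemma region_disjoint:
  "i \<in> {1, 2} \<Longrightarrow> z \<in> region i P \<Longrightarrow> z \<notin> region (3 - i) P"
  "i \<in> {1, 2} \<Longrightarrow> z \<in> region i P \<Longrightarrow> z \<notin> switching P"
  by (auto simp: region_iff switching_iff simp flip: One_nat_def)

lemma sliding_subset_switching: "sliding \<kappa> P \<subseteq> switching P"
  by (auto simp: sliding_def)

text \<open>On the switching manifold the continuation can be ambiguous; \<open>init\<close> removes
  the rivals at the start, namely entering the other region and sliding. Sliding is excluded either
  locally, by avoiding the closure of the sliding segment, or globally, for an orbit that never
  slides. The global form serves homoclinic orbits, which start at a boundary equilibrium.\<close>

lemma pws_follow: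
  assumes orb: "pws_orbit \<kappa> P \<phi>" and t: "t \<ge> 0" and i: "i \<in> {1, 2}"
    and reg: "\<And>s. 0 < s \<Longrightarrow> s < \<tau> \<Longrightarrow> flow \<kappa> i P (\<phi> t) s \<in> region i P"
    and init: "\<phi> t \<in> region i P \<or>
      ((\<forall>s>0. flow \<kappa> (3 - i) P (\<phi> t) s \<notin> region (3 - i) P) \<and>
       (\<phi> t \<notin> closure (sliding \<kappa> P) \<or> (\<forall>t\<ge>0. \<phi> t \<notin> sliding \<kappa> P)))"
    and s: "0 \<le> s" "s \<le> \<tau>"
  shows "\<phi> (t + s) = flow \<kappa> i P (\<phi> t) s"
proof (rule ccontr)
  assume neq: "\<phi> (t + s) \<noteq> flow \<kappa> i P (\<phi> t) s"
  have c0: "continuous_on {0..} \<phi>" using orb by (simp add: pws_orbit_def)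
  have c: "continuous_on {0..} (\<lambda>s. \<phi> (t + s) - flow \<kappa> i P (\<phi> t) s)"
    by (intro continuous_intros continuous_on_flow continuous_on_compose2[OF c0]) (use t in auto)
  define B where "B = {s \<in> {0..}. \<phi> (t + s) - flow \<kappa> i P (\<phi> t) s = 0}"
  have Bclosed: "closed B" unfolding B_def
    by (rule continuous_closed_preimage_constant[OF c closed_atLeast])
  \<comment> \<open>Continuous induction: agreement of orbit and flow is a closed condition, so the
    supremum of \<open>C\<close> is attained, and \<open>key\<close> contradicts its maximality by
    extending the agreement.\<close>
  define C where "C = {r. 0 \<le> r \<and> r \<le> s \<and> {0..r} \<subseteq> B}"
  have "0 \<in> C" using s by (auto simp: C_def B_def)
  have bdd: "bdd_above C" by (auto simp: C_def)
  define r where "r = Sup C"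
  have r0: "0 \<le> r" unfolding r_def by (rule cSup_upper[OF \<open>0 \<in> C\<close> bdd])
  have rs: "r \<le> s" unfolding r_def by (rule cSup_least) (use \<open>0 \<in> C\<close> in \<open>auto simp: C_def\<close>)
  have before: "x \<in> B" if x: "0 \<le> x" "x < r" for x
  proof -
    obtain y where "y \<in> C" "x < y"
      using x(2) \<open>0 \<in> C\<close> unfolding r_def by (auto elim: less_cSupE)
    then show ?thesis using x by (auto simp: C_def)
  qed
  have rB: "r \<in> B"
  proof (cases "r = 0")
    case True then show ?thesis by (simp add: B_def)
  next
    case False
    then have "r \<in> closure {0..<r}" using r0 by simp
    also have "\<dots> \<subseteq> B" using Bclosed before by (intro closure_minimal) auto
    finally show ?thesis .
  qed
  then have r_eq: "\<phi> (t + r) = flow \<kappa> i P (\<phi> t) r" by (simp add: B_def)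
  have "r \<noteq> s" using r_eq neq by auto
  then have "r < s" using rs by simp
  have key: False if "\<epsilon> > 0" and fl: "\<And>x. 0 \<le> x \<Longrightarrow> x < \<epsilon> \<Longrightarrow> \<phi> (t + r + x) = flow \<kappa> i P (\<phi> (t + r)) x" for \<epsilon>
  proof -
    define x where "x = min (\<epsilon> / 2) (s - r)"
    have x: "0 < x" "x < \<epsilon>" "r + x \<le> s" using that \<open>r < s\<close> by (auto simp: x_def)
    have "y \<in> B" if "0 \<le> y" "y \<le> r + x" for y
    proof (cases "y \<le> r")
      case True then show ?thesis using before[of y] rB that by (cases "y = r") auto
    next
      case False
      then have "\<phi> (t + r + (y - r)) = flow \<kappa> i P (\<phi> (t + r)) (y - r)"
        using x that by (intro fl) auto
      then show ?thesis using that by (simp add: B_def r_eq flow_flow)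
    qed
    then have "r + x \<in> C" using x r0 by (auto simp: C_def)
    then have "r + x \<le> r" unfolding r_def using bdd by (rule cSup_upper)
    then show False using x by simp
  qed
  have c1: "((\<lambda>x. \<phi> (t + r + x)) \<longlongrightarrow> \<phi> (t + r)) (at_right 0)"
  proof -
    have "continuous_on {0..} (\<lambda>x. \<phi> (t + r + x))"
      by (intro continuous_intros continuous_on_compose2[OF c0]) (use t r0 in auto)
    then have "((\<lambda>x. \<phi> (t + r + x)) \<longlongrightarrow> \<phi> (t + r + 0)) (at 0 within {0..})"
      unfolding continuous_on_def by (rule bspec) simp
    moreover have "{0<..} \<subseteq> {0::real..}" by auto
    ultimately show ?thesis using tendsto_within_subset by fastforce
  qed
  have small: "\<forall>\<^sub>F x in at_right 0. 0 < x \<and> x < \<epsilon>" if "\<epsilon> > 0" for \<epsilon> :: real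
    using that by (auto simp: eventually_at_right)
  have tr0: "t + r \<ge> 0" using t r0 by simp
  show False
  proof (cases "\<phi> (t + r) \<in> region i P")
    case True
    \<comment> \<open>The region is open, so the orbit remains in it for a short time; this rules
      out sliding and the other flow.\<close>
    then have near: "\<forall>\<^sub>F x in at_right 0. \<phi> (t + r + x) \<in> region i P"
      using c1 open_region topological_tendstoD by blast
    show False
    proof (rule pws_initial[OF orb tr0])
      fix \<epsilon> j assume \<epsilon>: "\<epsilon> > 0" and j: "j \<in> {1, 2}"
        and fl: "\<And>s. 0 \<le> s \<Longrightarrow> s < \<epsilon> \<Longrightarrow> \<phi> (t + r + s) = flow \<kappa> j P (\<phi> (t + r)) s"
        and re: "\<And>s. 0 < s \<Longrightarrow> s < \<epsilon> \<Longrightarrow> \<phi> (t + r + s) \<in> region j P"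
      from eventually_happens[OF eventually_conj[OF near small[OF \<epsilon>]]]
      obtain x where x: "\<phi> (t + r + x) \<in> region i P" "0 < x" "x < \<epsilon>" by auto
      then have "\<phi> (t + r + x) \<in> region j P" using re by simp
      then have "j = i" using x i j region_disjoint[of i "\<phi> (t + r + x)" P] by auto
      then show False using key \<epsilon> fl by blast
    next
      fix \<epsilon> assume \<epsilon>: "\<epsilon> > 0" and re: "\<And>s. 0 < s \<Longrightarrow> s < \<epsilon> \<Longrightarrow> \<phi> (t + r + s) \<in> sliding \<kappa> P"
      from eventually_happens[OF eventually_conj[OF near small[OF \<epsilon>]]]
      obtain x where x: "\<phi> (t + r + x) \<in> region i P" "0 < x" "x < \<epsilon>" by auto
      then show False using re[of x] sliding_subset_switching region_disjoint(2)[OF i] by blast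
    qed
  next
    case False
    \<comment> \<open>At positive times below \<open>\<tau>\<close> the flow is in the region by
      \<open>reg\<close>, so only the starting point can lie outside.\<close>
    have "r = 0"
    proof (rule ccontr)
      assume "r \<noteq> 0"
      then show False using reg[of r] r0 \<open>r < s\<close> s False r_eq by auto
    qed
    then have F: "\<phi> t \<notin> region i P" using False by simp
    then have ex: "\<forall>s>0. flow \<kappa> (3 - i) P (\<phi> t) s \<notin> region (3 - i) P"
      and sl: "\<phi> t \<notin> closure (sliding \<kappa> P) \<or> (\<forall>t\<ge>0. \<phi> t \<notin> sliding \<kappa> P)"
      using init by auto
    show False
    proof (rule pws_initial[OF orb tr0])
      fix \<epsilon> j assume \<epsilon>: "\<epsilon> > 0" and j: "j \<in> {1, 2}"
        and fl: "\<And>s. 0 \<le> s \<Longrightarrow> s < \<epsilon> \<Longrightarrow> \<phi> (t + r + s) = flow \<kappa> j P (\<phi> (t + r)) s"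
        and re: "\<And>s. 0 < s \<Longrightarrow> s < \<epsilon> \<Longrightarrow> \<phi> (t + r + s) \<in> region j P"
      show False
      proof (cases "j = i")
        case True then show ?thesis using key \<epsilon> fl by blast
      next
        case False
        then have "j = 3 - i" using i j by auto
        then show ?thesis using ex re[of "\<epsilon> / 2"] fl[of "\<epsilon> / 2"] \<epsilon> \<open>r = 0\<close> by auto
      qed
    next
      fix \<epsilon> assume \<epsilon>: "\<epsilon> > 0" and re: "\<And>s. 0 < s \<Longrightarrow> s < \<epsilon> \<Longrightarrow> \<phi> (t + r + s) \<in> sliding \<kappa> P"
      from sl show False
      proof
        assume "\<forall>t\<ge>0. \<phi> t \<notin> sliding \<kappa> P"
        then show False using re[of "\<epsilon> / 2"] \<epsilon> tr0 by simp
      next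
        assume "\<phi> t \<notin> closure (sliding \<kappa> P)"
        moreover have "\<phi> (t + r) \<in> closure (sliding \<kappa> P)"
        proof (rule Lim_in_closed_set[OF closed_closure _ _ c1])
          show "\<forall>\<^sub>F x in at_right 0. \<phi> (t + r + x) \<in> closure (sliding \<kappa> P)"
            using small[OF \<epsilon>]
            by eventually_elim (use re closure_subset in blast)
        qed simp
        ultimately show False using \<open>r = 0\<close> by simp
      qed
    qed
  qed
qed

end

section \<open>Crossing periodic orbits\<close>

text \<open>The offset between the two normal form coordinates on the switching manifold.\<close>

definition spread :: "(nat \<Rightarrow> real) \<Rightarrow> real" where
  "spread \<kappa> = 1 / (1 + \<kappa> 1) - 1 / (1 + \<kappa> 2)"

lemma other_index: "i \<in> {1, 2} \<Longrightarrow> 3 - i \<in> {1, 2::nat}" "i \<in> {1, 2} \<Longrightarrow> 3 - (3 - i) = (i::nat)"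
    "i \<in> {1, 2} \<Longrightarrow> side (3 - i) = - side i"
  by auto

lemma fst_equil: "fst (equil \<kappa> i P) = 1 / (1 + \<kappa> i)"
  and snd_equil: "snd (equil \<kappa> i P) = fst P / \<kappa> i"
  by (simp_all add: equil_def split_beta)

lemma sw_point_eq_iff [simp]: "sw_point \<kappa> i P \<alpha> = sw_point \<kappa> i P \<beta> \<longleftrightarrow> \<alpha> = \<beta>"
  by (simp add: sw_point_def)

text \<open>The reflection makes the two coordinates run in opposite directions, so their sum is the
  same at all points of the line.\<close>

lemma sw_point_other:
  "i \<in> {1, 2} \<Longrightarrow> sw_point \<kappa> i P \<alpha> = sw_point \<kappa> (3 - i) P (spread \<kappa> - \<alpha>)"
  by (auto simp: sw_point_def spread_def fst_equil)

lemma excess_eq: "excess \<kappa> i P = side i * (snd P + 1 / (1 + \<kappa> i) - fst P / \<kappa> i)"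
  by (simp add: excess_def height_def fst_equil snd_equil algebra_simps)

text \<open>The zero of the right-hand side locates the tangency at
  \<open>\<kappa> i * excess \<kappa> i P\<close>, which is the threshold \<open>k * e\<close> of
  the half-return map.\<close>

lemma vf_nvec_sw_point:
  assumes "\<kappa> i > 0"
  shows "vf \<kappa> i P (sw_point \<kappa> i P \<alpha>) \<bullet> nvec = side i * (\<alpha> - \<kappa> i * excess \<kappa> i P)"
proof -
  define X where "X = 1 / (1 + \<kappa> i)"
  have X: "\<kappa> i * X = 1 - X" using assms by (simp add: X_def field_simps)
  have "vf \<kappa> i P (sw_point \<kappa> i P \<alpha>) \<bullet> nvec =
      side i * \<alpha> + (X + \<kappa> i * X - 1) - \<kappa> i * (X + snd P - fst P / \<kappa> i)"
    using assms by (simp add: vf_def nvec_def sw_point_def fst_equil split_beta algebra_simps flip: X_def)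
  also have "\<dots> = side i * \<alpha> - \<kappa> i * (X + snd P - fst P / \<kappa> i)" using X by simp
  also have "\<dots> = side i * (\<alpha> - \<kappa> i * excess \<kappa> i P)"
    unfolding excess_eq X_def[symmetric] by (simp add: algebra_simps)
  finally show ?thesis .
qed

definition arc :: "(nat \<Rightarrow> real) \<Rightarrow> nat \<Rightarrow> real \<times> real \<Rightarrow> real \<Rightarrow> (real \<times> real) set" where
  "arc \<kappa> i P \<tau> = flow \<kappa> i P (sw_point \<kappa> i P (excess \<kappa> i P * transit (\<kappa> i) \<tau>)) ` {0..\<tau>}"

context rates
begin

lemma spread_pos: "spread \<kappa> > 0"
proof -
  have "1 / (1 + \<kappa> 2) < 1 / (1 + \<kappa> 1)"
    by (rule divide_strict_left_mono) (use \<kappa>1 \<kappa>12 in \<open>auto intro!: mult_pos_pos add_pos_pos\<close>)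
  then show ?thesis by (simp add: spread_def)
qed

lemma \<kappa>_nonzero [simp]: "\<kappa> 1 \<noteq> 0" "\<kappa> 2 \<noteq> 0" "1 + \<kappa> 1 \<noteq> 0" "1 + \<kappa> 2 \<noteq> 0"
  using \<kappa>1 \<kappa>12 by linarith+

text \<open>Compares the tangencies: in the coordinate of field 1 they lie at
  \<open>\<kappa> 1 * excess \<kappa> 1 P\<close> and at
  \<open>spread \<kappa> - \<kappa> 2 * excess \<kappa> 2 P\<close>, so their order is decided by
  the sign of \<open>snd P\<close>.\<close>

lemma excess_sum:
  "\<kappa> 1 * excess \<kappa> 1 P + \<kappa> 2 * excess \<kappa> 2 P = spread \<kappa> + (\<kappa> 2 - \<kappa> 1) * snd P"
proof -
  define X Y where "X = 1 / (1 + \<kappa> 1)" and "Y = 1 / (1 + \<kappa> 2)"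
  have XY: "\<kappa> 1 * X = 1 - X" "\<kappa> 2 * Y = 1 - Y"
    by (simp_all add: X_def Y_def field_simps)
  have "\<kappa> 1 * excess \<kappa> 1 P + \<kappa> 2 * excess \<kappa> 2 P =
      fst P - \<kappa> 1 * X - \<kappa> 1 * snd P + (\<kappa> 2 * Y + \<kappa> 2 * snd P - fst P)"
    by (simp add: excess_eq distrib_left right_diff_distrib flip: X_def Y_def)
  also have "\<dots> = spread \<kappa> + (\<kappa> 2 - \<kappa> 1) * snd P"
    using XY by (simp add: spread_def algebra_simps flip: X_def Y_def)
  finally show ?thesis .
qed

lemma excess_sum_less_iff:
  "\<kappa> 1 * excess \<kappa> 1 P + \<kappa> 2 * excess \<kappa> 2 P < spread \<kappa> \<longleftrightarrow> snd P < 0"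
  using \<kappa>12 by (simp add: excess_sum mult_less_0_iff)

lemma excess_sum_less:
  assumes "i \<in> {1, 2}" "snd P < 0"
  shows "\<kappa> i * excess \<kappa> i P + \<kappa> (3 - i) * excess \<kappa> (3 - i) P < spread \<kappa>"
  using excess_sum_less_iff[of P] assms by auto

lemma Gamma_region_iff:
  "P \<in> Gamma_region \<kappa> \<longleftrightarrow> excess \<kappa> 1 P > 0 \<and> excess \<kappa> 2 P > 0 \<and> snd P < 0"
  by (auto simp: Gamma_region_def excess_eq split_beta)

lemma vf_nvec_sw_point_product:
  assumes "i \<in> {1, 2}"
  shows "(vf \<kappa> 1 P (sw_point \<kappa> i P \<alpha>) \<bullet> nvec) * (vf \<kappa> 2 P (sw_point \<kappa> i P \<alpha>) \<bullet> nvec) =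
    - ((\<alpha> - \<kappa> i * excess \<kappa> i P) * (spread \<kappa> - \<alpha> - \<kappa> (3 - i) * excess \<kappa> (3 - i) P))"
proof -
  have 1: "(vf \<kappa> 1 P z \<bullet> nvec) * (vf \<kappa> 2 P z \<bullet> nvec) = (vf \<kappa> i P z \<bullet> nvec) * (vf \<kappa> (3 - i) P z \<bullet> nvec)" for z
    using assms by auto
  have 2: "vf \<kappa> (3 - i) P (sw_point \<kappa> i P \<alpha>) \<bullet> nvec =
      - side i * (spread \<kappa> - \<alpha> - \<kappa> (3 - i) * excess \<kappa> (3 - i) P)"
    unfolding sw_point_other[OF assms]
      vf_nvec_sw_point[of \<kappa> "3 - i", OF \<kappa>_pos[OF other_index(1)[OF assms]]]
    by (simp only: other_index(3)[OF assms])
  show ?thesis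
    unfolding 1 2 vf_nvec_sw_point[of \<kappa> i, OF \<kappa>_pos[OF assms]]
    using side_simps(3)[of i] by algebra
qed

lemma crossing_sw_point_iff:
  assumes "i \<in> {1, 2}"
  shows "sw_point \<kappa> i P \<alpha> \<in> crossing \<kappa> P \<longleftrightarrow>
    (\<alpha> - \<kappa> i * excess \<kappa> i P) * (spread \<kappa> - \<alpha> - \<kappa> (3 - i) * excess \<kappa> (3 - i) P) < 0"
  unfolding crossing_def by (simp add: vf_nvec_sw_point_product[OF assms])

lemma sliding_sw_point_iff:
  assumes "i \<in> {1, 2}"
  shows "sw_point \<kappa> i P \<alpha> \<in> sliding \<kappa> P \<longleftrightarrow>
    (\<alpha> - \<kappa> i * excess \<kappa> i P) * (spread \<kappa> - \<alpha> - \<kappa> (3 - i) * excess \<kappa> (3 - i) P) > 0"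
  unfolding sliding_def by (simp add: vf_nvec_sw_point_product[OF assms])

lemma half_orbit:
  assumes i: "i \<in> {1, 2}" and "\<tau> > 0" and sol: "solves (vf \<kappa> i P) \<phi> {0..\<tau>}"
    and reg: "\<phi> ` {0<..<\<tau>} \<subseteq> region i P" and sw: "\<phi> 0 \<in> switching P" "\<phi> \<tau> \<in> switching P"
  shows "excess \<kappa> i P > 0" "\<phi> 0 = sw_point \<kappa> i P (excess \<kappa> i P * transit (\<kappa> i) \<tau>)"
    "\<phi> \<tau> = sw_point \<kappa> i P (excess \<kappa> i P * transit (\<kappa> i) (- \<tau>))" "\<phi> ` {0..\<tau>} = arc \<kappa> i P \<tau>"
proof -
  define \<alpha> where "\<alpha> = side i * (fst (\<phi> 0) - fst (equil \<kappa> i P))"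
  have start: "\<phi> 0 = sw_point \<kappa> i P \<alpha>"
    unfolding \<alpha>_def using sw(1) by (intro sw_point_exhaust) (simp add: switching_iff)
  have fl: "\<phi> t = flow \<kappa> i P (\<phi> 0) t" if "0 \<le> t" "t \<le> \<tau>" for t
  proof -
    have "\<phi> t = flow \<kappa> i P (\<phi> 0) (t - 0)"
    proof (rule flow_unique[of \<kappa> i 0 \<tau> \<phi>])
      show "continuous_on {0..\<tau>} \<phi>"
        using sol by (auto simp: solves_def intro: continuous_on_vector_derivative)
      fix t assume t: "0 < t" "t < \<tau>"
      then have "(\<phi> has_vector_derivative vf \<kappa> i P (\<phi> t)) (at t within {0..\<tau>})"
        using sol by (simp add: solves_def)
      moreover have "at t within {0..\<tau>} = at t" using t by (intro at_within_interior) simp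
      ultimately show "(\<phi> has_vector_derivative vf \<kappa> i P (\<phi> t)) (at t)" by simp
    qed (use that i \<kappa>_pos in auto)
    then show ?thesis by simp
  qed
  have eq: "excess \<kappa> i P * transit (\<kappa> i) \<tau> = \<alpha>"
    using sw(2) fl[of \<tau>] \<open>\<tau> > 0\<close> start flow_sw_point_in_switching_iff_transit[of \<tau> \<kappa> i P \<alpha>] by simp
  \<comment> \<open>In the region at half time, on the line at full time: as \<open>transit\<close>
    increases, this combination forces a positive excess.\<close>
  have "\<phi> (\<tau> / 2) \<in> region i P" using reg \<open>\<tau> > 0\<close> by auto
  then have "excess \<kappa> i P * transit (\<kappa> i) (\<tau> / 2) < excess \<kappa> i P * transit (\<kappa> i) \<tau>"
    using flow_sw_point_in_region_iff_transit[OF i, of "\<tau> / 2" \<kappa> P \<alpha>] fl[of "\<tau> / 2"] start eq \<open>\<tau> > 0\<close>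
    by simp
  moreover have "transit (\<kappa> i) (\<tau> / 2) < transit (\<kappa> i) \<tau>"
    using transit_strict_mono[OF \<kappa>_pos[OF i], of "\<tau> / 2" \<tau>] \<open>\<tau> > 0\<close> by simp
  ultimately show "excess \<kappa> i P > 0"
    by (auto simp: mult_less_cancel_left)
  show "\<phi> 0 = sw_point \<kappa> i P (excess \<kappa> i P * transit (\<kappa> i) \<tau>)" using start eq by simp
  show "\<phi> \<tau> = sw_point \<kappa> i P (excess \<kappa> i P * transit (\<kappa> i) (- \<tau>))"
    using fl[of \<tau>] \<open>\<tau> > 0\<close> flow_sw_point_return[OF \<open>\<tau> > 0\<close> eq[symmetric]]
    unfolding start by (metis less_imp_le order_refl)
  show "\<phi> ` {0..\<tau>} = arc \<kappa> i P \<tau>"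
    unfolding arc_def eq start[symmetric] by (intro image_cong refl fl) auto
qed

text \<open>Such an orbit amounts to a pair of flight times. At each junction the landing of one
  field is the launch of the other, which by \<open>sw_point_other\<close> means that a launch and a
  landing coordinate add up to \<open>spread \<kappa>\<close>.\<close>

lemma crossing_periodic_orbit_iff:
  "crossing_periodic_orbit \<kappa> P G \<longleftrightarrow>
    (\<exists>\<tau>\<^sub>1 \<tau>\<^sub>2. \<tau>\<^sub>1 > 0 \<and> \<tau>\<^sub>2 > 0 \<and> excess \<kappa> 1 P > 0 \<and> excess \<kappa> 2 P > 0 \<and>
       excess \<kappa> 1 P * transit (\<kappa> 1) \<tau>\<^sub>1 + excess \<kappa> 2 P * transit (\<kappa> 2) (- \<tau>\<^sub>2) = spread \<kappa> \<and>
       excess \<kappa> 2 P * transit (\<kappa> 2) \<tau>\<^sub>2 + excess \<kappa> 1 P * transit (\<kappa> 1) (- \<tau>\<^sub>1) = spread \<kappa> \<and>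
       G = arc \<kappa> 1 P \<tau>\<^sub>1 \<union> arc \<kappa> 2 P \<tau>\<^sub>2)" (is "_ \<longleftrightarrow> ?R")
proof
  assume "crossing_periodic_orbit \<kappa> P G"
  then obtain \<phi>\<^sub>1 \<phi>\<^sub>2 \<tau>\<^sub>1 \<tau>\<^sub>2 where *: "\<tau>\<^sub>1 > 0" "\<tau>\<^sub>2 > 0"
        "solves (vf \<kappa> 1 P) \<phi>\<^sub>1 {0..\<tau>\<^sub>1}" "\<phi>\<^sub>1 ` {0<..<\<tau>\<^sub>1} \<subseteq> region 1 P"
        "solves (vf \<kappa> 2 P) \<phi>\<^sub>2 {0..\<tau>\<^sub>2}" "\<phi>\<^sub>2 ` {0<..<\<tau>\<^sub>2} \<subseteq> region 2 P"
        "\<phi>\<^sub>1 \<tau>\<^sub>1 = \<phi>\<^sub>2 0" "\<phi>\<^sub>1 \<tau>\<^sub>1 \<in> crossing \<kappa> P"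
        "\<phi>\<^sub>2 \<tau>\<^sub>2 = \<phi>\<^sub>1 0" "\<phi>\<^sub>2 \<tau>\<^sub>2 \<in> crossing \<kappa> P"
        "G = \<phi>\<^sub>1 ` {0..\<tau>\<^sub>1} \<union> \<phi>\<^sub>2 ` {0..\<tau>\<^sub>2}"
    unfolding crossing_periodic_orbit_def by blast
  have cs: "z \<in> crossing \<kappa> P \<Longrightarrow> z \<in> switching P" for z by (simp add: crossing_def)
  have sw: "\<phi>\<^sub>1 0 \<in> switching P" "\<phi>\<^sub>1 \<tau>\<^sub>1 \<in> switching P" "\<phi>\<^sub>2 0 \<in> switching P" "\<phi>\<^sub>2 \<tau>\<^sub>2 \<in> switching P"
    using *(8,10) cs by (simp_all add: *(7,9)[symmetric])
  note 1 = half_orbit[of 1, OF _ *(1,3,4) sw(1,2), simplified]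
  note 2 = half_orbit[of 2, OF _ *(2,5,6) sw(3,4), simplified]
  have o: "sw_point \<kappa> 2 P \<alpha> = sw_point \<kappa> 1 P (spread \<kappa> - \<alpha>)" for \<alpha>
    using sw_point_other[of 2] by simp
  show ?R
    using 1 2 *(1,2,7,9,11) unfolding o sw_point_eq_iff
    by (intro exI[of _ \<tau>\<^sub>1] exI[of _ \<tau>\<^sub>2]) auto
next
  assume ?R
  then obtain \<tau>\<^sub>1 \<tau>\<^sub>2 where t: "\<tau>\<^sub>1 > 0" "\<tau>\<^sub>2 > 0" and e: "excess \<kappa> 1 P > 0" "excess \<kappa> 2 P > 0"
    and eq: "excess \<kappa> 1 P * transit (\<kappa> 1) \<tau>\<^sub>1 + excess \<kappa> 2 P * transit (\<kappa> 2) (- \<tau>\<^sub>2) = spread \<kappa>"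
       "excess \<kappa> 2 P * transit (\<kappa> 2) \<tau>\<^sub>2 + excess \<kappa> 1 P * transit (\<kappa> 1) (- \<tau>\<^sub>1) = spread \<kappa>"
    and G: "G = arc \<kappa> 1 P \<tau>\<^sub>1 \<union> arc \<kappa> 2 P \<tau>\<^sub>2" by blast
  define \<alpha> where "\<alpha> i = excess \<kappa> i P * transit (\<kappa> i) (if i = 1 then \<tau>\<^sub>1 else \<tau>\<^sub>2)" for i
  define \<beta> where "\<beta> i = excess \<kappa> i P * transit (\<kappa> i) (- (if i = 1 then \<tau>\<^sub>1 else \<tau>\<^sub>2))" for i
  have sum: "\<alpha> 1 + \<beta> 2 = spread \<kappa>" "\<alpha> 2 + \<beta> 1 = spread \<kappa>"
    using eq by (simp_all add: \<alpha>_def \<beta>_def)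
  define \<phi> where "\<phi> i = flow \<kappa> i P (sw_point \<kappa> i P (\<alpha> i))" for i
  have start: "\<phi> i 0 = sw_point \<kappa> i P (\<alpha> i)" for i by (simp add: \<phi>_def)
  have stop: "\<phi> 1 \<tau>\<^sub>1 = sw_point \<kappa> 1 P (\<beta> 1)" "\<phi> 2 \<tau>\<^sub>2 = sw_point \<kappa> 2 P (\<beta> 2)"
    using t by (simp_all add: \<phi>_def \<alpha>_def \<beta>_def flow_sw_point_return)
  have reg: "\<phi> i ` {0<..<(if i = 1 then \<tau>\<^sub>1 else \<tau>\<^sub>2)} \<subseteq> region i P" if i: "i \<in> {1, 2}" for i
  proof (clarsimp simp only: image_subset_iff)
    fix s assume s: "s \<in> {0<..<(if i = 1 then \<tau>\<^sub>1 else \<tau>\<^sub>2)}"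
    then have "transit (\<kappa> i) s < transit (\<kappa> i) (if i = 1 then \<tau>\<^sub>1 else \<tau>\<^sub>2)"
      by (intro transit_strict_mono \<kappa>_pos i) auto
    moreover have "excess \<kappa> i P > 0" using i e by auto
    ultimately show "\<phi> i s \<in> region i P"
      using s by (simp add: \<phi>_def \<alpha>_def flow_sw_point_in_region_iff_transit[OF i])
  qed
  \<comment> \<open>Landings fall below the tangency coordinate and launches above it; at a junction
    one of each meets, and with the reversed coordinate this is the sign condition for
    crossing.\<close>
  have b: "\<beta> 1 < \<kappa> 1 * excess \<kappa> 1 P" "\<alpha> 1 > \<kappa> 1 * excess \<kappa> 1 P"
      "\<beta> 2 < \<kappa> 2 * excess \<kappa> 2 P" "\<alpha> 2 > \<kappa> 2 * excess \<kappa> 2 P"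
    using t e transit_gt transit_minus_bounds(2) by (simp_all add: \<alpha>_def \<beta>_def mult.commute)
  have "sw_point \<kappa> 1 P (\<beta> 1) = sw_point \<kappa> 2 P (\<alpha> 2)" "sw_point \<kappa> 2 P (\<beta> 2) = sw_point \<kappa> 1 P (\<alpha> 1)"
    using sum sw_point_other[of 1 \<kappa> P] sw_point_other[of 2 \<kappa> P] by (simp_all add: algebra_simps)
  moreover have "sw_point \<kappa> 1 P (\<beta> 1) \<in> crossing \<kappa> P" "sw_point \<kappa> 2 P (\<beta> 2) \<in> crossing \<kappa> P"
    using b sum crossing_sw_point_iff[of 1 P "\<beta> 1"] crossing_sw_point_iff[of 2 P "\<beta> 2"]
    by (auto simp: mult_less_0_iff)
  moreover have "G = \<phi> 1 ` {0..\<tau>\<^sub>1} \<union> \<phi> 2 ` {0..\<tau>\<^sub>2}"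
    by (simp add: G arc_def \<phi>_def \<alpha>_def)
  ultimately show "crossing_periodic_orbit \<kappa> P G"
    unfolding crossing_periodic_orbit_def using t reg[of 1] reg[of 2]
    by (intro exI[of _ "\<phi> 1"] exI[of _ "\<phi> 2"] exI[of _ \<tau>\<^sub>1] exI[of _ \<tau>\<^sub>2])
       (simp add: start stop, simp add: \<phi>_def solves_flow)
qed

text \<open>The sum of the two closing equations expresses \<open>2 * spread \<kappa>\<close>
  through symmetric transit sums, each of which exceeds its limit \<open>2 * \<kappa> i\<close>. The
  resulting inequality is the condition \<open>snd P < 0\<close>, and positive excesses are part of
  the closing conditions.\<close>

lemma no_crossing_periodic_orbit:
  assumes "P \<notin> Gamma_region \<kappa>"
  shows "\<not> crossing_periodic_orbit \<kappa> P G"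
proof
  assume "crossing_periodic_orbit \<kappa> P G"
  then obtain \<tau>\<^sub>1 \<tau>\<^sub>2 where t: "\<tau>\<^sub>1 > 0" "\<tau>\<^sub>2 > 0" and e: "excess \<kappa> 1 P > 0" "excess \<kappa> 2 P > 0"
    and eq: "excess \<kappa> 1 P * transit (\<kappa> 1) \<tau>\<^sub>1 + excess \<kappa> 2 P * transit (\<kappa> 2) (- \<tau>\<^sub>2) = spread \<kappa>"
       "excess \<kappa> 2 P * transit (\<kappa> 2) \<tau>\<^sub>2 + excess \<kappa> 1 P * transit (\<kappa> 1) (- \<tau>\<^sub>1) = spread \<kappa>"
    unfolding crossing_periodic_orbit_iff by blast
  have "excess \<kappa> 1 P * (2 * \<kappa> 1) < excess \<kappa> 1 P * (transit (\<kappa> 1) \<tau>\<^sub>1 + transit (\<kappa> 1) (- \<tau>\<^sub>1))"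
      "excess \<kappa> 2 P * (2 * \<kappa> 2) < excess \<kappa> 2 P * (transit (\<kappa> 2) \<tau>\<^sub>2 + transit (\<kappa> 2) (- \<tau>\<^sub>2))"
    using e t transit_sum_gt by simp_all
  then have "\<kappa> 1 * excess \<kappa> 1 P + \<kappa> 2 * excess \<kappa> 2 P < spread \<kappa>"
    using eq by (simp add: algebra_simps)
  then show False using assms e by (simp add: excess_sum_less_iff Gamma_region_iff)
qed

end

section \<open>The stable crossing periodic orbit\<close>

lemma norm_scaled_pair_le:
  fixes v :: "real \<times> real"
  assumes "\<bar>a\<bar> \<le> c" "\<bar>b\<bar> \<le> c"
  shows "norm (a * fst v, b * snd v) \<le> c * norm v"
proof -
  have c: "0 \<le> c" using assms by simp
  have "(a * x)\<^sup>2 \<le> (c * x)\<^sup>2" if "\<bar>a\<bar> \<le> c" for a x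
    using that c by (intro abs_le_square_iff[THEN iffD1]) (simp add: abs_mult mult_right_mono)
  then have "(a * fst v)\<^sup>2 + (b * snd v)\<^sup>2 \<le> (c * fst v)\<^sup>2 + (c * snd v)\<^sup>2"
    using assms by (meson add_mono)
  also have "\<dots> = (c * norm v)\<^sup>2"
    by (cases v) (simp add: norm_Pair power_mult_distrib distrib_left)
  finally have "sqrt ((a * fst v)\<^sup>2 + (b * snd v)\<^sup>2) \<le> c * norm v"
    using c by (intro real_le_lsqrt) auto
  then show ?thesis by (simp add: norm_Pair)
qed

lemma exp_minus_lipschitz:
  fixes l s t :: real
  assumes "l \<ge> 0" "s \<ge> 0" "t \<ge> 0"
  shows "\<bar>exp (- l * s) - exp (- l * t)\<bar> \<le> l * \<bar>s - t\<bar>"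
proof -
  have *: "\<bar>exp (- l * s) - exp (- l * t)\<bar> \<le> l * \<bar>s - t\<bar>" if "0 \<le> s" "s \<le> t" for s t
  proof -
    have "exp (- l * s) - exp (- l * t) = exp (- l * s) * (1 - exp (- (l * (t - s))))"
      by (simp add: algebra_simps flip: exp_add)
    also have "\<dots> \<le> 1 * (l * (t - s))"
      using exp_ge_add_one_self[of "- (l * (t - s))"] that assms
      by (intro mult_mono) auto
    finally have "exp (- l * s) - exp (- l * t) \<le> l * (t - s)" by simp
    moreover have "exp (- l * t) \<le> exp (- l * s)" using that assms by (simp add: mult_left_mono)
    ultimately show ?thesis using that by simp
  qed
  show ?thesis
    using *[of s t] *[of t s] assms by (cases "s \<le> t") (simp_all add: abs_minus_commute)
qed

text \<open>In each component the difference combines \<open>z - w\<close> and the displacement of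
  the equilibrium with nonnegative weights of sum 1. Two parameter points occur because the
  homoclinic limit compares flows at different parameters.\<close>

lemma dist_flow_le:
  assumes "\<kappa> i > 0" "t \<ge> 0"
  shows "dist (flow \<kappa> i P z t) (flow \<kappa> i Q w t) \<le> dist z w + dist (equil \<kappa> i P) (equil \<kappa> i Q)"
proof -
  let ?p = "equil \<kappa> i P" and ?q = "equil \<kappa> i Q"
  have e: "\<bar>exp (- (1 + \<kappa> i) * t)\<bar> \<le> 1" "\<bar>exp (- \<kappa> i * t)\<bar> \<le> 1"
      "\<bar>1 - exp (- (1 + \<kappa> i) * t)\<bar> \<le> 1" "\<bar>1 - exp (- \<kappa> i * t)\<bar> \<le> 1"
    using assms by (simp_all add: mult_nonneg_nonneg mult_nonpos_nonneg)
  have "flow \<kappa> i P z t - flow \<kappa> i Q w t =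
      (exp (- (1 + \<kappa> i) * t) * fst (z - w), exp (- \<kappa> i * t) * snd (z - w)) +
      ((1 - exp (- (1 + \<kappa> i) * t)) * fst (?p - ?q), (1 - exp (- \<kappa> i * t)) * snd (?p - ?q))"
    by (simp add: flow_def prod_eq_iff algebra_simps)
  then have "dist (flow \<kappa> i P z t) (flow \<kappa> i Q w t) \<le>
      norm (exp (- (1 + \<kappa> i) * t) * fst (z - w), exp (- \<kappa> i * t) * snd (z - w)) +
      norm ((1 - exp (- (1 + \<kappa> i) * t)) * fst (?p - ?q), (1 - exp (- \<kappa> i * t)) * snd (?p - ?q))"
    unfolding dist_norm by (metis norm_triangle_ineq)
  also have "\<dots> \<le> 1 * norm (z - w) + 1 * norm (?p - ?q)"
    by (intro add_mono norm_scaled_pair_le e)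
  finally show ?thesis by (simp add: dist_norm)
qed

lemma dist_flow_time_le:
  assumes "\<kappa> i > 0" "s \<ge> 0" "t \<ge> 0"
  shows "dist (flow \<kappa> i P z s) (flow \<kappa> i P z t) \<le> (1 + \<kappa> i) * \<bar>s - t\<bar> * norm (z - equil \<kappa> i P)"
proof -
  let ?v = "z - equil \<kappa> i P"
  have "flow \<kappa> i P z s - flow \<kappa> i P z t =
      ((exp (- (1 + \<kappa> i) * s) - exp (- (1 + \<kappa> i) * t)) * fst ?v, (exp (- \<kappa> i * s) - exp (- \<kappa> i * t)) * snd ?v)"
    by (simp add: flow_def prod_eq_iff algebra_simps)
  moreover have "\<bar>exp (- (1 + \<kappa> i) * s) - exp (- (1 + \<kappa> i) * t)\<bar> \<le> (1 + \<kappa> i) * \<bar>s - t\<bar>"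
    by (rule exp_minus_lipschitz) (use assms in auto)
  moreover have "\<bar>exp (- \<kappa> i * s) - exp (- \<kappa> i * t)\<bar> \<le> (1 + \<kappa> i) * \<bar>s - t\<bar>"
    by (rule order_trans[OF exp_minus_lipschitz]) (use assms in \<open>auto intro: mult_right_mono\<close>)
  ultimately show ?thesis unfolding dist_norm by (simp only: norm_scaled_pair_le)
qed

lemma dist_sw_point_le: "dist (sw_point \<kappa> i P \<alpha>) (sw_point \<kappa> i P \<beta>) \<le> 2 * \<bar>\<alpha> - \<beta>\<bar>"
proof -
  have "dist (sw_point \<kappa> i P \<alpha>) (sw_point \<kappa> i P \<beta>) \<le> norm (side i * (\<alpha> - \<beta>)) + norm (side i * (\<alpha> - \<beta>))"
    unfolding dist_norm sw_point_def
    by (rule order_trans[OF _ norm_Pair_le]) (simp add: algebra_simps)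
  then show ?thesis by (simp add: abs_mult)
qed

text \<open>The iterates approach \<open>a\<close> monotonically without overshooting. Their limit
  stays above \<open>l\<close>, where continuity makes it a fixed point, and \<open>below\<close>
  and \<open>above\<close> leave \<open>a\<close> as the only one.\<close>

lemma iterate_tendsto_fixpoint:
  fixes f :: "real \<Rightarrow> real"
  assumes cont: "continuous_on {l<..} f" and a: "l < a" and x: "l < x"
    and below: "\<And>x. l < x \<Longrightarrow> x < a \<Longrightarrow> x < f x \<and> f x \<le> a"
    and above: "\<And>x. a < x \<Longrightarrow> f x < x \<and> a \<le> f x" and fp: "f a = a"
  shows "(\<lambda>n. (f ^^ n) x) \<longlonglongrightarrow> a"
proof -
  define X where "X n = (f ^^ n) x" for n
  have X_Suc: "X (Suc n) = f (X n)" for n by (simp add: X_def)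
  have X0: "X 0 = x" by (simp add: X_def)
  have X1: "X (Suc 0) = f x" by (simp only: X_Suc X0)
  have unique: "L = a" if "X \<longlonglongrightarrow> L" "l < L" for L
  proof -
    have "isCont f L" using cont that by (simp add: continuous_on_eq_continuous_at)
    then have "(\<lambda>n. f (X n)) \<longlonglongrightarrow> f L" using that(1) isCont_tendsto_compose by blast
    moreover have "(\<lambda>n. f (X n)) \<longlonglongrightarrow> L" using LIMSEQ_Suc[OF that(1)] by (simp add: X_Suc)
    ultimately have "f L = L" by (rule LIMSEQ_unique)
    then show ?thesis using below[of L] above[of L] that(2) by (cases L a rule: linorder_cases) auto
  qed
  show ?thesis
  proof (cases "x \<le> a")
    case True
    have b: "x \<le> X n \<and> X n \<le> a \<and> X n \<le> X (Suc n)" for n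
    proof (induction n)
      case 0 then show ?case using True below[of x] fp x X0 X1 by (cases "x = a") auto
    next
      case (Suc n)
      then have "x \<le> X (Suc n)" by simp
      moreover have "X (Suc n) \<le> a"
        using Suc below[of "X n"] fp x by (cases "X n = a") (auto simp: X_Suc)
      ultimately show ?case
        using below[of "X (Suc n)"] fp x X_Suc[of "Suc n"] by (cases "X (Suc n) = a") auto
    qed
    then have inc: "incseq X" by (intro incseq_SucI) simp
    obtain L where L: "X \<longlonglongrightarrow> L" "\<And>n. X n \<le> L"
      using incseq_convergent[OF inc, of a] b by blast
    have "l < L" using L(2)[of 0] x by (simp add: X_def)
    then show ?thesis using L(1) unique unfolding X_def by blast
  next
    case False
    have b: "a \<le> X n \<and> X (Suc n) \<le> X n" for n
    proof (induction n)
      case 0 then show ?case using False above[of x] X0 X1 by auto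
    next
      case (Suc n)
      have "a \<le> X (Suc n)" using Suc above[of "X n"] fp by (cases "X n = a") (auto simp: X_Suc)
      then show ?case
        using above[of "X (Suc n)"] fp X_Suc[of "Suc n"] by (cases "X (Suc n) = a") auto
    qed
    then have dec: "decseq X" by (intro decseq_SucI) simp
    obtain L where L: "X \<longlonglongrightarrow> L" "\<And>n. L \<le> X n"
      using decseq_convergent[OF dec, of a] b by blast
    have "a \<le> L" using L(1) b by (intro LIMSEQ_le_const) auto
    then show ?thesis using L(1) unique a unfolding X_def by fastforce
  qed
qed

context rates
begin

text \<open>Backward in time X grows faster than Y, so the orbit must meet the line. The launch
  point found there lies beyond the tangency because a flight of positive duration starts at
  it.\<close>

lemma arc_cover:
  assumes i: "i \<in> {1, 2}" and e: "excess \<kappa> i P > 0" and z: "z \<in> region i P"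
    and pos: "side i * (fst z - fst (equil \<kappa> i P)) > 0"
  obtains \<alpha> s where "\<alpha> > \<kappa> i * excess \<kappa> i P" "0 < s" "s < transit_time (\<kappa> i) (\<alpha> / excess \<kappa> i P)"
    "z = flow \<kappa> i P (sw_point \<kappa> i P \<alpha>) s"
proof -
  let ?p = "equil \<kappa> i P"
  define x y where "x = side i * (fst z - fst ?p)" and "y = side i * (snd z - snd ?p)"
  define H where "H t = side i * height P (flow \<kappa> i P z (- t))" for t
  have H: "H t = exp (\<kappa> i * t) * (y - x * exp t) - excess \<kappa> i P" for t
  proof -
    have "exp ((1 + \<kappa> i) * t) = exp (\<kappa> i * t) * exp t" by (simp add: algebra_simps exp_add)
    then show ?thesis
      by (simp add: H_def height_def flow_def excess_def x_def y_def algebra_simps)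
  qed
  have H0: "H 0 > 0" using z by (simp add: H_def region_iff[OF i])
  then have "y - x > 0" using e by (simp add: H)
  then have y: "y > 0" "x > 0" "x < y" using pos by (simp_all add: x_def)
  \<comment> \<open>Backward time \<open>ln (y / x)\<close> brings the orbit to Y = X, where the
    signed height is \<open>- excess \<kappa> i P\<close>; so the line has been passed
    before.\<close>
  define r where "r = ln (y / x)"
  have r: "r > 0" using y by (simp add: r_def)
  have "H r < 0" using y e by (simp add: H r_def)
  moreover have "continuous_on {0..r} H" unfolding H[abs_def] by (intro continuous_intros)
  ultimately obtain s where s: "0 \<le> s" "s \<le> r" "H s = 0"
    using IVT2'[of H r 0 0] H0 r by auto
  have "s > 0" using s H0 by (cases "s = 0") auto
  define w where "w = flow \<kappa> i P z (- s)"
  have "height P w = 0" using s(3) by (simp add: H_def w_def)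
  then obtain \<alpha> where w: "w = sw_point \<kappa> i P \<alpha>" using sw_point_exhaust by blast
  have zw: "z = flow \<kappa> i P (sw_point \<kappa> i P \<alpha>) s"
    unfolding w[symmetric] w_def flow_flow by simp
  have k: "\<kappa> i > 0" using \<kappa>_pos[OF i] .
  have less: "excess \<kappa> i P * transit (\<kappa> i) s < \<alpha>"
    using z \<open>s > 0\<close> zw flow_sw_point_in_region_iff_transit[OF i] by simp
  show thesis
  proof (rule that[OF _ \<open>s > 0\<close> _ zw])
    have "excess \<kappa> i P * \<kappa> i < excess \<kappa> i P * transit (\<kappa> i) s"
      using transit_gt[OF k \<open>s > 0\<close>] e by simp
    then show a: "\<alpha> > \<kappa> i * excess \<kappa> i P" using less by (simp add: mult.commute)
    have "transit (\<kappa> i) s < \<alpha> / excess \<kappa> i P" using less e by (simp add: pos_less_divide_eq mult.commute)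
    then show "s < transit_time (\<kappa> i) (\<alpha> / excess \<kappa> i P)"
      using transit_time_strict_mono[OF k transit_gt[OF k \<open>s > 0\<close>]] transit_time_eq[OF k \<open>s > 0\<close>] by metis
  qed
qed

end

text \<open>Constant along orbits because X and Y decay at the rates \<open>1 + \<kappa> i\<close>
  and \<open>\<kappa> i\<close>. It tells which arc a point lies on without knowing the time spent
  on the arc.\<close>

definition first_integral :: "(nat \<Rightarrow> real) \<Rightarrow> nat \<Rightarrow> real \<times> real \<Rightarrow> real \<times> real \<Rightarrow> real" where
  "first_integral \<kappa> i P z = (1 + \<kappa> i) * ln (side i * (snd z - snd (equil \<kappa> i P)))
     - \<kappa> i * ln (side i * (fst z - fst (equil \<kappa> i P)))"

text \<open>The normal form quadrant X > 0, Y > 0, where both logarithms of the first integral are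
  genuine.\<close>

definition quadrant :: "(nat \<Rightarrow> real) \<Rightarrow> nat \<Rightarrow> real \<times> real \<Rightarrow> (real \<times> real) set" where
  "quadrant \<kappa> i P = {z. side i * (fst z - fst (equil \<kappa> i P)) > 0 \<and>
     side i * (snd z - snd (equil \<kappa> i P)) > 0}"

lemma open_quadrant: "open (quadrant \<kappa> i P)"
  unfolding quadrant_def Collect_conj_eq by (intro open_Int open_Collect_less continuous_intros)

lemma continuous_on_first_integral: "continuous_on (quadrant \<kappa> i P) (first_integral \<kappa> i P)"
  unfolding first_integral_def[abs_def] by (intro continuous_intros) (auto simp: quadrant_def)

lemma side_flow:
  "side i * (fst (flow \<kappa> i P z t) - fst (equil \<kappa> i P)) =
     exp (- (1 + \<kappa> i) * t) * (side i * (fst z - fst (equil \<kappa> i P)))"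
  "side i * (snd (flow \<kappa> i P z t) - snd (equil \<kappa> i P)) =
     exp (- \<kappa> i * t) * (side i * (snd z - snd (equil \<kappa> i P)))"
  by (simp_all add: flow_def)

lemma side_sw_point:
  "side i * (fst (sw_point \<kappa> i P \<alpha>) - fst (equil \<kappa> i P)) = \<alpha>"
  "side i * (snd (sw_point \<kappa> i P \<alpha>) - snd (equil \<kappa> i P)) = \<alpha> + excess \<kappa> i P"
  by (simp_all add: sw_point_def excess_def height_def algebra_simps)

lemma flow_in_quadrant_iff: "flow \<kappa> i P z t \<in> quadrant \<kappa> i P \<longleftrightarrow> z \<in> quadrant \<kappa> i P"
  unfolding quadrant_def mem_Collect_eq side_flow by (simp add: zero_less_mult_iff)

lemma first_integral_flow:
  assumes "z \<in> quadrant \<kappa> i P"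
  shows "first_integral \<kappa> i P (flow \<kappa> i P z t) = first_integral \<kappa> i P z"
proof -
  have "(1 + k) * ln (exp (- k * t) * y) - k * ln (exp (- (1 + k) * t) * x) = (1 + k) * ln y - k * ln x"
    if "x > 0" "y > 0" for x y k :: real
    using that by (simp add: ln_mult) (simp add: algebra_simps)
  then show ?thesis using assms unfolding first_integral_def side_flow by (simp only: quadrant_def mem_Collect_eq)
qed

definition sw_integral :: "real \<Rightarrow> real \<Rightarrow> real \<Rightarrow> real" where
  "sw_integral k e \<alpha> = (1 + k) * ln (\<alpha> + e) - k * ln \<alpha>"

lemma first_integral_sw_point:
  "first_integral \<kappa> i P (sw_point \<kappa> i P \<alpha>) = sw_integral (\<kappa> i) (excess \<kappa> i P) \<alpha>"
  unfolding first_integral_def side_sw_point sw_integral_def ..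

text \<open>The derivative is \<open>(x - k * e) / (x * (x + e))\<close>, so on the line the first
  integral is minimal at the tangency; beyond it the level determines the launch point.\<close>

lemma sw_integral_strict_mono:
  assumes "k > 0" "e > 0" "k * e \<le> \<alpha>" "\<alpha> < \<beta>"
  shows "sw_integral k e \<alpha> < sw_integral k e \<beta>"
proof (rule DERIV_pos_imp_increasing_open[OF assms(4)])
  have ke: "k * e > 0" using assms by simp
  fix x assume x: "\<alpha> < x" "x < \<beta>"
  then have p: "x > 0" "x + e > 0" "k * e < x" using assms ke by linarith+
  have "(sw_integral k e has_real_derivative (1 + k) / (x + e) - k / x) (at x)"
    unfolding sw_integral_def[abs_def] using p by (auto intro!: derivative_eq_intros)
  moreover have "(1 + k) / (x + e) - k / x = (x - k * e) / (x * (x + e))"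
    using p by (simp add: divide_simps) (simp add: algebra_simps)
  then have "(1 + k) / (x + e) - k / x > 0" using p by simp
  ultimately show "\<exists>y. (sw_integral k e has_real_derivative y) (at x) \<and> 0 < y" by blast
next
  have "k * e > 0" using assms by simp
  then have "x > 0" "x + e > 0" if "x \<in> {\<alpha>..\<beta>}" for x
    using assms that unfolding atLeastAtMost_iff by linarith+
  then show "continuous_on {\<alpha>..\<beta>} (sw_integral k e)"
    unfolding sw_integral_def[abs_def] by (intro continuous_intros) force+
qed

lemma sw_integral_less_iff:
  assumes "k > 0" "e > 0" "k * e \<le> \<alpha>" "k * e \<le> \<beta>"
  shows "sw_integral k e \<alpha> < sw_integral k e \<beta> \<longleftrightarrow> \<alpha> < \<beta>"
  using sw_integral_strict_mono[of k e \<alpha> \<beta>] sw_integral_strict_mono[of k e \<beta> \<alpha>] assms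
  by (cases \<alpha> \<beta> rule: linorder_cases) auto

text \<open>\<open>A 1\<close> and \<open>A 2\<close> are the launch coordinates of the two arcs;
  read for both indices, \<open>A_other\<close> says that each arc lands where the other one is
  launched. \<open>limit_cycle_exists\<close> supplies such an \<open>A\<close> throughout
  \<open>Gamma_region\<close>.\<close>

locale limit_cycle = rates +
  fixes P :: "real \<times> real" and A :: "nat \<Rightarrow> real"
  assumes excess_pos: "i \<in> {1, 2} \<Longrightarrow> excess \<kappa> i P > 0"
    and snd_neg: "snd P < 0"
    and A_gt: "i \<in> {1, 2} \<Longrightarrow> A i > \<kappa> i * excess \<kappa> i P"
    and A_other: "i \<in> {1, 2} \<Longrightarrow> A (3 - i) = spread \<kappa> - half_return (\<kappa> i) (excess \<kappa> i P) (A i)"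
begin

abbreviation "ex i \<equiv> excess \<kappa> i P"
abbreviation "fl i \<equiv> flow \<kappa> i P"
abbreviation "pt i \<equiv> sw_point \<kappa> i P"
abbreviation "hr i \<equiv> half_return (\<kappa> i) (ex i)"
abbreviation "T i \<alpha> \<equiv> transit_time (\<kappa> i) (\<alpha> / ex i)"

text \<open>The coordinate of the tangency of the other field: beyond it lie crossing points.\<close>
definition "thr i = spread \<kappa> - \<kappa> (3 - i) * ex (3 - i)"

definition "cyc = (\<Union>i\<in>{1, 2}. fl i (pt i (A i)) ` {0..T i (A i)})"

text \<open>Points on arcs that start within \<open>\<rho>\<close> of the start of an arc of the periodic orbit.  As the half-return
  maps do not expand distances, the set of these points is forward invariant.\<close>
definition state :: "real \<Rightarrow> real \<times> real \<Rightarrow> bool" where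
  "state \<rho> z \<longleftrightarrow> (\<exists>i\<in>{1, 2}. \<exists>\<alpha> s. \<alpha> > thr i \<and> \<bar>\<alpha> - A i\<bar> < \<rho> \<and> 0 \<le> s \<and> s \<le> T i \<alpha> \<and> z = fl i (pt i \<alpha>) s)"

lemma thr_gt: "i \<in> {1, 2} \<Longrightarrow> thr i > \<kappa> i * ex i"
  using excess_sum_less[of i P] snd_neg by (simp add: thr_def)

lemma thr_other: "i \<in> {1, 2} \<Longrightarrow> thr (3 - i) = spread \<kappa> - \<kappa> i * ex i"
  by (auto simp: thr_def)

lemma \<kappa>_ex_pos: "i \<in> {1, 2} \<Longrightarrow> \<kappa> i * ex i > 0"
  by (intro mult_pos_pos \<kappa>_pos excess_pos)

text \<open>The third claim keeps the motion going: a landing is a launch of the other field that is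
  again beyond the threshold \<open>thr\<close>.\<close>

lemma hr_bounds:
  assumes "i \<in> {1, 2}" "\<alpha> > \<kappa> i * ex i"
  shows "0 < hr i \<alpha>" "hr i \<alpha> < \<kappa> i * ex i" "spread \<kappa> - hr i \<alpha> > thr (3 - i)"
  using half_return_bounds[OF \<kappa>_pos[OF assms(1)] excess_pos[OF assms(1)] assms(2)] thr_other[OF assms(1)]
  by simp_all

lemma A_gt_thr: "i \<in> {1, 2} \<Longrightarrow> A i > thr i"
  using hr_bounds(3)[OF other_index(1) A_gt[OF other_index(1)], of i] A_other[OF other_index(1), of i]
    other_index(2)[of i] by simp

lemma T_pos: "i \<in> {1, 2} \<Longrightarrow> \<alpha> > \<kappa> i * ex i \<Longrightarrow> T i \<alpha> > 0"
  by (intro transit_time \<kappa>_pos) (simp_all add: excess_pos pos_less_divide_eq)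

lemma transit_T: "i \<in> {1, 2} \<Longrightarrow> \<alpha> > \<kappa> i * ex i \<Longrightarrow> ex i * transit (\<kappa> i) (T i \<alpha>) = \<alpha>"
  using transit_time(2)[of "\<kappa> i" "\<alpha> / ex i"] \<kappa>_pos[of i] excess_pos[of i]
  by (simp add: pos_less_divide_eq)

lemma T_mono: "i \<in> {1, 2} \<Longrightarrow> \<alpha> > \<kappa> i * ex i \<Longrightarrow> \<alpha> \<le> \<beta> \<Longrightarrow> T i \<alpha> \<le> T i \<beta>"
  using transit_time_strict_mono[of "\<kappa> i" "\<alpha> / ex i" "\<beta> / ex i"] \<kappa>_pos[of i] excess_pos[of i]
  by (cases "\<alpha> = \<beta>") (simp_all add: pos_less_divide_eq divide_strict_right_mono less_imp_le)

lemma fl_return: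
  assumes "i \<in> {1, 2}" "\<alpha> > \<kappa> i * ex i"
  shows "fl i (pt i \<alpha>) (T i \<alpha>) = pt (3 - i) (spread \<kappa> - hr i \<alpha>)"
proof -
  note t = T_pos[OF assms] transit_T[OF assms]
  have "hr i \<alpha> = ex i * transit (\<kappa> i) (- T i \<alpha>)"
    using half_return_transit[OF \<kappa>_pos[OF assms(1)] excess_pos[OF assms(1)] t(1)] t(2) by simp
  then show ?thesis
    using flow_sw_point_return[OF t(1) t(2)[symmetric]] sw_point_other[OF assms(1)] by simp
qed

lemma fl_in_region_iff:
  assumes "i \<in> {1, 2}" "\<alpha> > \<kappa> i * ex i" "s > 0"
  shows "fl i (pt i \<alpha>) s \<in> region i P \<longleftrightarrow> s < T i \<alpha>"
proof -
  note t = T_pos[OF assms(1,2)] transit_T[OF assms(1,2)]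
  have "fl i (pt i \<alpha>) s \<in> region i P \<longleftrightarrow> ex i * transit (\<kappa> i) s < ex i * transit (\<kappa> i) (T i \<alpha>)"
    by (simp add: flow_sw_point_in_region_iff_transit[OF assms(1,3)] t(2))
  also have "\<dots> \<longleftrightarrow> s < T i \<alpha>"
    using excess_pos[OF assms(1)] transit_less_iff[OF \<kappa>_pos[OF assms(1)] assms(3) t(1)] by simp
  finally show ?thesis .
qed

text \<open>The closure appears because sliding could begin at an end point of the segment; a closed
  half-plane of abscissae holds the segment apart from the launch points.\<close>

lemma closure_sliding:
  assumes "i \<in> {1, 2}" "\<alpha> > thr i"
  shows "pt i \<alpha> \<notin> closure (sliding \<kappa> P)"
proof -
  let ?C = "{z. side i * (fst z - fst (equil \<kappa> i P)) \<le> thr i}"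
  have "sliding \<kappa> P \<subseteq> ?C"
  proof
    fix z assume z: "z \<in> sliding \<kappa> P"
    then have "height P z = 0" using sliding_subset_switching switching_iff by blast
    then obtain \<beta> where \<beta>: "z = pt i \<beta>" using sw_point_exhaust by blast
    have "(\<beta> - \<kappa> i * ex i) * (thr i - \<beta>) > 0"
      using z sliding_sw_point_iff[OF assms(1), of P \<beta>] by (simp add: \<beta> thr_def algebra_simps)
    then have "\<beta> \<le> thr i" using thr_gt[OF assms(1)] by (auto simp: zero_less_mult_iff)
    then show "z \<in> ?C" by (simp add: \<beta> side_sw_point)
  qed
  moreover have "closed ?C" by (intro closed_Collect_le continuous_intros)
  ultimately have "closure (sliding \<kappa> P) \<subseteq> ?C" by (rule closure_minimal)
  moreover have "pt i \<alpha> \<notin> ?C" using assms by (simp add: side_sw_point)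
  ultimately show ?thesis by blast
qed

text \<open>Launches beyond \<open>thr i\<close> are away from sliding and the other field does not
  enter its region there, so any orbit that meets such an arc is forced to follow it to the
  landing.\<close>

lemma orbit_step:
  assumes orb: "pws_orbit \<kappa> P \<phi>" "t \<ge> 0" and i: "i \<in> {1, 2}" and \<alpha>: "\<alpha> > thr i"
    and s: "0 \<le> s" "\<phi> t = fl i (pt i \<alpha>) s" and r: "0 \<le> r" "s + r \<le> T i \<alpha>"
  shows "\<phi> (t + r) = fl i (pt i \<alpha>) (s + r)"
proof -
  have \<alpha>': "\<alpha> > \<kappa> i * ex i" using \<alpha> thr_gt[OF i] by simp
  show ?thesis
  proof (cases "s < T i \<alpha>")
    case False
    then have "r = 0" using r by linarith
    then show ?thesis using s by simp
  next
    case True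
    have "\<phi> (t + r) = fl i (\<phi> t) r"
    proof (rule pws_follow[OF orb i, of "T i \<alpha> - s"])
      fix x assume "0 < x" "x < T i \<alpha> - s"
      then show "fl i (\<phi> t) x \<in> region i P"
        using s \<alpha>' fl_in_region_iff[OF i \<alpha>', of "s + x"] by (simp add: flow_flow)
    next
      show "\<phi> t \<in> region i P \<or> (\<forall>s>0. fl (3 - i) (\<phi> t) s \<notin> region (3 - i) P) \<and>
        (\<phi> t \<notin> closure (sliding \<kappa> P) \<or> (\<forall>t\<ge>0. \<phi> t \<notin> sliding \<kappa> P))"
      proof (cases "s = 0")
        case True
        then have eq: "\<phi> t = pt i \<alpha>" using s by simp
        \<comment> \<open>In the coordinate of the other field the point lies below that field's
          tangency, and \<open>transit_gt\<close> excludes flights from there.\<close>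
        have "fl (3 - i) (\<phi> t) x \<notin> region (3 - i) P" if "x > 0" for x
        proof -
          have j: "3 - i \<in> {1, 2}" using other_index i by blast
          have "ex (3 - i) * \<kappa> (3 - i) < ex (3 - i) * transit (\<kappa> (3 - i)) x"
            using transit_gt[OF \<kappa>_pos[OF j] that] excess_pos[OF j] by simp
          then have "spread \<kappa> - \<alpha> < ex (3 - i) * transit (\<kappa> (3 - i)) x"
            using \<alpha> by (simp add: thr_def mult.commute)
          then show ?thesis
            unfolding eq sw_point_other[OF i] flow_sw_point_in_region_iff_transit[OF j that] by simp
        qed
        then show ?thesis using closure_sliding[OF i \<alpha>] eq by simp
      next
        case False
        then show ?thesis using s True fl_in_region_iff[OF i \<alpha>', of s] by simp
      qed
    qed (use r in auto)
    then show ?thesis using s by (simp add: flow_flow)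
  qed
qed

lemma hr_lipschitz:
  assumes "i \<in> {1, 2}" "\<alpha> > thr i"
  shows "\<bar>spread \<kappa> - hr i \<alpha> - A (3 - i)\<bar> \<le> \<bar>\<alpha> - A i\<bar>"
  using half_return_lipschitz[OF \<kappa>_pos[OF assms(1)] excess_pos[OF assms(1)], of \<alpha> "A i"]
    A_gt[OF assms(1)] thr_gt[OF assms(1)] A_other[OF assms(1)] assms by simp

text \<open>A positive lower bound for all flight times that occur: during a time step of this
  length at most one landing takes place, so crossings cannot accumulate.\<close>

definition "T_min = Min ((\<lambda>i. T i (thr i)) ` {1, 2})"

lemma T_min: "T_min > 0" "i \<in> {1, 2} \<Longrightarrow> \<alpha> > thr i \<Longrightarrow> T_min \<le> T i \<alpha>"
proof -
  show "T_min > 0" unfolding T_min_def using T_pos thr_gt by (subst Min_gr_iff) auto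
  assume i: "i \<in> {1, 2}" "\<alpha> > thr i"
  have "T_min \<le> T i (thr i)" unfolding T_min_def using i by (intro Min_le) auto
  also have "\<dots> \<le> T i \<alpha>" using i by (intro T_mono thr_gt) auto
  finally show "T_min \<le> T i \<alpha>" .
qed

text \<open>If the step passes a landing, \<open>hr_lipschitz\<close> keeps the new launch within
  the window \<open>\<rho>\<close>, and the remaining time is too short for a second
  landing.\<close>

lemma state_invariant_short:
  assumes orb: "pws_orbit \<kappa> P \<phi>" "t \<ge> 0" and st: "state \<rho> (\<phi> t)" and r: "0 \<le> r" "r \<le> T_min"
  shows "state \<rho> (\<phi> (t + r))"
proof -
  obtain i \<alpha> s where i: "i \<in> {1, 2}" and \<alpha>: "\<alpha> > thr i" "\<bar>\<alpha> - A i\<bar> < \<rho>"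
    and s: "0 \<le> s" "s \<le> T i \<alpha>" "\<phi> t = fl i (pt i \<alpha>) s"
    using st unfolding state_def by blast
  show ?thesis
  proof (cases "s + r \<le> T i \<alpha>")
    case True
    have "\<phi> (t + r) = fl i (pt i \<alpha>) (s + r)"
      by (rule orbit_step[OF orb i \<alpha>(1) s(1,3) r(1) True])
    then show ?thesis unfolding state_def using i \<alpha> s r True
      by (intro bexI[OF _ i] exI[of _ \<alpha>] exI[of _ "s + r"]) auto
  next
    case False
    have j: "3 - i \<in> {1, 2}" using other_index i by blast
    have \<alpha>': "\<alpha> > \<kappa> i * ex i" using \<alpha> thr_gt[OF i] by simp
    let ?\<beta> = "spread \<kappa> - hr i \<alpha>"
    have \<beta>: "?\<beta> > thr (3 - i)" "\<bar>?\<beta> - A (3 - i)\<bar> < \<rho>"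
      using hr_bounds(3)[OF i \<alpha>'] hr_lipschitz[OF i \<alpha>(1)] \<alpha> by auto
    have "\<phi> (t + (T i \<alpha> - s)) = fl i (pt i \<alpha>) (s + (T i \<alpha> - s))"
      by (rule orbit_step[OF orb i \<alpha>(1) s(1,3)]) (use s in auto)
    then have 1: "\<phi> (t + (T i \<alpha> - s)) = fl (3 - i) (pt (3 - i) ?\<beta>) 0"
      using fl_return[OF i \<alpha>'] by simp
    let ?r = "r - (T i \<alpha> - s)"
    have "T_min \<le> T (3 - i) ?\<beta>" using T_min(2)[OF j \<beta>(1)] .
    then have r': "0 \<le> ?r" "0 + ?r \<le> T (3 - i) ?\<beta>" using False r s by auto
    have "\<phi> (t + (T i \<alpha> - s) + ?r) = fl (3 - i) (pt (3 - i) ?\<beta>) (0 + ?r)"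
      by (rule orbit_step[OF orb(1) _ j \<beta>(1) _ 1 r']) (use orb s in auto)
    then have "\<phi> (t + r) = fl (3 - i) (pt (3 - i) ?\<beta>) ?r" by simp
    then show ?thesis unfolding state_def using \<beta> r'
      by (intro bexI[OF _ j] exI[of _ ?\<beta>] exI[of _ ?r]) auto
  qed
qed

lemma state_invariant:
  assumes orb: "pws_orbit \<kappa> P \<phi>" "t \<ge> 0" and st: "state \<rho> (\<phi> t)" and u: "t \<le> u"
  shows "state \<rho> (\<phi> u)"
proof -
  have *: "\<forall>r. 0 \<le> r \<and> r \<le> of_nat n * T_min \<longrightarrow> state \<rho> (\<phi> (t + r))" for n
  proof (induction n)
    case 0
    have "r = 0" if "0 \<le> r \<and> r \<le> of_nat 0 * T_min" for r using that by simp
    then show ?case using st by fastforce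
  next
    case (Suc n)
    show ?case
    proof (intro allI impI)
      fix r assume r: "0 \<le> r \<and> r \<le> of_nat (Suc n) * T_min"
      show "state \<rho> (\<phi> (t + r))"
      proof (cases "r \<le> of_nat n * T_min")
        case True then show ?thesis using Suc r by simp
      next
        case False
        let ?m = "of_nat n * T_min"
        have m: "?m \<ge> 0" using T_min(1) by simp
        have "state \<rho> (\<phi> (t + ?m))" using Suc m by blast
        then have "state \<rho> (\<phi> ((t + ?m) + (r - ?m)))"
          by (rule state_invariant_short[OF orb(1), rotated])
             (use m orb r False in \<open>auto simp: algebra_simps\<close>)
        then show ?thesis by simp
      qed
    qed
  qed
  obtain n where "(u - t) / T_min \<le> of_nat n" using real_arch_simple by blast
  then have "u - t \<le> of_nat n * T_min" using T_min(1) by (simp add: pos_divide_le_eq)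
  then show ?thesis using *[of n] u by (metis add_diff_cancel_left' diff_add_cancel add.commute diff_ge_0_iff_ge)
qed

lemma pt_A_eq: "i \<in> {1, 2} \<Longrightarrow> fl i (pt i (A i)) (T i (A i)) = pt (3 - i) (A (3 - i))"
  using fl_return A_gt A_other by simp

lemma cyc_compact: "compact cyc"
  unfolding cyc_def by (intro compact_UN compact_continuous_image continuous_on_flow) auto

lemma pt_in_cyc: "i \<in> {1, 2} \<Longrightarrow> 0 \<le> s \<Longrightarrow> s \<le> T i (A i) \<Longrightarrow> fl i (pt i (A i)) s \<in> cyc"
  unfolding cyc_def by (rule UN_I[of i]) auto

lemma cyc_nonempty: "cyc \<noteq> {}"
  using pt_in_cyc[of 1 0] T_pos[of 1 "A 1"] A_gt[of 1] by auto

text \<open>Two errors add up: the displacement of the launch point, which the flow does not expand,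
  and the mismatch of flight times, which is small by continuity of
  \<open>transit_time\<close>.\<close>

lemma state_close_one:
  assumes i: "i \<in> {1, 2}" and "\<epsilon> > 0"
  shows "\<exists>\<rho>>0. \<forall>\<alpha> s. \<alpha> > thr i \<and> \<bar>\<alpha> - A i\<bar> < \<rho> \<and> 0 \<le> s \<and> s \<le> T i \<alpha> \<longrightarrow> infdist (fl i (pt i \<alpha>) s) cyc < \<epsilon>"
proof -
  have k: "\<kappa> i > 0" using \<kappa>_pos[OF i] .
  \<comment> \<open>Lipschitz constant in time along the arc of the cycle, increased by 1 so that it
    can be divided by.\<close>
  define C where "C = 1 + (1 + \<kappa> i) * norm (pt i (A i) - equil \<kappa> i P)"
  have C: "C > 0" unfolding C_def using k by (intro add_pos_nonneg mult_nonneg_nonneg) auto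
  have "((\<lambda>\<alpha>. \<alpha> / ex i) \<longlongrightarrow> A i / ex i) (at (A i))"
    by (intro tendsto_intros) (use excess_pos[OF i] in auto)
  then have "((\<lambda>\<alpha>. T i \<alpha>) \<longlongrightarrow> T i (A i)) (at (A i))"
    by (rule transit_time_tendsto[OF k, rotated])
       (use A_gt[OF i] excess_pos[OF i] in \<open>simp add: pos_less_divide_eq\<close>)
  then obtain d where d: "d > 0" "\<And>\<alpha>. \<alpha> \<noteq> A i \<Longrightarrow> \<bar>\<alpha> - A i\<bar> < d \<Longrightarrow> \<bar>T i \<alpha> - T i (A i)\<bar> < \<epsilon> / (2 * C)"
    using C \<open>\<epsilon> > 0\<close> unfolding LIM_def dist_real_def by (metis divide_pos_pos mult_pos_pos zero_less_numeral)
  have d': "\<bar>T i \<alpha> - T i (A i)\<bar> < \<epsilon> / (2 * C)" if "\<bar>\<alpha> - A i\<bar> < d" for \<alpha>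
    using d(2)[OF _ that] C \<open>\<epsilon> > 0\<close> by (cases "\<alpha> = A i") auto
  show ?thesis
  proof (intro exI[of _ "min d (\<epsilon> / 4)"] conjI allI impI)
    show "0 < min d (\<epsilon> / 4)" using d \<open>\<epsilon> > 0\<close> by simp
    fix \<alpha> s assume h: "\<alpha> > thr i \<and> \<bar>\<alpha> - A i\<bar> < min d (\<epsilon> / 4) \<and> 0 \<le> s \<and> s \<le> T i \<alpha>"
    \<comment> \<open>A nearby arc may outlast the arc of the cycle; its time is cut off at the
      landing of the latter.\<close>
    define u where "u = min s (T i (A i))"
    have tA: "T i (A i) > 0" using T_pos A_gt i by blast
    have u: "0 \<le> u" "u \<le> T i (A i)" using h tA by (auto simp: u_def)
    have su: "\<bar>s - u\<bar> < \<epsilon> / (2 * C)"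
    proof -
      have "\<bar>s - u\<bar> \<le> \<bar>T i \<alpha> - T i (A i)\<bar>" using h by (auto simp: u_def min_def)
      then show ?thesis using d'[of \<alpha>] h by simp
    qed
    have "infdist (fl i (pt i \<alpha>) s) cyc \<le> dist (fl i (pt i \<alpha>) s) (fl i (pt i (A i)) u)"
      using pt_in_cyc[OF i u] by (rule infdist_le)
    also have "\<dots> \<le> dist (fl i (pt i \<alpha>) s) (fl i (pt i (A i)) s) + dist (fl i (pt i (A i)) s) (fl i (pt i (A i)) u)"
      by (rule dist_triangle)
    also have "\<dots> \<le> dist (pt i \<alpha>) (pt i (A i)) + (1 + \<kappa> i) * \<bar>s - u\<bar> * norm (pt i (A i) - equil \<kappa> i P)"
      using dist_flow_le[of \<kappa> i s P "pt i \<alpha>" P "pt i (A i)"] dist_flow_time_le[of \<kappa> i s u P "pt i (A i)"] k h u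
      by (intro add_mono) auto
    also have "\<dots> \<le> 2 * \<bar>\<alpha> - A i\<bar> + C * \<bar>s - u\<bar>"
      using dist_sw_point_le[of \<kappa> i P \<alpha> "A i"] by (intro add_mono) (auto simp: C_def algebra_simps)
    also have "\<dots> < \<epsilon> / 2 + C * (\<epsilon> / (2 * C))"
      using su C h by (intro add_strict_mono mult_strict_left_mono) auto
    also have "\<dots> = \<epsilon>" using C by simp
    finally show "infdist (fl i (pt i \<alpha>) s) cyc < \<epsilon>" .
  qed
qed

lemma state_close:
  assumes "\<epsilon> > 0"
  shows "\<exists>\<rho>>0. \<forall>z. state \<rho> z \<longrightarrow> infdist z cyc < \<epsilon>"
proof -
  obtain \<rho>\<^sub>1 where 1: "\<rho>\<^sub>1 > 0" "\<forall>\<alpha> s. \<alpha> > thr 1 \<and> \<bar>\<alpha> - A 1\<bar> < \<rho>\<^sub>1 \<and> 0 \<le> s \<and> s \<le> T 1 \<alpha> \<longrightarrow> infdist (fl 1 (pt 1 \<alpha>) s) cyc < \<epsilon>"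
    using state_close_one[OF _ assms, of 1] by auto
  obtain \<rho>\<^sub>2 where 2: "\<rho>\<^sub>2 > 0" "\<forall>\<alpha> s. \<alpha> > thr 2 \<and> \<bar>\<alpha> - A 2\<bar> < \<rho>\<^sub>2 \<and> 0 \<le> s \<and> s \<le> T 2 \<alpha> \<longrightarrow> infdist (fl 2 (pt 2 \<alpha>) s) cyc < \<epsilon>"
    using state_close_one[OF _ assms, of 2] by auto
  show ?thesis
    using 1 2 by (intro exI[of _ "min \<rho>\<^sub>1 \<rho>\<^sub>2"]) (auto simp: state_def)
qed

lemma pt_in_quadrant: "i \<in> {1, 2} \<Longrightarrow> \<alpha> > 0 \<Longrightarrow> pt i \<alpha> \<in> quadrant \<kappa> i P"
  using excess_pos[of i] by (simp add: quadrant_def side_sw_point del: insert_iff)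

text \<open>The levels of the first integrals describe the states by open conditions around the
  cycle; compactness of the cycle then yields a uniform distance.\<close>

lemma nbhd_states:
  assumes "\<rho> > 0"
  shows "\<exists>\<delta>>0. \<forall>z. infdist z cyc < \<delta> \<longrightarrow> state \<rho> z"
proof -
  \<comment> \<open>Besides \<open>r \<le> \<rho>\<close>, the choice keeps \<open>A i - r\<close>
    at or above \<open>thr i\<close>, so that levels within the window belong to launches beyond the
    threshold.\<close>
  define r where "r = min \<rho> (min (A 1 - thr 1) (A 2 - thr 2))"
  have r: "0 < r" "r \<le> \<rho>" and rA: "\<And>i. i \<in> {1, 2} \<Longrightarrow> thr i \<le> A i - r"
    using assms A_gt_thr[of 1] A_gt_thr[of 2] by (auto simp: r_def)
  define c where "c i = sw_integral (\<kappa> i) (ex i)" for i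
  have c_less: "c i \<alpha> < c i \<beta> \<longleftrightarrow> \<alpha> < \<beta>" if "i \<in> {1, 2}" "\<alpha> \<ge> \<kappa> i * ex i" "\<beta> \<ge> \<kappa> i * ex i" for i \<alpha> \<beta>
    unfolding c_def using that by (intro sw_integral_less_iff \<kappa>_pos excess_pos)
  define U where "U i = quadrant \<kappa> i P \<inter> first_integral \<kappa> i P -` {c i (A i - r)<..<c i (A i + r)}" for i
  have U_open: "open (U i)" for i unfolding U_def
    by (rule continuous_open_preimage[OF continuous_on_first_integral open_quadrant open_greaterThanLessThan])
  have U_fl: "fl i (pt i \<alpha>) s \<in> U i \<longleftrightarrow> \<bar>\<alpha> - A i\<bar> < r" if i: "i \<in> {1, 2}" and \<alpha>: "\<alpha> > \<kappa> i * ex i" for i \<alpha> s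
  proof -
    have q: "pt i \<alpha> \<in> quadrant \<kappa> i P" using pt_in_quadrant[OF i] \<alpha> \<kappa>_ex_pos[OF i] by simp
    have "fl i (pt i \<alpha>) s \<in> U i \<longleftrightarrow> c i (A i - r) < c i \<alpha> \<and> c i \<alpha> < c i (A i + r)"
      using q unfolding U_def by (simp add: flow_in_quadrant_iff first_integral_flow first_integral_sw_point c_def)
    also have "\<dots> \<longleftrightarrow> A i - r < \<alpha> \<and> \<alpha> < A i + r"
      using c_less[OF i] rA[OF i] thr_gt[OF i] \<alpha> r(1) by simp
    finally show ?thesis by auto
  qed
  \<comment> \<open>A junction lies on both arcs and has neighbours in both regions, so both level
    conditions are imposed there; elsewhere on the cycle the condition of the field active in the
    region is enough. All three pieces are open.\<close>
  define N where "N = (U 1 \<inter> U 2) \<union> (U 1 \<inter> region 1 P) \<union> (U 2 \<inter> region 2 P)"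
  have "open N" unfolding N_def using U_open open_region by (intro open_Un open_Int)
  have N_region: "z \<in> N" if "i \<in> {1, 2}" "z \<in> U i" "z \<in> region i P" for i z
    using that by (auto simp: N_def)
  have U_A: "fl i (pt i (A i)) s \<in> U i" if i: "i \<in> {1, 2}" for i s
    using U_fl[OF i A_gt[OF i]] r by simp
  have pt_N: "pt i (A i) \<in> N" if i: "i \<in> {1, 2}" for i
  proof -
    have "pt i (A i) \<in> U i" using U_A[OF i, of 0] by simp
    moreover have "pt i (A i) \<in> U (3 - i)"
      using U_A[OF other_index(1)[OF i], of "T (3 - i) (A (3 - i))"] pt_A_eq[OF other_index(1)[OF i]] other_index(2)[OF i]
      by simp
    ultimately show ?thesis using i by (auto simp: N_def)
  qed
  have "cyc \<subseteq> N"
  proof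
    fix z assume "z \<in> cyc"
    then obtain i where i: "i \<in> {1, 2}" and "z \<in> fl i (pt i (A i)) ` {0..T i (A i)}"
      unfolding cyc_def by (rule UN_E)
    then obtain s where s: "0 \<le> s" "s \<le> T i (A i)" and z: "z = fl i (pt i (A i)) s"
      by auto
    consider "s = 0" | "s = T i (A i)" | "0 < s" "s < T i (A i)" using s by force
    then show "z \<in> N"
    proof cases
      case 1 then show ?thesis using pt_N[OF i] z by simp
    next
      case 2 then show ?thesis using pt_N[OF other_index(1)[OF i]] pt_A_eq[OF i] z by simp
    next
      case 3
      then have "z \<in> region i P" using fl_in_region_iff[OF i A_gt[OF i]] z by simp
      then show ?thesis using N_region[OF i] U_A[OF i] z by simp
    qed
  qed
  have N_state: "state \<rho> z" if "z \<in> N" for z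
  proof -
    have state: "state \<rho> z" if i: "i \<in> {1, 2}" and \<alpha>: "\<alpha> > \<kappa> i * ex i" and z: "z \<in> U i" "z = fl i (pt i \<alpha>) s"
        and s: "0 \<le> s" "s \<le> T i \<alpha>" for i \<alpha> s
    proof -
      have a: "\<bar>\<alpha> - A i\<bar> < r" using U_fl[OF i \<alpha>] z by simp
      then have "\<alpha> > thr i" using rA[OF i] by simp
      then show ?thesis unfolding state_def using i a r s z(2)
        by (intro bexI[OF _ i] exI[of _ \<alpha>] exI[of _ s]) auto
    qed
    have region: "state \<rho> z" if i: "i \<in> {1, 2}" and z: "z \<in> U i" "z \<in> region i P" for i
    proof (rule arc_cover[OF i excess_pos[OF i] z(2)])
      show "0 < side i * (fst z - fst (equil \<kappa> i P))" using z(1) by (simp add: U_def quadrant_def)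
    next
      fix \<alpha> s assume "\<kappa> i * ex i < \<alpha>" "0 < s" "s < T i \<alpha>" "z = fl i (pt i \<alpha>) s"
      then show ?thesis using state[OF i _ z(1)] by simp
    qed
    show ?thesis
    proof (cases "z \<in> switching P")
      case False
      then have "z \<in> region 1 P \<or> z \<in> region 2 P"
        by (auto simp: switching_iff region_iff)
      moreover have "z \<in> U i" if "z \<in> region i P" "i \<in> {1, 2}" for i
        using \<open>z \<in> N\<close> that region_disjoint(1)[OF that(2,1)] by (auto simp: N_def)
      ultimately show ?thesis using region by blast
    next
      case True
      then obtain \<alpha> where \<alpha>: "z = pt 1 \<alpha>" using sw_point_exhaust switching_iff by blast
      have "z \<notin> region 1 P" "z \<notin> region 2 P"
        using True region_disjoint(2)[of 1 z P] region_disjoint(2)[of 2 z P] by auto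
      then have zU: "z \<in> U 1" "z \<in> U 2" using \<open>z \<in> N\<close> by (auto simp: N_def)
      show ?thesis
      \<comment> \<open>A point on the line is treated as a launch with elapsed time 0. If it is not
        beyond the tangency of field 1, its other coordinate is at least \<open>thr 2\<close>, hence
        beyond the tangency of field 2.\<close>
      proof (cases "\<alpha> > \<kappa> 1 * ex 1")
        case True
        then show ?thesis using state[of 1 \<alpha> 0] zU \<alpha> T_pos[of 1 \<alpha>] by simp
      next
        case False
        have z2: "z = pt 2 (spread \<kappa> - \<alpha>)" using sw_point_other[of 1 \<kappa> P \<alpha>] \<alpha> by simp
        have "spread \<kappa> - \<alpha> > \<kappa> 2 * ex 2"
          using False thr_gt[of 2] by (simp add: thr_def)
        then show ?thesis using state[of 2 "spread \<kappa> - \<alpha>" 0] zU z2 T_pos[of 2 "spread \<kappa> - \<alpha>"] by simp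
      qed
    qed
  qed
  obtain \<delta> where \<delta>: "\<delta> > 0" "(\<Union>x\<in>cyc. ball x \<delta>) \<subseteq> N"
    using compact_subset_open_imp_ball_epsilon_subset[OF cyc_compact \<open>open N\<close> \<open>cyc \<subseteq> N\<close>] by blast
  show ?thesis
  proof (intro exI[of _ \<delta>] conjI allI impI \<delta>(1))
    fix z assume "infdist z cyc < \<delta>"
    moreover obtain x where "x \<in> cyc" "infdist z cyc = dist z x"
      using infdist_attains_inf[OF compact_imp_closed[OF cyc_compact] cyc_nonempty] by blast
    ultimately have "z \<in> (\<Union>x\<in>cyc. ball x \<delta>)" by (auto simp: dist_commute)
    then show "state \<rho> z" using \<delta> N_state by blast
  qed
qed

section \<open>The return map and asymptotic stability\<close>

definition "ret i \<alpha> = spread \<kappa> - hr (3 - i) (spread \<kappa> - hr i \<alpha>)"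

lemma ret_gt:
  assumes i: "i \<in> {1, 2}" and \<alpha>: "\<alpha> > \<kappa> i * ex i"
  shows "ret i \<alpha> > thr i"
proof -
  have j: "3 - i \<in> {1, 2}" "3 - (3 - i) = i" using other_index i by blast+
  have "spread \<kappa> - hr i \<alpha> > \<kappa> (3 - i) * ex (3 - i)"
    using hr_bounds(3)[OF i \<alpha>] thr_gt[OF j(1)] by simp
  from hr_bounds(3)[OF j(1) this] show ?thesis by (simp add: ret_def j(2))
qed

lemma ret_A: "i \<in> {1, 2} \<Longrightarrow> ret i (A i) = A i"
  using A_other[of i] A_other[OF other_index(1), of i] other_index(2)[of i] by (simp add: ret_def)

text \<open>Two decreasing maps with slopes above -1 compose to an increasing map with slope below
  1: iterates neither overshoot the fixed point nor stop before it.\<close>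

lemma ret_mono:
  assumes i: "i \<in> {1, 2}" and \<alpha>: "\<alpha> > \<kappa> i * ex i" "\<alpha> < \<beta>"
  shows "ret i \<alpha> < ret i \<beta>" "ret i \<beta> - ret i \<alpha> < \<beta> - \<alpha>"
proof -
  have j: "3 - i \<in> {1, 2}" "3 - (3 - i) = i" using other_index i by blast+
  have 1: "hr i \<beta> < hr i \<alpha>" "\<alpha> + hr i \<alpha> < \<beta> + hr i \<beta>"
    using half_return_antimono[OF \<kappa>_pos[OF i] excess_pos[OF i] \<alpha>] by auto
  have 2: "spread \<kappa> - hr i \<alpha> > \<kappa> (3 - i) * ex (3 - i)"
    using hr_bounds(3)[OF i \<alpha>(1)] thr_gt[OF j(1)] by simp
  show "ret i \<alpha> < ret i \<beta>" "ret i \<beta> - ret i \<alpha> < \<beta> - \<alpha>"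
    using half_return_antimono[OF \<kappa>_pos[OF j(1)] excess_pos[OF j(1)] 2, of "spread \<kappa> - hr i \<beta>"] 1
    by (auto simp: ret_def)
qed

lemma continuous_on_ret:
  assumes i: "i \<in> {1, 2}"
  shows "continuous_on {thr i<..} (ret i)"
  unfolding continuous_on_iff dist_real_def
proof (intro ballI allI impI)
  fix x d :: real assume x: "x \<in> {thr i<..}" "d > 0"
  have "\<bar>ret i y - ret i x\<bar> \<le> \<bar>y - x\<bar>" if "y > thr i" for y
    using ret_mono[OF i, of x y] ret_mono[OF i, of y x] x that thr_gt[OF i]
    by (cases x y rule: linorder_cases) auto
  then show "\<exists>r>0. \<forall>y\<in>{thr i<..}. \<bar>y - x\<bar> < r \<longrightarrow> \<bar>ret i y - ret i x\<bar> < d"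
    using x by (intro exI[of _ d]) force
qed

lemma ret_iterates:
  assumes i: "i \<in> {1, 2}" and \<alpha>: "\<alpha> > thr i"
  shows "(\<lambda>n. (ret i ^^ n) \<alpha>) \<longlonglongrightarrow> A i"
proof (rule iterate_tendsto_fixpoint[OF continuous_on_ret[OF i] A_gt_thr[OF i] \<alpha> _ _ ret_A[OF i]])
  fix x assume "thr i < x" "x < A i"
  then show "x < ret i x \<and> ret i x \<le> A i"
    using ret_mono[OF i, of x "A i"] ret_A[OF i] thr_gt[OF i] by simp
next
  fix x assume "A i < x"
  then show "ret i x < x \<and> A i \<le> ret i x"
    using ret_mono[OF i, of "A i" x] ret_A[OF i] A_gt[OF i] by simp
qed

lemma orbit_half_return:
  assumes "pws_orbit \<kappa> P \<phi>" "t \<ge> 0" "i \<in> {1, 2}" "\<alpha> > thr i" "0 \<le> s" "s \<le> T i \<alpha>" "\<phi> t = fl i (pt i \<alpha>) s"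
  shows "\<exists>u\<ge>0. \<phi> u = pt (3 - i) (spread \<kappa> - hr i \<alpha>)"
proof -
  have "\<phi> (t + (T i \<alpha> - s)) = fl i (pt i \<alpha>) (s + (T i \<alpha> - s))"
    by (rule orbit_step[OF assms(1-5,7)]) (use assms in auto)
  moreover have "\<alpha> > \<kappa> i * ex i" using assms(3,4) thr_gt by fastforce
  ultimately show ?thesis using fl_return[OF assms(3)] assms(2,6)
    by (intro exI[of _ "t + (T i \<alpha> - s)"]) simp
qed

lemma orbit_ret:
  assumes orb: "pws_orbit \<kappa> P \<phi>" "t \<ge> 0" and i: "i \<in> {1, 2}" and \<alpha>: "\<alpha> > thr i" and "\<phi> t = pt i \<alpha>"
  shows "\<exists>u\<ge>0. \<phi> u = pt i ((ret i ^^ n) \<alpha>)" "(ret i ^^ n) \<alpha> > thr i"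
proof -
  have "(\<exists>u\<ge>0. \<phi> u = pt i ((ret i ^^ n) \<alpha>)) \<and> (ret i ^^ n) \<alpha> > thr i"
  proof (induction n)
    case 0 then show ?case using assms by auto
  next
    case (Suc n)
    let ?\<beta> = "(ret i ^^ n) \<alpha>"
    obtain u where u: "u \<ge> 0" "\<phi> u = fl i (pt i ?\<beta>) 0" and \<beta>: "?\<beta> > thr i" using Suc by auto
    have j: "3 - i \<in> {1, 2}" "3 - (3 - i) = i" using other_index i by blast+
    have \<beta>': "?\<beta> > \<kappa> i * ex i" using \<beta> thr_gt[OF i] by simp
    let ?\<gamma> = "spread \<kappa> - hr i ?\<beta>"
    obtain v where v: "v \<ge> 0" "\<phi> v = fl (3 - i) (pt (3 - i) ?\<gamma>) 0"
      using orbit_half_return[OF orb(1) u(1) i \<beta> _ _ u(2)] T_pos[OF i \<beta>'] by auto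
    have \<gamma>: "?\<gamma> > thr (3 - i)" by (rule hr_bounds(3)[OF i \<beta>'])
    then have \<gamma>': "?\<gamma> > \<kappa> (3 - i) * ex (3 - i)" using thr_gt[OF j(1)] by simp
    have "\<exists>u\<ge>0. \<phi> u = pt i (ret i ?\<beta>)"
      using orbit_half_return[OF orb(1) v(1) j(1) \<gamma> _ _ v(2)] T_pos[OF j(1) \<gamma>'] by (auto simp: ret_def j(2))
    then show ?case using ret_gt[OF i \<beta>'] by simp
  qed
  then show "\<exists>u\<ge>0. \<phi> u = pt i ((ret i ^^ n) \<alpha>)" "(ret i ^^ n) \<alpha> > thr i" by auto
qed

text \<open>The orbit may start inside an arc, so the return map is iterated from the first landing
  on. Since \<open>\<rho>\<close> is arbitrary, this together with \<open>state_invariant\<close>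
  gives attraction.\<close>

lemma states_reached:
  assumes orb: "pws_orbit \<kappa> P \<phi>" and st: "state \<sigma> (\<phi> 0)" and "\<rho> > 0"
  shows "\<exists>t\<ge>0. state \<rho> (\<phi> t)"
proof -
  obtain i \<alpha> s where i: "i \<in> {1, 2}" and \<alpha>: "\<alpha> > thr i"
    and s: "0 \<le> s" "s \<le> T i \<alpha>" "\<phi> 0 = fl i (pt i \<alpha>) s"
    using st unfolding state_def by blast
  let ?j = "3 - i" and ?\<beta> = "spread \<kappa> - hr i \<alpha>"
  have j: "?j \<in> {1, 2}" using other_index i by blast
  have \<beta>: "?\<beta> > thr ?j" by (rule hr_bounds(3)[OF i]) (use \<alpha> thr_gt[OF i] in simp)
  obtain u where u: "u \<ge> 0" "\<phi> u = pt ?j ?\<beta>"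
    using orbit_half_return[OF orb order_refl i \<alpha> s] by blast
  have "\<forall>\<^sub>F n in sequentially. \<bar>(ret ?j ^^ n) ?\<beta> - A ?j\<bar> < \<rho>"
    using ret_iterates[OF j \<beta>] \<open>\<rho> > 0\<close> by (auto simp: tendsto_iff dist_real_def)
  then obtain n where n: "\<bar>(ret ?j ^^ n) ?\<beta> - A ?j\<bar> < \<rho>"
    using eventually_happens trivial_limit_sequentially by blast
  obtain v where v: "v \<ge> 0" "\<phi> v = pt ?j ((ret ?j ^^ n) ?\<beta>)" and gt: "(ret ?j ^^ n) ?\<beta> > thr ?j"
    using orbit_ret[OF orb u(1) j \<beta> u(2)] by blast
  have "T ?j ((ret ?j ^^ n) ?\<beta>) > 0" by (rule T_pos[OF j]) (use gt thr_gt[OF j] in simp)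
  then have "state \<rho> (\<phi> v)" unfolding state_def using n gt v
    by (intro bexI[OF _ j] exI[of _ "(ret ?j ^^ n) ?\<beta>"] exI[of _ 0]) auto
  then show ?thesis using v by blast
qed

text \<open>The states of size \<open>\<rho>\<close> act as forward invariant neighbourhoods: by
  \<open>nbhd_states\<close> each contains a metric neighbourhood of the cycle, and by
  \<open>state_close\<close> they shrink to it.\<close>

lemma stable_set_cyc: "stable_set \<kappa> P cyc"
  unfolding stable_set_def
proof (intro conjI allI impI)
  fix \<epsilon> :: real assume "\<epsilon> > 0"
  then obtain \<rho> where \<rho>: "\<rho> > 0" "\<forall>z. state \<rho> z \<longrightarrow> infdist z cyc < \<epsilon>" using state_close by blast
  obtain \<delta> where \<delta>: "\<delta> > 0" "\<forall>z. infdist z cyc < \<delta> \<longrightarrow> state \<rho> z" using nbhd_states[OF \<rho>(1)] by blast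
  show "\<exists>\<delta>>0. \<forall>\<phi>. pws_orbit \<kappa> P \<phi> \<and> infdist (\<phi> 0) cyc < \<delta> \<longrightarrow> (\<forall>t\<ge>0. infdist (\<phi> t) cyc < \<epsilon>)"
  proof (intro exI[of _ \<delta>] conjI allI impI \<delta>(1))
    fix \<phi> :: "real \<Rightarrow> real \<times> real" and t :: real
    assume \<phi>: "pws_orbit \<kappa> P \<phi> \<and> infdist (\<phi> 0) cyc < \<delta>" and "0 \<le> t"
    then have "state \<rho> (\<phi> 0)" using \<delta> by blast
    then have "state \<rho> (\<phi> t)" using state_invariant[of \<phi> 0] \<phi> \<open>0 \<le> t\<close> by blast
    then show "infdist (\<phi> t) cyc < \<epsilon>" using \<rho> by blast
  qed
next
  obtain \<delta> where \<delta>: "\<delta> > 0" "\<forall>z. infdist z cyc < \<delta> \<longrightarrow> state 1 z" using nbhd_states[of 1] by auto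
  show "\<exists>\<delta>>0. \<forall>\<phi>. pws_orbit \<kappa> P \<phi> \<and> infdist (\<phi> 0) cyc < \<delta> \<longrightarrow> ((\<lambda>t. infdist (\<phi> t) cyc) \<longlongrightarrow> 0) at_top"
  proof (intro exI[of _ \<delta>] conjI allI impI \<delta>(1))
    fix \<phi> assume \<phi>: "pws_orbit \<kappa> P \<phi> \<and> infdist (\<phi> 0) cyc < \<delta>"
    show "((\<lambda>t. infdist (\<phi> t) cyc) \<longlongrightarrow> 0) at_top"
    proof (rule tendstoI)
      fix \<epsilon> :: real assume "\<epsilon> > 0"
      then obtain \<rho> where \<rho>: "\<rho> > 0" "\<forall>z. state \<rho> z \<longrightarrow> infdist z cyc < \<epsilon>" using state_close by blast
      obtain t where t: "t \<ge> 0" "state \<rho> (\<phi> t)" using states_reached[of \<phi> 1 \<rho>] \<phi> \<delta> \<rho> by blast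
      then have "\<forall>u\<ge>t. infdist (\<phi> u) cyc < \<epsilon>" using state_invariant[of \<phi> t] \<phi> \<rho> by blast
      then show "\<forall>\<^sub>F u in at_top. dist (infdist (\<phi> u) cyc) 0 < \<epsilon>"
        unfolding eventually_at_top_linorder by (auto simp: dist_real_def infdist_nonneg)
    qed
  qed
qed

end

section \<open>The sliding segment and its type\<close>

context rates
begin

lemma vf_nvec_switching:
  "z \<in> switching P \<Longrightarrow> vf \<kappa> i P z \<bullet> nvec = fst z - fst (tangency \<kappa> i P)"
  by (cases z) (auto simp: switching_def vf_def nvec_def tangency_def split_beta algebra_simps)

lemma tangency_diff: "fst (tangency \<kappa> 2 P) - fst (tangency \<kappa> 1 P) = (\<kappa> 2 - \<kappa> 1) * snd P"
  by (simp add: tangency_def split_beta algebra_simps)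

lemma sliding_iff:
  "z \<in> sliding \<kappa> P \<longleftrightarrow> z \<in> switching P \<and>
     (fst z - fst (tangency \<kappa> 1 P)) * (fst z - fst (tangency \<kappa> 2 P)) < 0"
  by (auto simp: sliding_def vf_nvec_switching)

lemma sliding_nonempty:
  assumes "snd P \<noteq> 0" shows "sliding \<kappa> P \<noteq> {}"
proof -
  define a b where "a = fst (tangency \<kappa> 1 P)" and "b = fst (tangency \<kappa> 2 P)"
  have "a \<noteq> b" using tangency_diff[of P] assms by (auto simp: a_def b_def)
  then have "(b - a) * (b - a) > 0" by (simp add: zero_less_mult_iff) linarith
  moreover have "((a + b) / 2 - a) * ((a + b) / 2 - b) = - ((b - a) * (b - a)) / 4"
    by (simp add: field_simps)
  ultimately have "((a + b) / 2 - a) * ((a + b) / 2 - b) < 0" by simp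
  then have "((a + b) / 2, (a + b) / 2 + snd P) \<in> sliding \<kappa> P"
    by (simp add: sliding_iff switching_iff height_def a_def b_def)
  then show ?thesis by blast
qed

lemma repelling_if:
  assumes "snd P < 0" shows "repelling \<kappa> P"
proof -
  have lt: "fst (tangency \<kappa> 2 P) < fst (tangency \<kappa> 1 P)"
  proof -
    have "(\<kappa> 2 - \<kappa> 1) * snd P < 0" using assms \<kappa>12 by (intro mult_pos_neg) auto
    then show ?thesis using tangency_diff[of P] by linarith
  qed
  show ?thesis unfolding repelling_def using sliding_nonempty[of P] assms lt
    by (auto simp: sliding_iff vf_nvec_switching mult_less_0_iff)
qed

lemma attracting_if:
  assumes "snd P > 0" shows "attracting \<kappa> P"
proof -
  have lt: "fst (tangency \<kappa> 1 P) < fst (tangency \<kappa> 2 P)"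
  proof -
    have "(\<kappa> 2 - \<kappa> 1) * snd P > 0" using assms \<kappa>12 by (intro mult_pos_pos) auto
    then show ?thesis using tangency_diff[of P] by linarith
  qed
  show ?thesis unfolding attracting_def using sliding_nonempty[of P] assms lt
    by (auto simp: sliding_iff vf_nvec_switching mult_less_0_iff)
qed

end

section \<open>The domain enclosed by the cycle\<close>

context limit_cycle
begin

definition "abscissa i x = side i * (x - fst (equil \<kappa> i P))"
text \<open>The abscissa decays exponentially along an arc, so each arc is a graph over the x-axis;
  inverting the decay gives the time at which the arc passes over \<open>x\<close>.\<close>

definition "arc_time i x = ln (A i / abscissa i x) / (1 + \<kappa> i)"
definition "graph i x = snd (fl i (pt i (A i)) (arc_time i x))"
definition "x_left = fst (pt 1 (A 1))"
definition "x_right = fst (pt 2 (A 2))"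

lemma abscissa_flow: "abscissa i (fst (fl i (pt i (A i)) s)) = exp (- (1 + \<kappa> i) * s) * A i"
  unfolding abscissa_def side_flow side_sw_point ..

lemma A_pos: "i \<in> {1, 2} \<Longrightarrow> A i > 0"
  using A_gt \<kappa>_ex_pos by fastforce

lemma hr_A: "hr i (A i) = A i * exp (- (1 + \<kappa> i) * T i (A i))"
  by (simp add: half_return_def)

lemma abscissa_other: "i \<in> {1, 2} \<Longrightarrow> abscissa (3 - i) x = spread \<kappa> - abscissa i x"
  by (auto simp: abscissa_def spread_def fst_equil)

text \<open>Launch of one field and landing of the other are the same point, so both arcs lie over
  the same interval of abscissae.\<close>

lemma x_range:
  assumes i: "i \<in> {1, 2}"
  shows "x_left \<le> x \<and> x \<le> x_right \<longleftrightarrow> hr i (A i) \<le> abscissa i x \<and> abscissa i x \<le> A i"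
    and "x_left < x \<and> x < x_right \<longleftrightarrow> hr i (A i) < abscissa i x \<and> abscissa i x < A i"
proof -
  have 1: "abscissa 1 x = A 1 + x_left - x" "abscissa 2 x = A 2 + x - x_right"
    by (simp_all add: abscissa_def x_left_def x_right_def sw_point_def)
  have 2: "abscissa 2 x = spread \<kappa> - abscissa 1 x" using abscissa_other[of 1] by simp
  have 3: "A 2 = spread \<kappa> - hr 1 (A 1)" "A 1 = spread \<kappa> - hr 2 (A 2)"
    using A_other[of 1] A_other[of 2] by simp_all
  have "x_left \<le> x \<longleftrightarrow> abscissa 1 x \<le> A 1" "x \<le> x_right \<longleftrightarrow> hr 1 (A 1) \<le> abscissa 1 x"
      "x_left < x \<longleftrightarrow> abscissa 1 x < A 1" "x < x_right \<longleftrightarrow> hr 1 (A 1) < abscissa 1 x"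
      "x_left \<le> x \<longleftrightarrow> hr 2 (A 2) \<le> abscissa 2 x" "x \<le> x_right \<longleftrightarrow> abscissa 2 x \<le> A 2"
      "x_left < x \<longleftrightarrow> hr 2 (A 2) < abscissa 2 x" "x < x_right \<longleftrightarrow> abscissa 2 x < A 2"
    using 1 2 3 by linarith+
  then show "x_left \<le> x \<and> x \<le> x_right \<longleftrightarrow> hr i (A i) \<le> abscissa i x \<and> abscissa i x \<le> A i"
    "x_left < x \<and> x < x_right \<longleftrightarrow> hr i (A i) < abscissa i x \<and> abscissa i x < A i"
    using i by blast+
qed

lemma abscissa_pos: "i \<in> {1, 2} \<Longrightarrow> x_left \<le> x \<Longrightarrow> x \<le> x_right \<Longrightarrow> abscissa i x > 0"
  using x_range(1)[of i x] hr_bounds(1)[OF _ A_gt, of i] by auto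

lemma exp_arc_time:
  assumes "i \<in> {1, 2}" "abscissa i x > 0"
  shows "A i * exp (- (1 + \<kappa> i) * arc_time i x) = abscissa i x"
proof -
  have "(1 + \<kappa> i) * arc_time i x = ln (A i / abscissa i x)"
    using \<kappa>_pos[OF assms(1)] by (simp add: arc_time_def)
  then have "- (1 + \<kappa> i) * arc_time i x = - ln (A i / abscissa i x)" by linarith
  then have "exp (- (1 + \<kappa> i) * arc_time i x) = inverse (A i / abscissa i x)"
    using A_pos[OF assms(1)] assms(2) by (simp only: exp_minus) simp
  then show ?thesis using A_pos[OF assms(1)] by simp
qed

lemma arc_time_bounds:
  assumes i: "i \<in> {1, 2}" and pos: "abscissa i x > 0"
  shows "0 \<le> arc_time i x \<longleftrightarrow> abscissa i x \<le> A i" "0 < arc_time i x \<longleftrightarrow> abscissa i x < A i"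
    "arc_time i x \<le> T i (A i) \<longleftrightarrow> hr i (A i) \<le> abscissa i x"
    "arc_time i x < T i (A i) \<longleftrightarrow> hr i (A i) < abscissa i x"
proof -
  have k: "1 + \<kappa> i > 0" using \<kappa>_pos[OF i] by simp
  have *: "A i * exp (- (1 + \<kappa> i) * s) < A i * exp (- (1 + \<kappa> i) * t) \<longleftrightarrow> t < s" for s t
    using A_pos[OF i] k by simp
  have **: "A i * exp (- (1 + \<kappa> i) * s) \<le> A i * exp (- (1 + \<kappa> i) * t) \<longleftrightarrow> t \<le> s" for s t
    using A_pos[OF i] k by simp
  show "0 \<le> arc_time i x \<longleftrightarrow> abscissa i x \<le> A i"
    using **[of "arc_time i x" 0] unfolding exp_arc_time[OF i pos] by simp
  show "0 < arc_time i x \<longleftrightarrow> abscissa i x < A i"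
    using *[of "arc_time i x" 0] unfolding exp_arc_time[OF i pos] by simp
  show "arc_time i x \<le> T i (A i) \<longleftrightarrow> hr i (A i) \<le> abscissa i x"
    using **[of "T i (A i)" "arc_time i x"] unfolding exp_arc_time[OF i pos] hr_A by simp
  show "arc_time i x < T i (A i) \<longleftrightarrow> hr i (A i) < abscissa i x"
    using *[of "T i (A i)" "arc_time i x"] unfolding exp_arc_time[OF i pos] hr_A by simp
qed

lemma graph_point:
  assumes i: "i \<in> {1, 2}" and x: "x_left \<le> x" "x \<le> x_right"
  shows "fl i (pt i (A i)) (arc_time i x) = (x, graph i x)" "0 \<le> arc_time i x" "arc_time i x \<le> T i (A i)"
proof -
  have pos: "abscissa i x > 0" by (rule abscissa_pos[OF i x])
  have "abscissa i (fst (fl i (pt i (A i)) (arc_time i x))) = abscissa i x"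
    unfolding abscissa_flow using exp_arc_time[OF i pos] by (simp add: mult.commute)
  then have "fst (fl i (pt i (A i)) (arc_time i x)) = x" by (simp add: abscissa_def)
  then show "fl i (pt i (A i)) (arc_time i x) = (x, graph i x)" by (simp add: graph_def prod_eq_iff)
  show "0 \<le> arc_time i x" "arc_time i x \<le> T i (A i)"
    using arc_time_bounds[OF i pos] x_range(1)[OF i, of x] x by auto
qed

lemma graph_in_cyc: "i \<in> {1, 2} \<Longrightarrow> x_left \<le> x \<Longrightarrow> x \<le> x_right \<Longrightarrow> (x, graph i x) \<in> cyc"
  using pt_in_cyc[OF _ graph_point(2,3)] graph_point(1) by metis

lemma graph_side:
  assumes i: "i \<in> {1, 2}" and x: "x_left < x" "x < x_right"
  shows "side i * (graph i x - x - snd P) > 0"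
proof -
  have pos: "abscissa i x > 0" using abscissa_pos[OF i] x by simp
  have "0 < arc_time i x" "arc_time i x < T i (A i)"
    using arc_time_bounds[OF i pos] x_range(2)[OF i, of x] x by auto
  then have "fl i (pt i (A i)) (arc_time i x) \<in> region i P" using fl_in_region_iff[OF i A_gt[OF i]] by simp
  then show ?thesis using graph_point(1)[OF i, of x] x by (simp add: region_iff[OF i] height_def)
qed

lemma graph_ends:
  assumes i: "i \<in> {1, 2}" and x: "x = x_left \<or> x = x_right"
  shows "graph i x = x + snd P"
proof -
  \<comment> \<open>Witness: the tangency of field 2, at \<open>thr 1\<close> in the coordinate of
    field 1, lies strictly between landing and launch.\<close>
  have "x_left < x_right"
    using x_range(2)[of 1 "fst (pt 1 (thr 1))"] A_gt_thr[of 1] thr_gt[of 1] hr_bounds(2)[of 1 "A 1"] A_gt[of 1]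
      side_sw_point(1)[of 1 \<kappa> P "thr 1"] by (simp add: abscissa_def)
  then have r: "x_left \<le> x" "x \<le> x_right" "\<not> (x_left < x \<and> x < x_right)" using x by auto
  have pos: "abscissa i x > 0" using abscissa_pos[OF i] r by simp
  have "abscissa i x = A i \<or> abscissa i x = hr i (A i)"
    using x_range[OF i, of x] r by auto
  then have "arc_time i x = 0 \<or> arc_time i x = T i (A i)"
    using arc_time_bounds[OF i pos] graph_point(2,3)[OF i r(1,2)] by force
  then have "height P (fl i (pt i (A i)) (arc_time i x)) = 0"
    using pt_A_eq[OF i] by auto
  then show ?thesis using graph_point(1)[OF i r(1,2)] by (simp add: height_def)
qed

lemma continuous_on_graph:
  assumes i: "i \<in> {1, 2}"
  shows "continuous_on {x_left..x_right} (graph i)"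
proof -
  have "abscissa i x \<noteq> 0" "A i / abscissa i x \<noteq> 0" if "x \<in> {x_left..x_right}" for x
    using abscissa_pos[OF i, of x] A_pos[OF i] that by auto
  moreover have "1 + \<kappa> i \<noteq> 0" using \<kappa>_pos[OF i] by simp
  moreover have "continuous_on {x_left..x_right} (abscissa i)"
    unfolding abscissa_def[abs_def] by (intro continuous_intros)
  ultimately have "continuous_on {x_left..x_right} (arc_time i)"
    unfolding arc_time_def[abs_def] by (intro continuous_intros) auto
  then show ?thesis
    unfolding graph_def[abs_def]
    by (intro continuous_on_snd continuous_on_compose2[OF continuous_on_flow[of UNIV]]) auto
qed

definition "disc = {z. x_left < fst z \<and> fst z < x_right \<and> graph 1 (fst z) < snd z \<and> snd z < graph 2 (fst z)}"

lemma cyc_graph: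
  assumes "z \<in> cyc"
  shows "\<exists>i\<in>{1, 2}. snd z = graph i (fst z)"
proof -
  obtain i where i: "i \<in> {1, 2}" and "z \<in> fl i (pt i (A i)) ` {0..T i (A i)}"
    using assms unfolding cyc_def by (rule UN_E)
  then obtain s where s: "0 \<le> s" "s \<le> T i (A i)" and z: "z = fl i (pt i (A i)) s" by auto
  have pos: "abscissa i (fst z) > 0" using abscissa_flow A_pos[OF i] by (simp add: z)
  have "A i * exp (- (1 + \<kappa> i) * arc_time i (fst z)) = A i * exp (- (1 + \<kappa> i) * s)"
    unfolding exp_arc_time[OF i pos] by (simp add: z abscissa_flow)
  then have "arc_time i (fst z) = s" using A_pos[OF i] \<kappa>_pos[OF i] by simp
  then have "snd z = graph i (fst z)" by (simp add: graph_def z)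
  then show ?thesis using i by blast
qed

lemma disc_Int_cyc: "disc \<inter> cyc = {}"
  using cyc_graph by (fastforce simp: disc_def)

text \<open>At a frontier point one of the strict inequalities of \<open>disc\<close> has become an
  equality: the point is on a graph, or over an end of the interval, where the two graphs meet and
  leave no room between them.\<close>

lemma frontier_disc: "frontier disc \<subseteq> cyc"
proof -
  let ?S = "{x_left..x_right} \<times> (UNIV :: real set)"
  have cont: "continuous_on ?S (\<lambda>z. graph i (fst z))" if "i \<in> {1, 2}" for i
    by (rule continuous_on_compose2[OF continuous_on_graph[OF that]]) (auto intro!: continuous_intros)
  let ?C = "{z \<in> ?S. graph 1 (fst z) \<le> snd z} \<inter> {z \<in> ?S. snd z \<le> graph 2 (fst z)}"
  have "closed ?C"
    by (intro closed_Int continuous_on_closed_Collect_le cont continuous_intros closed_Times) auto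
  moreover have "disc \<subseteq> ?C" by (auto simp: disc_def)
  ultimately have clo: "closure disc \<subseteq> ?C" by (intro closure_minimal)
  have "open disc"
  proof -
    let ?V = "{x_left<..<x_right} \<times> (UNIV :: real set)"
    have c: "continuous_on ?V (\<lambda>z. graph i (fst z))" if "i \<in> {1, 2}" for i
      by (rule continuous_on_subset[OF cont[OF that]]) auto
    have "open ?V" by (intro open_Times) auto
    then have "open (?V \<inter> (\<lambda>z. snd z - graph 1 (fst z)) -` {0<..})" "open (?V \<inter> (\<lambda>z. graph 2 (fst z) - snd z) -` {0<..})"
      by (auto intro!: continuous_open_preimage continuous_intros c)
    then have "open ((?V \<inter> (\<lambda>z. snd z - graph 1 (fst z)) -` {0<..}) \<inter> (?V \<inter> (\<lambda>z. graph 2 (fst z) - snd z) -` {0<..}))"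
      by (rule open_Int)
    also have "\<dots> = disc" by (auto simp: disc_def)
    finally show ?thesis .
  qed
  then have fr: "frontier disc = closure disc - disc" by (simp add: frontier_def interior_open)
  show ?thesis
  proof
    fix z assume "z \<in> frontier disc"
    then have z: "z \<in> ?C" "z \<notin> disc" using clo fr by auto
    obtain x y where xy: "z = (x, y)" by force
    have r: "x_left \<le> x" "x \<le> x_right" "graph 1 x \<le> y" "y \<le> graph 2 x" using z(1) xy by auto
    have "y = graph 1 x \<or> y = graph 2 x"
    proof (cases "x_left < x \<and> x < x_right")
      case True then show ?thesis using z(2) r xy by (auto simp: disc_def)
    next
      case False
      then have "x = x_left \<or> x = x_right" using r by auto
      then show ?thesis using graph_ends[of 1 x] graph_ends[of 2 x] r by auto
    qed
    then show "z \<in> cyc" using graph_in_cyc[of 1 x] graph_in_cyc[of 2 x] r xy by auto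
  qed
qed

text \<open>A connected set that meets the disc and leaves it meets the frontier, hence the cycle.
  So the component of a point of the disc in the complement of the cycle stays in the disc, which is
  bounded.\<close>

lemma disc_subset_inside: "disc \<subseteq> inside cyc"
proof
  fix z assume z: "z \<in> disc"
  obtain M where M: "\<And>w. w \<in> cyc \<Longrightarrow> norm w \<le> M"
    using compact_imp_bounded[OF cyc_compact] bounded_iff by blast
  have "bounded disc" unfolding bounded_iff
  proof (intro exI[of _ "M + (M + M)"] ballI)
    fix w assume w: "w \<in> disc"
    obtain x y where xy: "w = (x, y)" by force
    have r: "x_left \<le> x" "x \<le> x_right" "graph 1 x < y" "y < graph 2 x" using w xy by (auto simp: disc_def)
    have "norm x \<le> M" "norm (graph 1 x) \<le> M" "norm (graph 2 x) \<le> M"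
      using M[OF graph_in_cyc[of 1 x]] M[OF graph_in_cyc[of 2 x]] r
        norm_fst_le[of x "graph 1 x"] norm_snd_le[of "graph 1 x" x] norm_snd_le[of "graph 2 x" x] by auto
    then have "norm x + norm y \<le> M + (M + M)" using r by (simp add: abs_if split: if_splits)
    then show "norm w \<le> M + (M + M)" using norm_Pair_le[of x y] xy by simp
  qed
  have zc: "z \<notin> cyc" using z disc_Int_cyc by blast
  let ?K = "connected_component_set (- cyc) z"
  have "?K \<subseteq> disc"
  proof (rule ccontr)
    assume "\<not> ?K \<subseteq> disc"
    then have "?K - disc \<noteq> {}" by blast
    moreover have "?K \<inter> disc \<noteq> {}" using z zc by (auto intro!: connected_component_refl)
    ultimately have "?K \<inter> frontier disc \<noteq> {}"
      by (intro connected_Int_frontier connected_connected_component)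
    then show False using frontier_disc connected_component_subset[of "- cyc" z] by blast
  qed
  then show "z \<in> inside cyc" using zc \<open>bounded disc\<close> by (auto simp: inside_def intro: bounded_subset)
qed

text \<open>Sliding points lie between the tangencies, hence strictly between landing and launch;
  over such abscissae \<open>graph_side\<close> places the line between the two graphs.\<close>

lemma sliding_inside: "sliding \<kappa> P \<subseteq> inside cyc"
proof -
  have "sliding \<kappa> P \<subseteq> disc"
  proof
    fix z assume z: "z \<in> sliding \<kappa> P"
    then have h: "height P z = 0" using sliding_subset_switching switching_iff by blast
    then obtain \<beta> where \<beta>: "z = pt 1 \<beta>" using sw_point_exhaust by blast
    have pr: "(\<beta> - \<kappa> 1 * ex 1) * (thr 1 - \<beta>) > 0"
      using z sliding_sw_point_iff[of 1 P \<beta>] by (simp add: \<beta> thr_def algebra_simps)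
    then have "\<kappa> 1 * ex 1 < \<beta>" "\<beta> < thr 1" using thr_gt[of 1] by (auto simp: zero_less_mult_iff)
    moreover have "abscissa 1 (fst z) = \<beta>" unfolding \<beta> abscissa_def by (rule side_sw_point)
    ultimately have x: "x_left < fst z" "fst z < x_right"
      using x_range(2)[of 1 "fst z"] A_gt_thr[of 1] hr_bounds(2)[of 1 "A 1"] A_gt[of 1] by auto
    then show "z \<in> disc"
      using graph_side[of 1 "fst z"] graph_side[of 2 "fst z"] h by (simp add: disc_def height_def)
  qed
  then show ?thesis using disc_subset_inside by blast
qed

lemma arc_eq: "i \<in> {1, 2} \<Longrightarrow> arc \<kappa> i P (T i (A i)) = fl i (pt i (A i)) ` {0..T i (A i)}"
  by (simp add: arc_def transit_T A_gt del: insert_iff)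

lemma cyc_eq: "cyc = arc \<kappa> 1 P (T 1 (A 1)) \<union> arc \<kappa> 2 P (T 2 (A 2))"
  using arc_eq[of 1] arc_eq[of 2] by (simp add: cyc_def)

lemma hr_A_transit: "i \<in> {1, 2} \<Longrightarrow> ex i * transit (\<kappa> i) (- T i (A i)) = hr i (A i)"
  using half_return_transit[of "\<kappa> i" "ex i" "T i (A i)"] \<kappa>_pos[of i] excess_pos[of i] T_pos[of i "A i"]
    transit_T[of i "A i"] A_gt[of i] by simp

lemma crossing_periodic_orbit_cyc: "crossing_periodic_orbit \<kappa> P cyc"
  unfolding crossing_periodic_orbit_iff
proof (rule exI[of _ "T 1 (A 1)"], rule exI[of _ "T 2 (A 2)"], intro conjI cyc_eq)
  show "ex 1 * transit (\<kappa> 1) (T 1 (A 1)) + ex 2 * transit (\<kappa> 2) (- T 2 (A 2)) = spread \<kappa>"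
    "ex 2 * transit (\<kappa> 2) (T 2 (A 2)) + ex 1 * transit (\<kappa> 1) (- T 1 (A 1)) = spread \<kappa>"
    using transit_T[of 1 "A 1"] transit_T[of 2 "A 2"] hr_A_transit[of 1] hr_A_transit[of 2]
      A_gt[of 1] A_gt[of 2] A_other[of 1] A_other[of 2] by simp_all
qed (use T_pos[of 1 "A 1"] T_pos[of 2 "A 2"] A_gt[of 1] A_gt[of 2] excess_pos[of 1] excess_pos[of 2] in auto)

lemma is_Gamma_cyc: "is_Gamma \<kappa> P cyc"
  unfolding is_Gamma_def
  using crossing_periodic_orbit_cyc stable_set_cyc repelling_if[OF snd_neg] sliding_inside by blast

lemma crossing_periodic_orbit_unique:
  assumes "crossing_periodic_orbit \<kappa> P G"
  shows "G = cyc"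
proof -
  from assms obtain \<tau>\<^sub>1 \<tau>\<^sub>2 where t: "\<tau>\<^sub>1 > 0" "\<tau>\<^sub>2 > 0"
    and eq: "ex 1 * transit (\<kappa> 1) \<tau>\<^sub>1 + ex 2 * transit (\<kappa> 2) (- \<tau>\<^sub>2) = spread \<kappa>"
       "ex 2 * transit (\<kappa> 2) \<tau>\<^sub>2 + ex 1 * transit (\<kappa> 1) (- \<tau>\<^sub>1) = spread \<kappa>"
    and G: "G = arc \<kappa> 1 P \<tau>\<^sub>1 \<union> arc \<kappa> 2 P \<tau>\<^sub>2"
    unfolding crossing_periodic_orbit_iff by blast
  define \<alpha>\<^sub>1 \<alpha>\<^sub>2 where "\<alpha>\<^sub>1 = ex 1 * transit (\<kappa> 1) \<tau>\<^sub>1" and "\<alpha>\<^sub>2 = ex 2 * transit (\<kappa> 2) \<tau>\<^sub>2"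
  have e: "ex 1 > 0" "ex 2 > 0" using excess_pos[of 1] excess_pos[of 2] by auto
  have gt: "\<alpha>\<^sub>1 > \<kappa> 1 * ex 1" "\<alpha>\<^sub>2 > \<kappa> 2 * ex 2"
    using transit_gt[OF _ t(1), of "\<kappa> 1"] transit_gt[OF _ t(2), of "\<kappa> 2"] e
    by (simp_all add: \<alpha>\<^sub>1_def \<alpha>\<^sub>2_def mult.commute)
  have hr: "hr 1 \<alpha>\<^sub>1 = ex 1 * transit (\<kappa> 1) (- \<tau>\<^sub>1)" "hr 2 \<alpha>\<^sub>2 = ex 2 * transit (\<kappa> 2) (- \<tau>\<^sub>2)"
    using half_return_transit[OF _ e(1) t(1), of "\<kappa> 1"] half_return_transit[OF _ e(2) t(2), of "\<kappa> 2"]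
    by (simp_all add: \<alpha>\<^sub>1_def \<alpha>\<^sub>2_def)
  have tau: "T 1 \<alpha>\<^sub>1 = \<tau>\<^sub>1" "T 2 \<alpha>\<^sub>2 = \<tau>\<^sub>2"
    using transit_time_eq[OF _ t(1), of "\<kappa> 1"] transit_time_eq[OF _ t(2), of "\<kappa> 2"] e
    by (simp_all add: \<alpha>\<^sub>1_def \<alpha>\<^sub>2_def)
  have sum: "\<alpha>\<^sub>1 + hr 2 \<alpha>\<^sub>2 = spread \<kappa>" "\<alpha>\<^sub>2 + hr 1 \<alpha>\<^sub>1 = spread \<kappa>"
    using eq unfolding hr by (simp_all add: \<alpha>\<^sub>1_def \<alpha>\<^sub>2_def)
  have sumA: "A 1 + hr 2 (A 2) = spread \<kappa>" "A 2 + hr 1 (A 1) = spread \<kappa>"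
    using A_other[of 1] A_other[of 2] by simp_all
  note mono1 = half_return_antimono[of "\<kappa> 1", OF _ e(1)] and mono2 = half_return_antimono[of "\<kappa> 2", OF _ e(2)]
  have A: "A 1 > \<kappa> 1 * ex 1" "A 2 > \<kappa> 2 * ex 2" using A_gt[of 1] A_gt[of 2] by auto
  \<comment> \<open>A longer chord of one field is shifted one way, a longer chord of the other field the other way.\<close>
  have "\<alpha>\<^sub>1 = A 1"
  proof (rule linorder_cases[of \<alpha>\<^sub>1 "A 1"])
    assume "\<alpha>\<^sub>1 < A 1"
    note 1 = mono1[OF \<kappa>1_pos(1) gt(1) this]
    have "\<alpha>\<^sub>2 < A 2" using 1 sum sumA by linarith
    note 2 = mono2[OF \<kappa>1_pos(2) gt(2) this]
    show ?thesis using 1 2 sum sumA by linarith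
  next
    assume "\<alpha>\<^sub>1 > A 1"
    note 1 = mono1[OF \<kappa>1_pos(1) A(1) this]
    have "\<alpha>\<^sub>2 > A 2" using 1 sum sumA by linarith
    note 2 = mono2[OF \<kappa>1_pos(2) A(2) this]
    show ?thesis using 1 2 sum sumA by linarith
  qed
  moreover from this have "\<alpha>\<^sub>2 = A 2" using sum sumA by simp
  ultimately show ?thesis using tau by (simp add: G cyc_eq)
qed

end

context rates
begin

lemma limit_cycle_exists:
  assumes "P \<in> Gamma_region \<kappa>"
  shows "\<exists>A. limit_cycle \<kappa> P A"
proof -
  have e: "excess \<kappa> 1 P > 0" "excess \<kappa> 2 P > 0" and neg: "snd P < 0"
    using assms by (simp_all add: Gamma_region_iff)
  have sum: "\<kappa> 1 * excess \<kappa> 1 P + \<kappa> 2 * excess \<kappa> 2 P < spread \<kappa>"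
    using neg excess_sum_less_iff by blast
  define h1 h2 where "h1 = half_return (\<kappa> 1) (excess \<kappa> 1 P)" and "h2 = half_return (\<kappa> 2) (excess \<kappa> 2 P)"
  have h1: "0 < h1 \<alpha>" "h1 \<alpha> < \<kappa> 1 * excess \<kappa> 1 P" if "\<alpha> > \<kappa> 1 * excess \<kappa> 1 P" for \<alpha>
    using half_return_bounds[OF _ e(1) that] by (simp_all add: h1_def)
  have h2: "0 < h2 \<alpha>" "h2 \<alpha> < \<kappa> 2 * excess \<kappa> 2 P" if "\<alpha> > \<kappa> 2 * excess \<kappa> 2 P" for \<alpha>
    using half_return_bounds[OF _ e(2) that] by (simp_all add: h2_def)
  \<comment> \<open>The tangency of field 2 in the coordinate of field 1. There the displacement
    \<open>f\<close> is nonnegative, as landings of field 2 fall below its tangency; at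
    \<open>spread \<kappa>\<close> it is nonpositive, as landings have positive coordinates.\<close>
  define l where "l = spread \<kappa> - \<kappa> 2 * excess \<kappa> 2 P"
  have l: "l > \<kappa> 1 * excess \<kappa> 1 P" "l < spread \<kappa>" using sum e \<kappa>1_pos(2) by (simp_all add: l_def del: \<kappa>1_pos)
  have gt2: "spread \<kappa> - h1 \<alpha> > \<kappa> 2 * excess \<kappa> 2 P" if "\<alpha> \<ge> l" for \<alpha>
    using h1[of \<alpha>] that l(1) sum by linarith
  define f where "f \<alpha> = spread \<kappa> - h2 (spread \<kappa> - h1 \<alpha>) - \<alpha>" for \<alpha>
  have c1: "continuous_on {l..spread \<kappa>} h1"
    unfolding h1_def by (rule continuous_on_subset[OF continuous_on_half_return[OF _ e(1)]]) (use l in auto)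
  have "continuous_on {l..spread \<kappa>} (\<lambda>\<alpha>. h2 (spread \<kappa> - h1 \<alpha>))"
    unfolding h2_def
    by (rule continuous_on_compose2[OF continuous_on_half_return[OF _ e(2)]])
       (use gt2 in \<open>auto intro!: continuous_intros c1\<close>)
  then have "continuous_on {l..spread \<kappa>} f" unfolding f_def[abs_def] by (intro continuous_intros)
  moreover have "f l \<ge> 0" using h2[OF gt2[of l]] by (simp add: f_def l_def)
  moreover have "f (spread \<kappa>) \<le> 0" using h2[OF gt2[of "spread \<kappa>"]] l by (simp add: f_def)
  ultimately obtain \<alpha> where \<alpha>: "l \<le> \<alpha>" "f \<alpha> = 0"
    using IVT2'[of f "spread \<kappa>" 0 l] l by auto
  define A where "A i = (if i = 1 then \<alpha> else spread \<kappa> - h1 \<alpha>)" for i :: nat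
  have "limit_cycle \<kappa> P A"
  proof unfold_locales
    fix i :: nat assume "i \<in> {1, 2}"
    then consider "i = 1" | "i = 2" by auto
    note cs = this
    show "excess \<kappa> i P > 0" using e by (cases rule: cs) auto
    show "A i > \<kappa> i * excess \<kappa> i P"
      using \<alpha> l gt2[OF \<alpha>(1)] by (cases rule: cs) (auto simp: A_def)
    show "A (3 - i) = spread \<kappa> - half_return (\<kappa> i) (excess \<kappa> i P) (A i)"
      using \<alpha>(2) by (cases rule: cs) (auto simp: A_def f_def h1_def h2_def)
  qed (fact neg)
  then show ?thesis by blast
qed

lemma ex1_Gamma:
  assumes "P \<in> Gamma_region \<kappa>"
  shows "\<exists>!G. is_Gamma \<kappa> P G"
proof -
  obtain A where "limit_cycle \<kappa> P A" using limit_cycle_exists[OF assms] by blast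
  then interpret limit_cycle \<kappa> P A .
  show ?thesis
    by (rule ex1I[of _ cyc], rule is_Gamma_cyc, rule crossing_periodic_orbit_unique, simp add: is_Gamma_def)
qed

text \<open>Existence in the region and nonexistence outside hold at every parameter point, so
  nothing local remains to be shown.\<close>

lemma Gamma_disappears_if_frontier:
  "P \<in> frontier (Gamma_region \<kappa>) \<Longrightarrow> Gamma_disappears \<kappa> P"
  unfolding Gamma_disappears_def using ex1_Gamma no_crossing_periodic_orbit by simp

text \<open>The region is cut out by strict affine inequalities. A segment that starts at a point
  satisfying them weakly and ends at a solution lies in the region except possibly for its
  start.\<close>

lemma frontier_Gamma_region:
  assumes "excess \<kappa> 1 P \<ge> 0" "excess \<kappa> 2 P \<ge> 0" "snd P \<le> 0" "P \<notin> Gamma_region \<kappa>"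
  shows "P \<in> frontier (Gamma_region \<kappa>)"
proof -
  define c where "c = \<kappa> 2 - \<kappa> 1"
  have c: "c > 0" using \<kappa>12 by (simp add: c_def)
  \<comment> \<open>The point \<open>C\<close> is constructed so that both products
    \<open>\<kappa> i * excess \<kappa> i C\<close> equal \<open>spread \<kappa> / 4\<close>; by
    \<open>excess_sum\<close> this dictates the second coordinate \<open>h\<close>.\<close>
  define h where "h = - (spread \<kappa> / (2 * c))"
  have h: "h < 0" "c * h = - (spread \<kappa> / 2)" using spread_pos c by (simp_all add: h_def)
  define C where "C = (\<kappa> 1 * (h + 1 / (1 + \<kappa> 1)) + spread \<kappa> / 4, h)"
  have "(\<kappa> 1 * q + s) / \<kappa> 1 = q + s / \<kappa> 1" for q s by (simp add: add_divide_distrib)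
  then have "excess \<kappa> 1 C = spread \<kappa> / 4 / \<kappa> 1"
    unfolding excess_eq C_def fst_conv snd_conv by simp
  then have "\<kappa> 1 * excess \<kappa> 1 C = spread \<kappa> / 4" by simp
  moreover from this have "\<kappa> 2 * excess \<kappa> 2 C = spread \<kappa> / 4"
    using excess_sum[of C] h(2) by (simp add: C_def flip: c_def)
  ultimately have C1: "\<kappa> 1 * excess \<kappa> 1 C > 0" "\<kappa> 2 * excess \<kappa> 2 C > 0"
    using spread_pos by simp_all
  have C: "excess \<kappa> 1 C > 0" "excess \<kappa> 2 C > 0" "snd C < 0"
    using h zero_less_mult_pos[OF C1(1)] zero_less_mult_pos[OF C1(2)] by (simp_all add: C_def)
  have aff: "excess \<kappa> i (P + t *\<^sub>R (C - P)) = (1 - t) * excess \<kappa> i P + t * excess \<kappa> i C" for i t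
    by (simp add: excess_eq algebra_simps add_divide_distrib diff_divide_distrib)
  have snd_aff: "snd (P + t *\<^sub>R (C - P)) = (1 - t) * snd P + t * snd C" for t
    by (simp add: algebra_simps)
  have "P + t *\<^sub>R (C - P) \<in> Gamma_region \<kappa>" if "0 < t" "t \<le> 1" for t
    unfolding Gamma_region_iff aff snd_aff
    using that assms C by (intro conjI add_nonneg_pos add_nonpos_neg mult_nonneg_nonneg
        mult_nonneg_nonpos mult_pos_pos mult_pos_neg) auto
  note mem = this
  have ev: "\<forall>\<^sub>F t in at_right (0::real). 0 < t \<and> t < 1"
    unfolding eventually_at_right_field by (intro exI[of _ 1]) simp
  have "((\<lambda>t. P + t *\<^sub>R (C - P)) \<longlongrightarrow> P + 0 *\<^sub>R (C - P)) (at_right 0)"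
    by (intro tendsto_intros)
  then have lim: "((\<lambda>t. P + t *\<^sub>R (C - P)) \<longlongrightarrow> P) (at_right 0)" by simp
  have "\<forall>\<^sub>F t in at_right 0. P + t *\<^sub>R (C - P) \<in> closure (Gamma_region \<kappa>)"
    using ev by eventually_elim (rule subsetD[OF closure_subset], rule mem, auto)
  then have "P \<in> closure (Gamma_region \<kappa>)"
    by (rule Lim_in_closed_set[OF closed_closure _ _ lim]) simp
  then show ?thesis using assms(4) interior_subset[of "Gamma_region \<kappa>"] by (auto simp: frontier_def)
qed

end

section \<open>Homoclinic orbits of boundary equilibria\<close>

context rates
begin

lemma BE_excess: "i \<in> {1, 2} \<Longrightarrow> P \<in> BE \<kappa> i \<longleftrightarrow> excess \<kappa> i P = 0"
  by (auto simp: BE_def excess_eq split_beta)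

text \<open>States that the right-hand side of \<open>excess_sum\<close> vanishes at
  \<open>BB \<kappa>\<close>. Along one boundary line the excess of the other field is therefore
  proportional to the height above \<open>BB \<kappa>\<close>.\<close>

lemma BB_spread: "(\<kappa> 2 - \<kappa> 1) * snd (BB \<kappa>) = - spread \<kappa>"
  by (simp add: BB_def spread_def divide_simps) (simp add: algebra_simps)

lemma excess_other:
  assumes "i \<in> {1, 2}" "excess \<kappa> i P = 0"
  shows "\<kappa> (3 - i) * excess \<kappa> (3 - i) P = (\<kappa> 2 - \<kappa> 1) * (snd P - snd (BB \<kappa>))"
    and "\<kappa> (3 - i) * excess \<kappa> (3 - i) P = spread \<kappa> + (\<kappa> 2 - \<kappa> 1) * snd P"
  using excess_sum[of P] assms BB_spread by (auto simp: right_diff_distrib)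

lemma excess_other_sign:
  assumes "i \<in> {1, 2}" "excess \<kappa> i P = 0"
  shows "excess \<kappa> (3 - i) P > 0 \<longleftrightarrow> snd P > snd (BB \<kappa>)"
    "excess \<kappa> (3 - i) P < 0 \<longleftrightarrow> snd P < snd (BB \<kappa>)"
proof -
  have k: "\<kappa> (3 - i) > 0" "\<kappa> 2 - \<kappa> 1 > 0" using \<kappa>_pos[OF other_index(1)[OF assms(1)]] \<kappa>12 by auto
  have "excess \<kappa> (3 - i) P > 0 \<longleftrightarrow> \<kappa> (3 - i) * excess \<kappa> (3 - i) P > 0" using k by (simp add: zero_less_mult_iff)
  also have "\<dots> \<longleftrightarrow> snd P > snd (BB \<kappa>)" unfolding excess_other(1)[OF assms] using k by (simp add: zero_less_mult_iff)
  finally show "excess \<kappa> (3 - i) P > 0 \<longleftrightarrow> snd P > snd (BB \<kappa>)" .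
  have "excess \<kappa> (3 - i) P < 0 \<longleftrightarrow> \<kappa> (3 - i) * excess \<kappa> (3 - i) P < 0" using k by (simp add: mult_less_0_iff)
  also have "\<dots> \<longleftrightarrow> snd P < snd (BB \<kappa>)" unfolding excess_other(1)[OF assms] using k by (simp add: mult_less_0_iff)
  finally show "excess \<kappa> (3 - i) P < 0 \<longleftrightarrow> snd P < snd (BB \<kappa>)" .
qed

lemma equil_sw_point:
  assumes "i \<in> {1, 2}" "excess \<kappa> i P = 0"
  shows "equil \<kappa> i P = sw_point \<kappa> i P 0" "equil \<kappa> i P = sw_point \<kappa> (3 - i) P (spread \<kappa>)"
proof -
  have "height P (equil \<kappa> i P) = 0" using assms(2) by (simp add: excess_def)
  then show "equil \<kappa> i P = sw_point \<kappa> i P 0" by (simp add: sw_point_def height_def prod_eq_iff)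
  then show "equil \<kappa> i P = sw_point \<kappa> (3 - i) P (spread \<kappa>)"
    using sw_point_other[OF assms(1), of \<kappa> P 0] by simp
qed

lemma sw_point_not_in_region: "i \<in> {1, 2} \<Longrightarrow> sw_point \<kappa> j P \<alpha> \<notin> region i P"
  by (simp add: region_iff del: insert_iff)

text \<open>For \<open>snd P > 0\<close> there is no way to leave the equilibrium: its own field
  rests, the other does not enter its region, and sliding is forbidden. Below
  \<open>BB \<kappa>\<close> the equilibrium of the other field is admissible and the orbit stays in
  that region for ever, so it never crosses.\<close>

lemma no_homoclinic_orbit:
  assumes i: "i \<in> {1, 2}" and e: "excess \<kappa> i P = 0" and "snd P > 0 \<or> snd P < snd (BB \<kappa>)"
  shows "\<not> homoclinic_orbit \<kappa> i P \<phi>"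
proof
  assume hom: "homoclinic_orbit \<kappa> i P \<phi>"
  then have orb: "pws_orbit \<kappa> P \<phi>" and start: "\<phi> 0 = equil \<kappa> i P"
    and nosl: "\<forall>t\<ge>0. \<phi> t \<notin> sliding \<kappa> P" and cr: "\<exists>t>0. \<phi> t \<in> crossing \<kappa> P"
    by (auto simp: homoclinic_orbit_def)
  have j: "3 - i \<in> {1, 2}" "3 - (3 - i) = i" using other_index i by blast+
  have equil_reg: "equil \<kappa> i P \<notin> region i P"
    unfolding equil_sw_point(1)[OF i e] by (rule sw_point_not_in_region[OF i])
  have start': "\<phi> 0 = sw_point \<kappa> (3 - i) P (spread \<kappa>)"
    using start equil_sw_point(2)[OF i e] by simp
  have in_reg: "flow \<kappa> (3 - i) P (\<phi> 0) s \<in> region (3 - i) P \<longleftrightarrow> excess \<kappa> (3 - i) P * transit (\<kappa> (3 - i)) s < spread \<kappa>"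
    if "s > 0" for s unfolding start' using flow_sw_point_in_region_iff_transit[OF j(1) that] .
  show False
  proof (cases "snd P > 0")
    case True
    have "spread \<kappa> < \<kappa> (3 - i) * excess \<kappa> (3 - i) P"
      unfolding excess_other(2)[OF i e] using True \<kappa>12 by simp
    then have ej: "\<kappa> (3 - i) * excess \<kappa> (3 - i) P > spread \<kappa>" "excess \<kappa> (3 - i) P > 0"
      using spread_pos zero_less_mult_pos[OF _ \<kappa>_pos[OF j(1)], of "excess \<kappa> (3 - i) P"] by auto
    show False
    proof (rule pws_initial[OF orb order_refl])
      fix \<epsilon> m assume \<epsilon>: "\<epsilon> > 0" and m: "m \<in> {1, 2}"
        and fl: "\<And>s. 0 \<le> s \<Longrightarrow> s < \<epsilon> \<Longrightarrow> \<phi> (0 + s) = flow \<kappa> m P (\<phi> 0) s"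
        and re: "\<And>s. 0 < s \<Longrightarrow> s < \<epsilon> \<Longrightarrow> \<phi> (0 + s) \<in> region m P"
      have f: "flow \<kappa> m P (\<phi> 0) (\<epsilon> / 2) \<in> region m P" using fl[of "\<epsilon> / 2"] re[of "\<epsilon> / 2"] \<epsilon> by simp
      show False
      proof (cases "m = i")
        case True
        then show False using f equil_reg start by simp
      next
        case False
        then have "m = 3 - i" using m i by auto
        then have "excess \<kappa> (3 - i) P * transit (\<kappa> (3 - i)) (\<epsilon> / 2) < spread \<kappa>"
          using f in_reg[of "\<epsilon> / 2"] \<epsilon> by simp
        moreover have "excess \<kappa> (3 - i) P * \<kappa> (3 - i) < excess \<kappa> (3 - i) P * transit (\<kappa> (3 - i)) (\<epsilon> / 2)"
          using transit_gt[OF \<kappa>_pos[OF j(1)], of "\<epsilon> / 2"] ej \<epsilon> by simp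
        ultimately show False using ej(1) by (simp add: mult.commute)
      qed
    next
      fix \<epsilon> assume "\<epsilon> > 0" "\<And>s. 0 < s \<Longrightarrow> s < \<epsilon> \<Longrightarrow> \<phi> (0 + s) \<in> sliding \<kappa> P"
      from this(2)[of "\<epsilon> / 2"] this(1) show False using nosl by simp
    qed
  next
    case False
    then have "snd P < snd (BB \<kappa>)" using assms(3) by simp
    then have ej: "excess \<kappa> (3 - i) P < 0" using excess_other_sign(2)[OF i e] by simp
    have reg: "flow \<kappa> (3 - i) P (\<phi> 0) s \<in> region (3 - i) P" if "s > 0" for s
    proof -
      have "excess \<kappa> (3 - i) P * transit (\<kappa> (3 - i)) s < 0"
        using ej transit_gt[OF \<kappa>_pos[OF j(1)] that] \<kappa>_pos[OF j(1)] by (intro mult_neg_pos) auto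
      then show ?thesis using in_reg[OF that] spread_pos by simp
    qed
    have "\<phi> (0 + s) = flow \<kappa> (3 - i) P (\<phi> 0) s" if "s > 0" for s
    proof (rule pws_follow[OF orb order_refl j(1), of s])
      show "\<phi> 0 \<in> region (3 - i) P \<or> (\<forall>s>0. flow \<kappa> (3 - (3 - i)) P (\<phi> 0) s \<notin> region (3 - (3 - i)) P) \<and>
          (\<phi> 0 \<notin> closure (sliding \<kappa> P) \<or> (\<forall>t\<ge>0. \<phi> t \<notin> sliding \<kappa> P))"
        unfolding j(2) start flow_equil using equil_reg nosl by blast
    qed (use reg that in auto)
    then have "\<phi> s \<in> region (3 - i) P" if "s > 0" for s using reg[OF that] that by simp
    moreover obtain t where "t > 0" "\<phi> t \<in> crossing \<kappa> P" using cr by blast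
    ultimately show False using region_disjoint(2)[OF j(1), of "\<phi> t" P] by (simp add: crossing_def)
  qed
qed

text \<open>A single flight of the other field, from the boundary equilibrium to its landing,
  followed by the approach to the node. The equilibrium has coordinate
  \<open>spread \<kappa>\<close> for the other field, which explains the flight time.\<close>

definition homoclinic :: "nat \<Rightarrow> real \<times> real \<Rightarrow> real \<Rightarrow> real \<times> real" where
  "homoclinic i P t =
    (let \<tau> = transit_time (\<kappa> (3 - i)) (spread \<kappa> / excess \<kappa> (3 - i) P);
         z = flow \<kappa> (3 - i) P (equil \<kappa> i P)
     in if t \<le> \<tau> then z t else flow \<kappa> i P (z \<tau>) (t - \<tau>))"

lemma flow_tendsto_equil:
  assumes "\<kappa> i > 0"
  shows "(flow \<kappa> i P z \<longlongrightarrow> equil \<kappa> i P) at_top"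
proof -
  have *: "((\<lambda>t. exp (- l * t)) \<longlongrightarrow> 0) at_top" if "l > 0" for l :: real
  proof -
    have "filterlim (\<lambda>t. - l * t) at_bot at_top"
      using that by (intro filterlim_tendsto_neg_mult_at_bot[OF tendsto_const _ filterlim_ident]) auto
    then show ?thesis by (rule filterlim_compose[OF exp_at_bot])
  qed
  have "((\<lambda>t. equil \<kappa> i P + (exp (- (1 + \<kappa> i) * t) * fst (z - equil \<kappa> i P),
      exp (- \<kappa> i * t) * snd (z - equil \<kappa> i P))) \<longlongrightarrow>
      equil \<kappa> i P + (0 * fst (z - equil \<kappa> i P), 0 * snd (z - equil \<kappa> i P))) at_top"
    by (intro tendsto_intros *) (use assms in auto)
  then show ?thesis by (simp add: flow_def[abs_def] zero_prod_def[symmetric])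
qed

text \<open>For zero excess every positive launch coordinate yields a flight without landing; the
  landing coordinate \<open>\<beta>\<close> of the other field is less than
  \<open>spread \<kappa>\<close>, so the second piece is of this kind.\<close>

lemma homoclinic_parts:
  assumes i: "i \<in> {1, 2}" and e: "excess \<kappa> i P = 0" and eta: "snd (BB \<kappa>) < snd P" "snd P < 0"
  defines "\<tau> \<equiv> transit_time (\<kappa> (3 - i)) (spread \<kappa> / excess \<kappa> (3 - i) P)"
    and "\<beta> \<equiv> half_return (\<kappa> (3 - i)) (excess \<kappa> (3 - i) P) (spread \<kappa>)"
  shows "excess \<kappa> (3 - i) P > 0" "\<kappa> (3 - i) * excess \<kappa> (3 - i) P < spread \<kappa>" "\<tau> > 0"
    "0 < \<beta>" "\<beta> < \<kappa> (3 - i) * excess \<kappa> (3 - i) P"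
    "flow \<kappa> (3 - i) P (equil \<kappa> i P) \<tau> = sw_point \<kappa> i P (spread \<kappa> - \<beta>)"
    "\<And>t. 0 < t \<Longrightarrow> t < \<tau> \<Longrightarrow> flow \<kappa> (3 - i) P (equil \<kappa> i P) t \<in> region (3 - i) P"
    "\<And>t. 0 < t \<Longrightarrow> flow \<kappa> i P (sw_point \<kappa> i P (spread \<kappa> - \<beta>)) t \<in> region i P"
proof -
  have j: "3 - i \<in> {1, 2}" "3 - (3 - i) = i" using other_index i by blast+
  note k = \<kappa>_pos[OF j(1)]
  show ej: "excess \<kappa> (3 - i) P > 0" using excess_other_sign(1)[OF i e] eta by simp
  show lt: "\<kappa> (3 - i) * excess \<kappa> (3 - i) P < spread \<kappa>"
    unfolding excess_other(2)[OF i e] using eta \<kappa>12 by (simp add: mult_pos_neg)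
  have r: "spread \<kappa> / excess \<kappa> (3 - i) P > \<kappa> (3 - i)" using ej lt by (simp add: pos_less_divide_eq)
  note t = transit_time[OF k r, folded \<tau>_def]
  show "\<tau> > 0" by (fact t(1))
  have et: "spread \<kappa> = excess \<kappa> (3 - i) P * transit (\<kappa> (3 - i)) \<tau>" using t ej by simp
  show "0 < \<beta>" and \<beta>: "\<beta> < \<kappa> (3 - i) * excess \<kappa> (3 - i) P"
    unfolding \<beta>_def using half_return_bounds[OF k ej lt] by auto
  have "flow \<kappa> (3 - i) P (equil \<kappa> i P) \<tau> = sw_point \<kappa> (3 - i) P \<beta>"
    unfolding equil_sw_point(2)[OF i e] \<beta>_def
    using flow_sw_point_return[OF t(1) et] half_return_transit[OF k ej t(1)] et by simp
  then show "flow \<kappa> (3 - i) P (equil \<kappa> i P) \<tau> = sw_point \<kappa> i P (spread \<kappa> - \<beta>)"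
    using sw_point_other[OF j(1), of \<kappa> P \<beta>] j(2) by simp
  show "flow \<kappa> (3 - i) P (equil \<kappa> i P) s \<in> region (3 - i) P" if "0 < s" "s < \<tau>" for s
  proof -
    have "excess \<kappa> (3 - i) P * transit (\<kappa> (3 - i)) s < excess \<kappa> (3 - i) P * transit (\<kappa> (3 - i)) \<tau>"
      using transit_strict_mono[OF k that] ej by simp
    then show ?thesis
      unfolding equil_sw_point(2)[OF i e] flow_sw_point_in_region_iff_transit[OF j(1) that(1)] using et by simp
  qed
  show "flow \<kappa> i P (sw_point \<kappa> i P (spread \<kappa> - \<beta>)) s \<in> region i P" if "0 < s" for s
    unfolding flow_sw_point_in_region_iff_transit[OF i that] using e \<beta> lt by simp
qed

lemma homoclinic_orbit_homoclinic:
  assumes i: "i \<in> {1, 2}" and e: "excess \<kappa> i P = 0" and eta: "snd (BB \<kappa>) < snd P" "snd P < 0"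
  shows "homoclinic_orbit \<kappa> i P (homoclinic i P)"
proof -
  have j: "3 - i \<in> {1, 2}" "3 - (3 - i) = i" using other_index i by blast+
  define \<tau> where "\<tau> = transit_time (\<kappa> (3 - i)) (spread \<kappa> / excess \<kappa> (3 - i) P)"
  define \<beta> where "\<beta> = half_return (\<kappa> (3 - i)) (excess \<kappa> (3 - i) P) (spread \<kappa>)"
  note p = homoclinic_parts[OF assms, folded \<tau>_def \<beta>_def]
  let ?p = "equil \<kappa> i P" and ?w = "sw_point \<kappa> i P (spread \<kappa> - \<beta>)"
  define \<phi> where "\<phi> = homoclinic i P"
  have \<phi>: "\<phi> t = (if t \<le> \<tau> then flow \<kappa> (3 - i) P ?p t else flow \<kappa> i P ?w (t - \<tau>))" for t
    by (simp add: \<phi>_def homoclinic_def Let_def p(6) flip: \<tau>_def)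
  have \<phi>1: "\<phi> t = flow \<kappa> (3 - i) P ?p t" if "t \<le> \<tau>" for t using that by (simp add: \<phi>)
  \<comment> \<open>Flowing backward by \<open>\<tau>\<close> from the landing point expresses the
    second piece in the time variable of the whole orbit.\<close>
  have \<phi>2: "\<phi> t = flow \<kappa> i P (flow \<kappa> i P ?w (- \<tau>)) t" if "\<tau> \<le> t" for t
    using that by (cases "t = \<tau>") (simp_all add: \<phi> p(6) flow_flow)
  have reg1: "\<phi> t \<in> region (3 - i) P" if "0 < t" "t < \<tau>" for t using p(7)[OF that] that by (simp add: \<phi>1)
  have reg2: "\<phi> t \<in> region i P" if "\<tau> < t" for t using p(8)[of "t - \<tau>"] that by (simp add: \<phi>)
  have \<phi>\<tau>: "\<phi> \<tau> = ?w" using p(6) by (simp add: \<phi>1)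
  have \<phi>0: "\<phi> 0 = ?p" using p(3) by (simp add: \<phi>1)
  have cont: "continuous_on {0..} \<phi>"
  proof -
    have "continuous_on {0..} (\<lambda>t. if t \<le> \<tau> then flow \<kappa> (3 - i) P ?p t else flow \<kappa> i P (flow \<kappa> i P ?w (- \<tau>)) t)"
      by (rule continuous_on_cases_le) (rule continuous_on_flow continuous_on_id | simp add: p(6) flow_flow)+
    also have "(\<lambda>t. if t \<le> \<tau> then flow \<kappa> (3 - i) P ?p t else flow \<kappa> i P (flow \<kappa> i P ?w (- \<tau>)) t) = \<phi>"
      by (rule ext) (simp add: \<phi> flow_flow)
    finally show ?thesis .
  qed
  have solves: "solves (vf \<kappa> m P) \<phi> S" if "m \<in> {1, 2}" "\<And>t. t \<in> S \<Longrightarrow> \<phi> t = flow \<kappa> m P z t" for m z S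
    unfolding solves_def
  proof
    fix t assume t: "t \<in> S"
    have "(\<phi> has_vector_derivative vf \<kappa> m P (flow \<kappa> m P z t)) (at t within S)"
      by (rule has_vector_derivative_transform[OF t _ flow_vector_derivative[where \<kappa> = \<kappa> and i = m, OF \<kappa>_pos[OF that(1)]]])
         (simp add: that(2))
    then show "(\<phi> has_vector_derivative vf \<kappa> m P (\<phi> t)) (at t within S)" using that(2)[OF t] by simp
  qed
  have orb: "pws_orbit \<kappa> P \<phi>"
    unfolding pws_orbit_def
  proof (intro conjI cont exI[of _ "{\<tau>}"] allI impI)
    fix s t assume st: "0 \<le> s \<and> s < t \<and> {\<tau>} \<inter> {s<..<t} = {}"
    then have "t \<le> \<tau> \<or> \<tau> \<le> s" by force
    then have "\<exists>m\<in>{1, 2}. traverses (vf \<kappa> m P) (region m P) \<phi> {s<..<t}"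
    proof
      assume t: "t \<le> \<tau>"
      have "traverses (vf \<kappa> (3 - i) P) (region (3 - i) P) \<phi> {s<..<t}"
        unfolding traverses_def using st t reg1 by (intro conjI solves[OF j(1), of _ ?p]) (auto simp: \<phi>1)
      then show ?thesis using j(1) by blast
    next
      assume t: "\<tau> \<le> s"
      have "traverses (vf \<kappa> i P) (region i P) \<phi> {s<..<t}"
        unfolding traverses_def using st t reg2 by (intro conjI solves[OF i, of _ "flow \<kappa> i P ?w (- \<tau>)"]) (auto simp: \<phi>2)
      then show ?thesis using i by blast
    qed
    then show "traverses (vf \<kappa> 1 P) (region 1 P) \<phi> {s<..<t} \<or>
      traverses (vf \<kappa> 2 P) (region 2 P) \<phi> {s<..<t} \<or>
      traverses (sliding_vf \<kappa> P) (sliding \<kappa> P) \<phi> {s<..<t}" by auto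
  qed auto
  have cases: "t = 0 \<or> t = \<tau> \<or> \<phi> t \<in> region i P \<or> \<phi> t \<in> region (3 - i) P" if "t \<ge> 0" for t
    using that reg1[of t] reg2[of t] by (cases t \<tau> rule: linorder_cases) auto
  have p0: "?p = sw_point \<kappa> i P 0" by (rule equil_sw_point(1)[OF i e])
  have pr: "?p \<notin> region m P" if "m \<in> {1, 2}" for m unfolding p0 by (rule sw_point_not_in_region[OF that])
  have neq: "\<phi> t \<noteq> ?p" if "t > 0" for t
  proof
    assume eq: "\<phi> t = ?p"
    then have "t = \<tau>" using cases[of t] that pr[OF i] pr[OF j(1)] by auto
    then have "?w = ?p" using eq \<phi>\<tau> by simp
    then show False using p(2,5) by (simp add: p0)
  qed
  have nosl: "\<phi> t \<notin> sliding \<kappa> P" if "t \<ge> 0" for t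
  proof
    assume sl: "\<phi> t \<in> sliding \<kappa> P"
    then have "\<phi> t \<in> switching P" using sliding_subset_switching by blast
    then have "t = 0 \<or> t = \<tau>" using cases[OF that] region_disjoint(2)[OF i] region_disjoint(2)[OF j(1)] by blast
    then have "?p \<in> sliding \<kappa> P \<or> ?w \<in> sliding \<kappa> P" using sl \<phi>0 \<phi>\<tau> by auto
    then show False
      unfolding p0 sliding_sw_point_iff[OF i] e using p(2,4,5) by (auto simp: zero_less_mult_iff)
  qed
  have cr: "\<phi> \<tau> \<in> crossing \<kappa> P"
    unfolding \<phi>\<tau> crossing_sw_point_iff[OF i] e using p(2,4,5) by (auto simp: mult_less_0_iff)
  have "(\<phi> \<longlongrightarrow> ?p) at_top"
  proof (rule Lim_transform_eventually[OF flow_tendsto_equil[OF \<kappa>_pos[OF i]]])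
    show "\<forall>\<^sub>F t in at_top. flow \<kappa> i P (flow \<kappa> i P ?w (- \<tau>)) t = \<phi> t"
      using eventually_ge_at_top[of \<tau>] by eventually_elim (simp add: \<phi>2)
  qed
  then show ?thesis
    unfolding homoclinic_orbit_def \<phi>_def[symmetric]
    using orb \<phi>0 neq nosl cr p(3) by blast
qed

lemma homoclinic_image:
  assumes i: "i \<in> {1, 2}" and e: "excess \<kappa> i P = 0" and eta: "snd (BB \<kappa>) < snd P" "snd P < 0"
  defines "\<tau> \<equiv> transit_time (\<kappa> (3 - i)) (spread \<kappa> / excess \<kappa> (3 - i) P)"
    and "z \<equiv> flow \<kappa> (3 - i) P (equil \<kappa> i P)"
  shows "homoclinic i P ` {0..} = z ` {0..\<tau>} \<union> flow \<kappa> i P (z \<tau>) ` {0..}"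
proof -
  have \<tau>: "\<tau> > 0" unfolding \<tau>_def by (rule homoclinic_parts(3)[OF i e eta])
  have 1: "homoclinic i P t = z t" if "t \<le> \<tau>" for t
    using that by (simp add: homoclinic_def Let_def \<tau>_def z_def)
  have 2: "homoclinic i P (\<tau> + t) = flow \<kappa> i P (z \<tau>) t" if "t \<ge> 0" for t
    using that by (cases "t = 0") (simp_all add: homoclinic_def Let_def \<tau>_def z_def)
  have "{0..} = {0..\<tau>} \<union> (\<lambda>t. \<tau> + t) ` {0..}"
    using \<tau> by (auto simp: image_iff intro: bexI[of _ "_ - \<tau>"])
  then have "homoclinic i P ` {0..} = homoclinic i P ` {0..\<tau>} \<union> (\<lambda>t. homoclinic i P (\<tau> + t)) ` {0..}"
    by (metis image_Un image_image)
  also have "\<dots> = z ` {0..\<tau>} \<union> flow \<kappa> i P (z \<tau>) ` {0..}"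
    by (intro arg_cong2[where f = "(\<union>)"] image_cong refl) (auto simp: 1 2)
  finally show ?thesis .
qed

lemma tendsto_equil: "(equil \<kappa> i \<longlongrightarrow> equil \<kappa> i P) (at P within S)"
proof -
  have "((\<lambda>Q. (1 / (1 + \<kappa> i), fst Q * inverse (\<kappa> i))) \<longlongrightarrow> (1 / (1 + \<kappa> i), fst P * inverse (\<kappa> i))) (at P within S)"
    by (intro tendsto_intros)
  moreover have "equil \<kappa> i = (\<lambda>Q. (1 / (1 + \<kappa> i), fst Q * inverse (\<kappa> i)))"
    by (simp add: fun_eq_iff equil_def divide_inverse)
  ultimately show ?thesis by simp
qed

lemma tendsto_excess: "(excess \<kappa> i \<longlongrightarrow> excess \<kappa> i P) (at P within S)"
proof -
  have "((\<lambda>Q. side i * (snd Q + 1 / (1 + \<kappa> i) - fst Q * inverse (\<kappa> i))) \<longlongrightarrow>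
      side i * (snd P + 1 / (1 + \<kappa> i) - fst P * inverse (\<kappa> i))) (at P within S)"
    by (intro tendsto_intros)
  then show ?thesis by (simp add: excess_eq[abs_def] divide_inverse)
qed

text \<open>For field \<open>j\<close> the flight times converge, so arcs are compared up to a small
  time mismatch. For field \<open>i\<close> they are not controlled; arcs are compared at equal
  times, and the part of the homoclinic orbit after the landing of the periodic orbit is treated
  separately.\<close>

lemma homoclinic_like_if:
  assumes i: "i \<in> {1, 2}" and e: "excess \<kappa> i P = 0" and eta: "snd (BB \<kappa>) < snd P" "snd P < 0"
  shows "homoclinic_like \<kappa> i P"
proof -
  define j where "j = 3 - i"
  have j: "j \<in> {1, 2}" "3 - j = i" using other_index i unfolding j_def by blast+
  note ki = \<kappa>_pos[OF i] and kj = \<kappa>_pos[OF j(1)]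
  define \<tau> where "\<tau> = transit_time (\<kappa> j) (spread \<kappa> / excess \<kappa> j P)"
  define p where "p = equil \<kappa> i P"
  define z where "z = flow \<kappa> j P p"
  note parts = homoclinic_parts[OF i e eta, folded j_def, folded \<tau>_def p_def]
  define H where "H = homoclinic i P ` {0..}"
  have H: "H = z ` {0..\<tau>} \<union> flow \<kappa> i P (z \<tau>) ` {0..}"
    unfolding H_def z_def p_def \<tau>_def j_def by (rule homoclinic_image[OF i e eta])
  have p_sw: "p = sw_point \<kappa> j P (spread \<kappa>)" unfolding p_def j_def by (rule equil_sw_point(2)[OF i e])
  define C where "C = (1 + \<kappa> j) * norm (p - equil \<kappa> j P)"
  define A where "A Q = (SOME A. limit_cycle \<kappa> Q A)" for Q
  have A: "limit_cycle \<kappa> Q (A Q)" if "Q \<in> Gamma_region \<kappa>" for Q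
    unfolding A_def by (rule someI_ex[OF limit_cycle_exists[OF that]])
  define T where "T m Q = transit_time (\<kappa> m) (A Q m / excess \<kappa> m Q)" for m Q
  \<comment> \<open>\<open>d1\<close> collects the displacements of launch point and equilibrium for
    field \<open>j\<close>, \<open>d2\<close> adds the time mismatch, \<open>d3\<close> is the
    displacement of the equilibrium of field \<open>i\<close>, and the last summand of
    \<open>d\<close> pays for the homoclinic tail.\<close>
  define d1 where "d1 Q = dist (sw_point \<kappa> j Q (A Q j)) p + dist (equil \<kappa> j Q) (equil \<kappa> j P)" for Q
  define d2 where "d2 Q = d1 Q + C * \<bar>T j Q - \<tau>\<bar>" for Q
  define d3 where "d3 Q = dist (equil \<kappa> i Q) p" for Q
  define d where "d Q = d2 Q + d3 Q + 2 * (d1 Q + d3 Q)" for Q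
  let ?F = "at P within Gamma_region \<kappa>"
  have inF: "\<forall>\<^sub>F Q in ?F. Q \<in> Gamma_region \<kappa>" by (simp add: eventually_at_filter)
  have Aj: "((\<lambda>Q. A Q j) \<longlongrightarrow> spread \<kappa>) ?F"
  proof (rule tendsto_sandwich)
    have bounds: "spread \<kappa> - \<kappa> i * excess \<kappa> i Q \<le> A Q j \<and> A Q j \<le> spread \<kappa>" if "Q \<in> Gamma_region \<kappa>" for Q
    proof -
      interpret limit_cycle \<kappa> Q "A Q" by (rule A[OF that])
      show ?thesis using A_other[OF i] hr_bounds[OF i A_gt[OF i]] by (simp add: j_def)
    qed
    show "\<forall>\<^sub>F Q in ?F. spread \<kappa> - \<kappa> i * excess \<kappa> i Q \<le> A Q j" "\<forall>\<^sub>F Q in ?F. A Q j \<le> spread \<kappa>"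
      using inF by (auto elim!: eventually_mono dest: bounds)
    have "((\<lambda>Q. spread \<kappa> - \<kappa> i * excess \<kappa> i Q) \<longlongrightarrow> spread \<kappa> - \<kappa> i * excess \<kappa> i P) ?F"
      by (intro tendsto_intros tendsto_excess)
    then show "((\<lambda>Q. spread \<kappa> - \<kappa> i * excess \<kappa> i Q) \<longlongrightarrow> spread \<kappa>) ?F" using e by simp
  qed simp
  have Tj: "(T j \<longlongrightarrow> \<tau>) ?F"
    unfolding T_def[abs_def] \<tau>_def
  proof (rule transit_time_tendsto[OF kj])
    show "((\<lambda>Q. A Q j / excess \<kappa> j Q) \<longlongrightarrow> spread \<kappa> / excess \<kappa> j P) ?F"
      using parts(1) by (intro tendsto_divide Aj tendsto_excess) simp
    show "\<kappa> j < spread \<kappa> / excess \<kappa> j P" using parts(1,2) by (simp add: pos_less_divide_eq)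
  qed
  have d1: "(d1 \<longlongrightarrow> 0) ?F"
  proof -
    have "((\<lambda>Q. sw_point \<kappa> j Q (A Q j)) \<longlongrightarrow> sw_point \<kappa> j P (spread \<kappa>)) ?F"
      unfolding sw_point_def by (intro tendsto_intros tendsto_equil Aj)
    then have "(d1 \<longlongrightarrow> dist p p + dist (equil \<kappa> j P) (equil \<kappa> j P)) ?F"
      unfolding d1_def[abs_def] p_sw by (intro tendsto_intros tendsto_equil)
    then show ?thesis by simp
  qed
  have "(d3 \<longlongrightarrow> dist p p) ?F"
    unfolding d3_def[abs_def] using tendsto_equil[of i P] by (intro tendsto_intros) (simp add: p_def)
  then have d3: "(d3 \<longlongrightarrow> 0) ?F" by simp
  have "(d \<longlongrightarrow> (0 + C * \<bar>\<tau> - \<tau>\<bar>) + 0 + 2 * (0 + 0)) ?F"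
    unfolding d_def[abs_def] d2_def by (intro tendsto_intros d1 d3 Tj)
  then have d: "(d \<longlongrightarrow> 0) ?F" by simp
  have close: "(\<forall>w\<in>G. infdist w H \<le> d Q) \<and> (\<forall>w\<in>H. infdist w G \<le> d Q)" and Gam: "is_Gamma \<kappa> Q G"
    if Q: "Q \<in> Gamma_region \<kappa>" and G: "G = limit_cycle.cyc \<kappa> Q (A Q)" for Q G
  proof -
    interpret limit_cycle \<kappa> Q "A Q" by (rule A[OF Q])
    show "is_Gamma \<kappa> Q G" using is_Gamma_cyc by (simp add: G)
    define a where "a m = flow \<kappa> m Q (sw_point \<kappa> m Q (A Q m))" for m
    have T: "T m Q > 0" if "m \<in> {1, 2}" for m using T_pos[OF that A_gt[OF that]] by (simp add: T_def)
    have inG: "a m s \<in> G" if "m \<in> {1, 2}" "0 \<le> s" "s \<le> T m Q" for m s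
      unfolding G a_def using pt_in_cyc[OF that(1,2)] that(3) by (simp add: T_def)
    have G_cases: "\<exists>m\<in>{1, 2}. \<exists>s. 0 \<le> s \<and> s \<le> T m Q \<and> w = a m s" if w: "w \<in> G" for w
    proof -
      obtain m where m: "m \<in> {1, 2}" and "w \<in> flow \<kappa> m Q (sw_point \<kappa> m Q (A Q m)) ` {0..T m Q}"
        using w unfolding G cyc_def T_def by (rule UN_E)
      then show ?thesis by (intro bexI[OF _ m]) (auto simp: a_def)
    qed
    have nonneg: "0 \<le> d1 Q" "0 \<le> d3 Q" "0 \<le> C * \<bar>T j Q - \<tau>\<bar>"
      using kj by (auto simp: d1_def d3_def C_def)
    have \<tau>: "\<tau> > 0" by (rule parts(3))
    have z_time: "dist (z s) (z t) \<le> C * \<bar>s - t\<bar>" if "0 \<le> s" "0 \<le> t" for s t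
      using dist_flow_time_le[where \<kappa> = \<kappa> and i = j, OF kj that, of P p] by (simp add: z_def C_def mult_ac)
    have az: "dist (a j s) (z s) \<le> d1 Q" if "0 \<le> s" for s
      using dist_flow_le[where \<kappa> = \<kappa> and i = j, OF kj that, of Q "sw_point \<kappa> j Q (A Q j)" P p]
      by (simp add: a_def z_def d1_def)
    have az': "dist (a j s) (z t) \<le> d2 Q" if "0 \<le> s" "0 \<le> t" "\<bar>s - t\<bar> \<le> \<bar>T j Q - \<tau>\<bar>" for s t
    proof -
      have "C * \<bar>s - t\<bar> \<le> C * \<bar>T j Q - \<tau>\<bar>" using that(3) kj by (intro mult_left_mono) (auto simp: C_def)
      then show ?thesis
        using dist_triangle[of "a j s" "z t" "z s"] az[OF that(1)] z_time[OF that(1,2)] by (simp add: d2_def)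
    qed
    have glue: "a j (T j Q) = sw_point \<kappa> i Q (A Q i)" "a i (T i Q) = sw_point \<kappa> j Q (A Q j)"
      using pt_A_eq[OF j(1)] pt_A_eq[OF i] by (simp_all add: a_def T_def j(2) flip: j_def)
    have ai: "dist (a i s) (flow \<kappa> i P (z \<tau>) s) \<le> d2 Q + d3 Q" if "0 \<le> s" for s
    proof -
      have "dist (a i s) (flow \<kappa> i P (z \<tau>) s) \<le> dist (a j (T j Q)) (z \<tau>) + d3 Q"
        using dist_flow_le[where \<kappa> = \<kappa> and i = i, OF ki that, of Q "sw_point \<kappa> i Q (A Q i)" P "z \<tau>"] unfolding glue
        by (simp add: a_def d3_def p_def)
      moreover have "dist (a j (T j Q)) (z \<tau>) \<le> d2 Q" by (rule az') (use T[OF j(1)] \<tau> in auto)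
      ultimately show ?thesis by simp
    qed
    have d_ge: "d2 Q \<le> d Q" "d2 Q + d3 Q \<le> d Q" using nonneg by (simp_all add: d_def)
    have "infdist w H \<le> d Q" if w: "w \<in> G" for w
    proof -
      obtain m s where m: "m \<in> {1, 2}" and s: "0 \<le> s" "s \<le> T m Q" "w = a m s" using G_cases[OF w] by blast
      show ?thesis
      proof (cases "m = i")
        case True
        have "infdist w H \<le> dist w (flow \<kappa> i P (z \<tau>) s)" by (rule infdist_le) (use s in \<open>auto simp: H\<close>)
        then show ?thesis using ai[OF s(1)] d_ge s True by simp
      next
        case False
        then have mj: "m = j" using m i by (auto simp: j_def)
        have "infdist w H \<le> dist w (z (min s \<tau>))" by (rule infdist_le) (use s \<tau> in \<open>auto simp: H\<close>)
        moreover have "dist (a j s) (z (min s \<tau>)) \<le> d2 Q" by (rule az') (use s mj \<tau> in \<open>auto simp: min_def\<close>)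
        ultimately show ?thesis using d_ge s mj by simp
      qed
    qed
    moreover have "infdist w G \<le> d Q" if w: "w \<in> H" for w
    proof -
      consider s where "0 \<le> s" "s \<le> \<tau>" "w = z s" | s where "0 \<le> s" "w = flow \<kappa> i P (z \<tau>) s"
        using w unfolding H by auto
      then show ?thesis
      proof cases
        case 1
        let ?s = "min s (T j Q)"
        have "infdist w G \<le> dist w (a j ?s)" by (rule infdist_le[OF inG[OF j(1)]]) (use 1 T[OF j(1)] in auto)
        moreover have "dist (a j ?s) (z s) \<le> d2 Q" by (rule az') (use 1 T[OF j(1)] in \<open>auto simp: min_def\<close>)
        ultimately show ?thesis using d_ge 1 by (simp add: dist_commute)
      next
        case 2
        show ?thesis
        proof (cases "s \<le> T i Q")
          case True
          have "infdist w G \<le> dist w (a i s)" by (rule infdist_le[OF inG[OF i 2(1) True]])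
          then show ?thesis using ai[OF 2(1)] d_ge 2 by (simp add: dist_commute)
        next
          case False
          \<comment> \<open>Past its landing point \<open>?b\<close> the flow of field
            \<open>i\<close> continues no farther from the equilibrium \<open>?q\<close> than
            \<open>?b\<close> itself, hence within twice that distance of \<open>?b\<close>, a point
            of the periodic orbit.\<close>
          let ?b = "sw_point \<kappa> j Q (A Q j)" and ?q = "equil \<kappa> i Q"
          have b: "?b \<in> G" using inG[OF i, of "T i Q"] T[OF i] glue by simp
          have bq: "dist ?b ?q \<le> d1 Q + d3 Q"
            using dist_triangle[of ?b ?q p] zero_le_dist[of "equil \<kappa> j Q" "equil \<kappa> j P"]
            unfolding d1_def d3_def dist_commute[of p] by linarith
          have eq: "a i s = flow \<kappa> i Q ?b (s - T i Q)" unfolding glue(2)[symmetric] by (simp add: a_def flow_flow)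
          have "dist (a i s) ?q \<le> dist ?b ?q"
            using dist_flow_le[where \<kappa> = \<kappa> and i = i, OF ki, of "s - T i Q" Q ?b Q ?q] False by (simp add: eq)
          then have "dist (a i s) ?b \<le> 2 * (d1 Q + d3 Q)"
            using dist_triangle[of "a i s" ?b ?q] bq by (simp add: dist_commute)
          then have "dist w ?b \<le> d Q"
            using dist_triangle[of w ?b "a i s"] ai[OF 2(1)] 2(2) by (simp add: d_def dist_commute)
          then show ?thesis using infdist_le[OF b, of w] by simp
        qed
      qed
    qed
    ultimately show "(\<forall>w\<in>G. infdist w H \<le> d Q) \<and> (\<forall>w\<in>H. infdist w G \<le> d Q)" by blast
  qed
  show ?thesis unfolding homoclinic_like_def
  proof (intro conjI exI[of _ "homoclinic i P"] allI impI)
    show "boundary_equilibrium \<kappa> i P" using e BE_excess[OF i] BE_iff[where \<kappa> = \<kappa> and i = i, OF ki] by blast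
    show "homoclinic_orbit \<kappa> i P (homoclinic i P)" by (rule homoclinic_orbit_homoclinic[OF i e eta])
    fix \<epsilon> :: real assume "\<epsilon> > 0"
    then have "\<forall>\<^sub>F Q in ?F. d Q < \<epsilon>" using d by (simp add: order_tendstoD)
    with inF show "\<forall>\<^sub>F Q in ?F. \<exists>G. is_Gamma \<kappa> Q G \<and> (\<forall>z\<in>G. infdist z (homoclinic i P ` {0..}) < \<epsilon>) \<and>
        (\<forall>z\<in>homoclinic i P ` {0..}. infdist z G < \<epsilon>)"
    proof eventually_elim
      case (elim Q)
      let ?G = "limit_cycle.cyc \<kappa> Q (A Q)"
      show ?case
      proof (intro exI[of _ ?G] conjI ballI)
        show "is_Gamma \<kappa> Q ?G" by (rule Gam[OF elim(1) refl])
      next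
        fix z assume "z \<in> ?G"
        then have "infdist z H \<le> d Q" using close[OF elim(1) refl] by blast
        then show "infdist z (homoclinic i P ` {0..}) < \<epsilon>" using elim(2) unfolding H_def by linarith
      next
        fix z assume "z \<in> homoclinic i P ` {0..}"
        then have "infdist z ?G \<le> d Q" using close[OF elim(1) refl] unfolding H_def by blast
        then show "infdist z ?G < \<epsilon>" using elim(2) by linarith
      qed
    qed
  qed
qed

end

section \<open>Tangencies\<close>

lemma exp_transit_gt: "k * (1 - exp (- t)) < exp (k * t) - 1" if "k > 0" "t \<noteq> 0" for k t :: real
proof -
  have "k * (1 - exp (- t)) < k * t" using one_minus_exp_minus_less[of t] that by simp
  also have "\<dots> < exp (k * t) - 1" using exp_diff_one_gt[of "k * t"] that by simp
  finally show ?thesis .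
qed

lemma tangency_sw_point:
  assumes "\<kappa> i > 0"
  shows "tangency \<kappa> i P = sw_point \<kappa> i P (\<kappa> i * excess \<kappa> i P)"
  using tangency_iff[of "sw_point \<kappa> i P (\<kappa> i * excess \<kappa> i P)" P \<kappa> i] vf_nvec_sw_point[of \<kappa> i P] assms
  by simp

text \<open>A vector tangent to the line is a multiple of \<open>(1, 1)\<close>, so the first
  component at the tangency abscissa is all there is to compute.\<close>

lemma vf_tangency:
  assumes "\<kappa> i > 0"
  shows "vf \<kappa> i P (tangency \<kappa> i P) = (- side i * \<kappa> i * (1 + \<kappa> i) * excess \<kappa> i P) *\<^sub>R (1, 1)"
proof -
  define X where "X = 1 / (1 + \<kappa> i)"
  have X: "(1 + \<kappa> i) * X = 1" using assms by (simp add: X_def)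
  have f: "fst (vf \<kappa> i P z) = 1 - (1 + \<kappa> i) * fst z" for z by (simp add: vf_def split_beta)
  have n: "vf \<kappa> i P (tangency \<kappa> i P) \<bullet> nvec = 0"
    using tangency_iff[of "tangency \<kappa> i P" P \<kappa> i] by simp
  then have s: "snd (vf \<kappa> i P (tangency \<kappa> i P)) = fst (vf \<kappa> i P (tangency \<kappa> i P))"
    by (cases "vf \<kappa> i P (tangency \<kappa> i P)") (simp add: nvec_def)
  have "fst (vf \<kappa> i P (tangency \<kappa> i P)) = 1 - (1 + \<kappa> i) * (X + side i * (\<kappa> i * excess \<kappa> i P))"
    unfolding f by (simp add: tangency_sw_point[where \<kappa> = \<kappa> and i = i, OF assms] sw_point_def fst_equil X_def)
  also have "\<dots> = - side i * \<kappa> i * (1 + \<kappa> i) * excess \<kappa> i P"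
    unfolding distrib_left[of _ X] X by (simp add: algebra_simps)
  finally show ?thesis using s by (simp add: prod_eq_iff)
qed

lemma has_derivative_vf: "(vf \<kappa> i P has_derivative (\<lambda>v. (- (1 + \<kappa> i) * fst v, - \<kappa> i * snd v))) (at z)"
proof -
  have "vf \<kappa> i P = (\<lambda>z. (1 - (1 + \<kappa> i) * fst z, fst P - \<kappa> i * snd z))"
    by (simp add: fun_eq_iff vf_def split_beta)
  moreover have "((\<lambda>z. (1 - (1 + \<kappa> i) * fst z, fst P - \<kappa> i * snd z)) has_derivative
      (\<lambda>v. (0 - (1 + \<kappa> i) * fst v, 0 - \<kappa> i * snd v))) (at z)"
    by (intro derivative_intros)
  ultimately show ?thesis by (simp only: diff_0 mult_minus_left)
qed

lemma frechet_derivative_vf: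
  "frechet_derivative (vf \<kappa> i P) (at z) = (\<lambda>v. (- (1 + \<kappa> i) * fst v, - \<kappa> i * snd v))"
  using frechet_derivative_at[OF has_derivative_vf] by metis

lemma lie_derivative_tangency:
  assumes "\<kappa> i > 0"
  shows "lie_derivative (vf \<kappa> i P) (\<lambda>w. vf \<kappa> i P w \<bullet> nvec) (tangency \<kappa> i P) =
    - side i * \<kappa> i * (1 + \<kappa> i) * excess \<kappa> i P"
proof -
  let ?D = "\<lambda>v. (- (1 + \<kappa> i) * fst v, - \<kappa> i * snd v) \<bullet> nvec"
  have "((\<lambda>w. vf \<kappa> i P w \<bullet> nvec) has_derivative ?D) (at z)" for z
    by (intro has_derivative_inner_left has_derivative_vf)
  then have "frechet_derivative (\<lambda>w. vf \<kappa> i P w \<bullet> nvec) (at z) = ?D" for z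
    by (rule frechet_derivative_at[symmetric])
  then show ?thesis
    unfolding lie_derivative_def vf_tangency[where \<kappa> = \<kappa> and i = i, OF assms]
    by (simp add: nvec_def algebra_simps)
qed

context rates
begin

lemma quadratic_tangency_iff:
  assumes "i \<in> {1, 2}"
  shows "quadratic_tangency \<kappa> i P (tangency \<kappa> i P) \<longleftrightarrow> excess \<kappa> i P \<noteq> 0"
proof -
  have k: "\<kappa> i > 0" "1 + \<kappa> i \<noteq> 0" using \<kappa>_pos[OF assms] by auto
  show ?thesis
    using tangency_iff[of "tangency \<kappa> i P" P \<kappa> i] k
    by (simp add: quadratic_tangency_def lie_derivative_tangency)
qed

text \<open>For a launch at the tangency the height is, up to a positive factor,
  \<open>- excess\<close> times a quantity that is positive at all nonzero times, so the whole orbit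
  lies on one side.\<close>

lemma flow_tangency_in_region_iff:
  assumes "i \<in> {1, 2}" "t \<noteq> 0"
  shows "flow \<kappa> i P (tangency \<kappa> i P) t \<in> region i P \<longleftrightarrow> excess \<kappa> i P < 0"
proof -
  have k: "\<kappa> i > 0" using \<kappa>_pos[OF assms(1)] .
  have "flow \<kappa> i P (tangency \<kappa> i P) t \<in> region i P \<longleftrightarrow>
      excess \<kappa> i P * (exp (\<kappa> i * t) - 1 - \<kappa> i * (1 - exp (- t))) < 0"
    unfolding tangency_sw_point[of \<kappa> i, OF k] flow_sw_point_in_region_iff[OF assms(1)] by (simp add: algebra_simps)
  then show ?thesis using exp_transit_gt[OF k assms(2)] by (simp add: mult_less_0_iff)
qed

text \<open>Any witnessing orbit agrees with the flow by uniqueness, and its position at a single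
  positive time already decides the side.\<close>

lemma visible_tangency_iff:
  assumes i: "i \<in> {1, 2}"
  shows "visible \<kappa> i P (tangency \<kappa> i P) \<longleftrightarrow> excess \<kappa> i P < 0"
proof
  assume "excess \<kappa> i P < 0"
  then show "visible \<kappa> i P (tangency \<kappa> i P)"
    unfolding visible_def using solves_flow[where \<kappa> = \<kappa> and i = i, OF \<kappa>_pos[OF i]] flow_tangency_in_region_iff[OF i]
    by (intro exI[of _ "flow \<kappa> i P (tangency \<kappa> i P)"] exI[of _ 1]) simp
next
  assume "visible \<kappa> i P (tangency \<kappa> i P)"
  then obtain \<phi> \<epsilon> where \<epsilon>: "\<epsilon> > 0" and \<phi>: "\<phi> 0 = tangency \<kappa> i P" "solves (vf \<kappa> i P) \<phi> {-\<epsilon><..<\<epsilon>}"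
    and reg: "\<And>t. 0 < \<bar>t\<bar> \<Longrightarrow> \<bar>t\<bar> < \<epsilon> \<Longrightarrow> \<phi> t \<in> region i P" unfolding visible_def by blast
  have der: "(\<phi> has_vector_derivative vf \<kappa> i P (\<phi> t)) (at t)" if "- \<epsilon> < t" "t < \<epsilon>" for t
  proof -
    have t: "t \<in> {-\<epsilon><..<\<epsilon>}" using that by simp
    then have "(\<phi> has_vector_derivative vf \<kappa> i P (\<phi> t)) (at t within {-\<epsilon><..<\<epsilon>})"
      using \<phi>(2) by (auto simp: solves_def)
    then show ?thesis by (simp only: at_within_open[OF t open_greaterThanLessThan])
  qed
  have "continuous_on {0..\<epsilon>/2} \<phi>"
    by (rule continuous_on_vector_derivative[OF has_vector_derivative_at_within[OF der]]) (use \<epsilon> in auto)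
  then have "\<phi> (\<epsilon>/2) = flow \<kappa> i P (\<phi> 0) (\<epsilon>/2 - 0)"
    by (rule flow_unique[where \<kappa> = \<kappa> and i = i, OF \<kappa>_pos[OF i]]) (use der \<epsilon> in auto)
  then show "excess \<kappa> i P < 0"
    using reg[of "\<epsilon>/2"] flow_tangency_in_region_iff[OF i, of "\<epsilon>/2" P] \<epsilon> \<phi>(1) by simp
qed

lemma isCont_excess: "isCont (excess \<kappa> i) P"
  unfolding isCont_def by (rule tendsto_excess)

lemma eventually_nhds_isCont_pos:
  fixes f :: "real \<times> real \<Rightarrow> real"
  assumes "isCont f P" "f P > 0" shows "\<forall>\<^sub>F Q in nhds P. f Q > 0"
proof -
  have "(f \<longlongrightarrow> f P) (nhds P)" using assms(1) by (simp add: isCont_def tendsto_at_iff_tendsto_nhds)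
  then show ?thesis using assms(2) by (rule order_tendstoD)
qed

text \<open>Quadraticity of the tangencies is the open condition of nonzero excess. The remaining
  claims hold at every point with \<open>snd Q \<noteq> 0\<close>, by the sign of
  \<open>tangency_diff\<close>.\<close>

lemma sliding_reversal_if:
  assumes "snd P = 0" "excess \<kappa> 1 P \<noteq> 0" "excess \<kappa> 2 P \<noteq> 0"
  shows "sliding_reversal \<kappa> P"
proof -
  have ev: "\<forall>\<^sub>F Q in nhds P. \<bar>excess \<kappa> i Q\<bar> > 0" if "excess \<kappa> i P \<noteq> 0" for i
    using that by (intro eventually_nhds_isCont_pos continuous_intros isCont_excess) auto
  have seg: "sliding \<kappa> Q = open_segment (tangency \<kappa> 1 Q) (tangency \<kappa> 2 Q)" if Q: "snd Q \<noteq> 0" for Q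
  proof -
    define a b where "a = fst (tangency \<kappa> 1 Q)" and "b = fst (tangency \<kappa> 2 Q)"
    have ab: "a \<noteq> b" using tangency_diff[of Q] Q by (auto simp: a_def b_def)
    have tan: "tangency \<kappa> 1 Q = (a, a + snd Q)" "tangency \<kappa> 2 Q = (b, b + snd Q)"
      by (simp_all add: a_def b_def tangency_def split_beta algebra_simps)
    have "(x - a) * (x - b) < 0 \<longleftrightarrow> (\<exists>u>0. u < 1 \<and> x = (1 - u) * a + u * b)" for x
    proof
      assume lt: "(x - a) * (x - b) < 0"
      define u where "u = (x - a) / (b - a)"
      have "u * (b - a) = x - a" using ab by (simp add: u_def)
      then have "x = (1 - u) * a + u * b" by (simp add: algebra_simps)
      moreover have "0 < u \<and> u < 1" using lt by (auto simp: u_def mult_less_0_iff divide_simps)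
      ultimately show "\<exists>u>0. u < 1 \<and> x = (1 - u) * a + u * b" by blast
    next
      assume "\<exists>u>0. u < 1 \<and> x = (1 - u) * a + u * b"
      then obtain u where u: "0 < u" "u < 1" and x: "x = (1 - u) * a + u * b" by blast
      have "(x - a) * (x - b) = - (u * (1 - u)) * ((b - a) * (b - a))" unfolding x by algebra
      moreover have "(b - a) * (b - a) > 0" using ab by (simp add: zero_less_mult_iff) linarith
      ultimately show "(x - a) * (x - b) < 0" using u by (simp add: mult_neg_pos)
    qed
    then have "z \<in> sliding \<kappa> Q \<longleftrightarrow> z \<in> open_segment (tangency \<kappa> 1 Q) (tangency \<kappa> 2 Q)" for z
      using ab by (cases z)
        (auto simp: sliding_iff switching_iff height_def in_segment tan algebra_simps, (metis+)?)
    then show ?thesis by blast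
  qed
  have "\<forall>\<^sub>F Q in nhds P. snd Q \<noteq> 0 \<longrightarrow>
        (\<forall>i\<in>{1, 2}. quadratic_tangency \<kappa> i Q (tangency \<kappa> i Q)) \<and>
        sliding \<kappa> Q = open_segment (tangency \<kappa> 1 Q) (tangency \<kappa> 2 Q) \<and>
        (snd Q < 0 \<longrightarrow> repelling \<kappa> Q \<and> fst (tangency \<kappa> 2 Q) < fst (tangency \<kappa> 1 Q)) \<and>
        (snd Q > 0 \<longrightarrow> attracting \<kappa> Q \<and> fst (tangency \<kappa> 1 Q) < fst (tangency \<kappa> 2 Q))"
    using ev[OF assms(2)] ev[OF assms(3)]
  proof eventually_elim
    case (elim Q)
    have "fst (tangency \<kappa> 2 Q) < fst (tangency \<kappa> 1 Q)" if "snd Q < 0"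
    proof -
      have "(\<kappa> 2 - \<kappa> 1) * snd Q < 0" using that \<kappa>12 by (intro mult_pos_neg) auto
      then show ?thesis using tangency_diff[of Q] by linarith
    qed
    moreover have "fst (tangency \<kappa> 1 Q) < fst (tangency \<kappa> 2 Q)" if "snd Q > 0"
    proof -
      have "(\<kappa> 2 - \<kappa> 1) * snd Q > 0" using that \<kappa>12 by (intro mult_pos_pos) auto
      then show ?thesis using tangency_diff[of Q] by linarith
    qed
    ultimately show ?case
      using elim seg[of Q] repelling_if[of Q] attracting_if[of Q] quadratic_tangency_iff[of 1 Q] quadratic_tangency_iff[of 2 Q]
      by auto
  qed
  then show ?thesis unfolding sliding_reversal_def .
qed

lemma fold_fold_if:
  assumes "P \<in> FF" "excess \<kappa> 1 P \<noteq> 0" "excess \<kappa> 2 P \<noteq> 0"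
  shows "fold_fold \<kappa> P"
  unfolding fold_fold_def
  using assms FF_iff[of \<kappa> P] quadratic_tangency_iff[of 1 P] quadratic_tangency_iff[of 2 P] by auto

text \<open>Both vectors are multiples of \<open>(1, 1)\<close>; the minus sign comes from the
  opposite sides. Excesses of opposite signs thus give vectors in the same direction, two positive
  excesses give opposite directions.\<close>

lemma vf_tangency_ratio:
  assumes "excess \<kappa> 1 P \<noteq> 0" "excess \<kappa> 2 P \<noteq> 0"
  shows "vf \<kappa> 1 P (tangency \<kappa> 1 P) =
    (- (\<kappa> 1 * (1 + \<kappa> 1) * excess \<kappa> 1 P) / (\<kappa> 2 * (1 + \<kappa> 2) * excess \<kappa> 2 P)) *\<^sub>R vf \<kappa> 2 P (tangency \<kappa> 2 P)"
  using assms by (simp add: vf_tangency)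

lemma fold_fold_VI1_if:
  assumes "P \<in> FF" "excess \<kappa> 1 P * excess \<kappa> 2 P < 0"
  shows "fold_fold_VI1 \<kappa> P"
proof -
  have nz: "excess \<kappa> 1 P \<noteq> 0" "excess \<kappa> 2 P \<noteq> 0" using assms(2) by auto
  define k1 k2 where "k1 = \<kappa> 1 * (1 + \<kappa> 1)" and "k2 = \<kappa> 2 * (1 + \<kappa> 2)"
  have k: "k1 > 0" "k2 > 0" unfolding k1_def k2_def using \<kappa>1 \<kappa>12 by (auto intro!: mult_pos_pos add_pos_pos)
  have "- (k1 * excess \<kappa> 1 P) / (k2 * excess \<kappa> 2 P) > 0"
    using assms(2) k by (auto simp: mult_less_0_iff zero_less_divide_iff zero_less_mult_iff divide_less_0_iff)
  moreover have "visible \<kappa> 1 P (tangency \<kappa> 1 P) \<and> \<not> visible \<kappa> 2 P (tangency \<kappa> 2 P) \<or>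
      visible \<kappa> 2 P (tangency \<kappa> 2 P) \<and> \<not> visible \<kappa> 1 P (tangency \<kappa> 1 P)"
    using assms(2) visible_tangency_iff[of 1 P] visible_tangency_iff[of 2 P] by (auto simp: mult_less_0_iff)
  then have "\<exists>i\<in>{1, 2}. visible \<kappa> i P (tangency \<kappa> i P) \<and> \<not> visible \<kappa> (3 - i) P (tangency \<kappa> (3 - i) P)"
    by auto
  ultimately show ?thesis
    unfolding fold_fold_VI1_def
    using fold_fold_if[OF assms(1) nz] vf_tangency_ratio[OF nz] unfolding k1_def k2_def by blast
qed

lemma fused_focus_if:
  assumes "P \<in> FF" "excess \<kappa> 1 P > 0" "excess \<kappa> 2 P > 0"
  shows "fused_focus \<kappa> P"
proof -
  have nz: "excess \<kappa> 1 P \<noteq> 0" "excess \<kappa> 2 P \<noteq> 0" using assms by auto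
  have "- (\<kappa> 1 * (1 + \<kappa> 1) * excess \<kappa> 1 P) / (\<kappa> 2 * (1 + \<kappa> 2) * excess \<kappa> 2 P) < 0"
    using assms \<kappa>1 \<kappa>12 by (intro divide_neg_pos) (auto intro!: mult_pos_pos add_pos_pos)
  moreover have "fold_fold \<kappa> P \<and> (\<forall>i\<in>{1, 2}. invisible \<kappa> i P (tangency \<kappa> i P))"
    using fold_fold_if[OF assms(1) nz] assms(2,3) visible_tangency_iff[of 1 P] visible_tangency_iff[of 2 P] by auto
  ultimately show ?thesis
    unfolding fused_focus_def using vf_tangency_ratio[OF nz] by blast
qed

end

section \<open>Boundary equilibrium bifurcations\<close>

lemma isCont_discr: "isCont discr P"
proof -
  have "discr = (\<lambda>Q. (snd Q + fst Q + 1)\<^sup>2 - 4 * fst Q)" by (simp add: fun_eq_iff discr_def)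
  moreover have "isCont (\<lambda>Q. (snd Q + fst Q + 1)\<^sup>2 - 4 * fst Q) P" by (intro continuous_intros)
  ultimately show ?thesis by (simp only:)
qed

lemma pseudo_eq_eq:
  "pseudo_eq s P = (1 / 2 * (1 - fst P - snd P + s * sqrt (discr P)),
     1 / 2 * (1 - fst P - snd P + s * sqrt (discr P)) + snd P)"
  by (simp add: pseudo_eq_def split_beta)

lemma isCont_pseudo_eq: "isCont (pseudo_eq s) P"
proof -
  have "isCont (\<lambda>P. (1 / 2 * (1 - fst P - snd P + s * sqrt (discr P)),
     1 / 2 * (1 - fst P - snd P + s * sqrt (discr P)) + snd P)) P"
    by (intro continuous_intros isCont_discr)
  then show ?thesis by (simp add: pseudo_eq_eq[abs_def])
qed

text \<open>The factorised form spares square roots later: from the value of the polynomial and the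
  sign of one factor follows the sign of the other.\<close>

lemma pseudo_eq_quadratic:
  assumes "discr P \<ge> 0" "s \<in> {1, -1}"
  shows "(t - fst (pseudo_eq s P)) * (t - fst (pseudo_eq (- s) P)) = t\<^sup>2 - (1 - fst P - snd P) * t - snd P"
proof -
  define r where "r = sqrt (discr P)"
  have r: "r * r = (snd P + fst P + 1)\<^sup>2 - 4 * fst P"
    using assms(1) by (simp add: r_def) (simp add: discr_def split_beta)
  have "s * s = 1" using assms(2) by auto
  then have "(s * r) * (s * r) = r * r" by (simp add: mult_ac)
  moreover have "(t - 1 / 2 * (b + q)) * (t - 1 / 2 * (b - q)) = t * t - b * t + (b * b - q * q) / 4" for b q :: real
    by (simp add: field_simps)
  ultimately show ?thesis
    using r by (simp add: pseudo_eq_eq flip: r_def) (simp add: power2_eq_square field_simps)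
qed

text \<open>A ray from \<open>P\<close> approaches \<open>P\<close> without meeting it again, so a
  property that fails near \<open>P\<close> would fail along the ray.\<close>

lemma frequently_at_line:
  fixes P v :: "real \<times> real"
  assumes "v \<noteq> 0" "\<forall>\<^sub>F t in at_right (0::real). R (P + t *\<^sub>R v)"
  shows "\<exists>\<^sub>F Q in at P. R Q"
proof -
  have "((\<lambda>t. P + t *\<^sub>R v) \<longlongrightarrow> P + 0 *\<^sub>R v) (at_right 0)" by (intro tendsto_intros)
  then have lim: "filterlim (\<lambda>t. P + t *\<^sub>R v) (at P) (at_right 0)"
    unfolding filterlim_at using assms(1) by (auto simp: eventually_at_filter)
  show ?thesis
  proof (rule ccontr)
    assume "\<not> ?thesis"
    then have "\<forall>\<^sub>F Q in at P. \<not> R Q" by (simp add: frequently_def)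
    then have "\<forall>\<^sub>F t in at_right 0. \<not> R (P + t *\<^sub>R v)"
      using lim by (rule eventually_compose_filterlim)
    with assms(2) have "\<forall>\<^sub>F t in at_right (0::real). False" by eventually_elim simp
    then show False by simp
  qed
qed

lemma eventually_at_right_0:
  assumes "c > 0" shows "\<forall>\<^sub>F t in at_right (0::real). 0 < t \<and> t < c"
  unfolding eventually_at_right_field using assms by (intro exI[of _ c]) simp

context rates
begin

lemma equil_admissible_iff: "i \<in> {1, 2} \<Longrightarrow> equil_admissible \<kappa> i P \<longleftrightarrow> excess \<kappa> i P < 0"
  by (simp add: equil_admissible_def region_iff excess_def del: insert_iff)

lemma boundary_equilibrium_iff: "i \<in> {1, 2} \<Longrightarrow> boundary_equilibrium \<kappa> i P \<longleftrightarrow> excess \<kappa> i P = 0"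
  using BE_iff[of \<kappa> i P] BE_excess[of i P] \<kappa>_pos[of i] by blast

lemma excess_move: "excess \<kappa> i (P + t *\<^sub>R (0, c)) = excess \<kappa> i P + t * (side i * c)"
  by (simp add: excess_eq algebra_simps)

lemma frequently_excess:
  assumes "excess \<kappa> i P = 0"
  shows "\<exists>\<^sub>F Q in at P. excess \<kappa> i Q > 0" "\<exists>\<^sub>F Q in at P. excess \<kappa> i Q < 0"
proof -
  have s: "(0, side i) \<noteq> (0::real \<times> real)" "(0, - side i) \<noteq> (0::real \<times> real)" by (simp_all add: zero_prod_def)
  show "\<exists>\<^sub>F Q in at P. excess \<kappa> i Q > 0"
  proof (rule frequently_at_line[OF s(1)])
    show "\<forall>\<^sub>F t in at_right 0. excess \<kappa> i (P + t *\<^sub>R (0, side i)) > 0"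
      using eventually_at_right_0[OF zero_less_one] by eventually_elim (unfold excess_move assms, simp)
  qed
  show "\<exists>\<^sub>F Q in at P. excess \<kappa> i Q < 0"
  proof (rule frequently_at_line[OF s(2)])
    show "\<forall>\<^sub>F t in at_right 0. excess \<kappa> i (P + t *\<^sub>R (0, - side i)) < 0"
      using eventually_at_right_0[OF zero_less_one] by eventually_elim (unfold excess_move assms, simp)
  qed
qed

lemma collides_if:
  assumes "i \<in> {1, 2}" "excess \<kappa> i P = 0"
  shows "collides_with_quadratic_tangency \<kappa> i P"
proof -
  have b: "equil \<kappa> i Q = tangency \<kappa> i Q \<longleftrightarrow> excess \<kappa> i Q = 0" for Q
    using boundary_equilibrium_iff[OF assms(1)] by (simp add: boundary_equilibrium_def)
  have "\<exists>\<^sub>F Q in at P. equil \<kappa> i Q \<noteq> tangency \<kappa> i Q"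
    using frequently_excess(1)[OF assms(2)] by (rule frequently_elim1) (simp add: b)
  then show ?thesis
    unfolding collides_with_quadratic_tangency_def b quadratic_tangency_iff[OF assms(1)] using assms by simp
qed

lemma excess_0_coords:
  assumes "i \<in> {1, 2}" "excess \<kappa> i P = 0"
  shows "fst P = \<kappa> i * (snd P + 1 / (1 + \<kappa> i))"
proof -
  have "snd P + 1 / (1 + \<kappa> i) = fst P / \<kappa> i" using assms(2) by (simp add: excess_eq)
  then show ?thesis using \<kappa>_pos[OF assms(1)] by (simp add: field_simps)
qed

text \<open>Up to sign the distance of the two pseudo-equilibria at a boundary equilibrium.\<close>
definition pseudo_gap :: "nat \<Rightarrow> real \<times> real \<Rightarrow> real" where
  "pseudo_gap i P = 1 / (1 + \<kappa> i) + (1 + \<kappa> i) * snd P"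

text \<open>At a boundary equilibrium \<open>1 / (1 + \<kappa> i)\<close> is one root of the
  quadratic of the pseudo-equilibria. The roots have product \<open>- snd P\<close>, so the other
  one is \<open>- ((1 + \<kappa> i) * snd P)\<close>, and the discriminant is the square of their
  difference.\<close>

lemma discr_boundary:
  assumes "i \<in> {1, 2}" "excess \<kappa> i P = 0"
  shows "discr P = (pseudo_gap i P)\<^sup>2" "1 - fst P - snd P = 1 / (1 + \<kappa> i) - (1 + \<kappa> i) * snd P"
proof -
  define X where "X = 1 / (1 + \<kappa> i)"
  have X: "\<kappa> i * X = 1 - X" using \<kappa>_pos[OF assms(1)] by (simp add: X_def field_simps)
  have f: "fst P = \<kappa> i * snd P + 1 - X"
    using excess_0_coords[OF assms] X by (simp add: distrib_left flip: X_def)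
  then show b: "1 - fst P - snd P = 1 / (1 + \<kappa> i) - (1 + \<kappa> i) * snd P"
    by (simp add: algebra_simps flip: X_def)
  have "discr P = (1 - fst P - snd P)\<^sup>2 + 4 * snd P"
    by (simp add: discr_def split_beta power2_eq_square algebra_simps)
  also have "\<dots> = (X + (1 + \<kappa> i) * snd P)\<^sup>2 + 4 * snd P * (1 - (X + \<kappa> i * X))"
    unfolding b X_def[symmetric] by (simp add: power2_eq_square algebra_simps)
  also have "X + \<kappa> i * X = 1" using X by simp
  finally show "discr P = (pseudo_gap i P)\<^sup>2" by (simp add: pseudo_gap_def X_def)
qed

text \<open>The sign of the gap tells whether the larger root (\<open>s = 1\<close>) or the smaller
  one (\<open>s = -1\<close>) sits at the tangency.\<close>

lemma pseudo_eq_boundary: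
  assumes "i \<in> {1, 2}" "excess \<kappa> i P = 0" "s \<in> {1, -1}" "s * pseudo_gap i P \<ge> 0"
  shows "pseudo_eq s P = tangency \<kappa> i P" "fst (pseudo_eq s P) = 1 / (1 + \<kappa> i)"
    "fst (pseudo_eq (- s) P) = - ((1 + \<kappa> i) * snd P)"
proof -
  have ss: "s * s = 1" using assms(3) by auto
  have "sqrt (discr P) = \<bar>pseudo_gap i P\<bar>" using discr_boundary(1)[OF assms(1,2)] by simp
  also have "\<dots> = s * pseudo_gap i P" using assms(3,4) by auto
  finally have "s * sqrt (discr P) = (s * s) * pseudo_gap i P" by (simp add: mult.assoc)
  then have r: "s * sqrt (discr P) = pseudo_gap i P" using ss by simp
  then have 1: "1 / 2 * (1 - fst P - snd P + s * sqrt (discr P)) = 1 / (1 + \<kappa> i)"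
    and 2: "1 / 2 * (1 - fst P - snd P - s * sqrt (discr P)) = - ((1 + \<kappa> i) * snd P)"
    unfolding r discr_boundary(2)[OF assms(1,2)] pseudo_gap_def by simp_all
  show "fst (pseudo_eq s P) = 1 / (1 + \<kappa> i)" using 1 by (simp add: pseudo_eq_eq)
  show "fst (pseudo_eq (- s) P) = - ((1 + \<kappa> i) * snd P)" using 2 by (simp add: pseudo_eq_eq)
  have "pseudo_eq s P = (1 / (1 + \<kappa> i), 1 / (1 + \<kappa> i) + snd P)" unfolding pseudo_eq_eq 1 ..
  also have "\<dots> = equil \<kappa> i P"
    using equil_sw_point(1)[OF assms(1,2)] by (simp add: sw_point_def fst_equil)
  also have "\<dots> = tangency \<kappa> i P"
    using boundary_equilibrium_iff[OF assms(1), of P] assms(2) by (simp add: boundary_equilibrium_def)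
  finally show "pseudo_eq s P = tangency \<kappa> i P" .
qed

lemma fst_tangency: "fst (tangency \<kappa> i P) = 1 - fst P + snd P * \<kappa> i"
  by (simp add: tangency_def split_beta)

text \<open>At the abscissa of the tangency the quadratic reduces to \<open>- snd P\<close> times
  the first component of the vector field there, which \<open>vf_tangency\<close> evaluates.\<close>

lemma tangency_quadratic:
  fixes P :: "real \<times> real"
  assumes "i \<in> {1, 2}"
  defines "t \<equiv> fst (tangency \<kappa> i P)"
  shows "t\<^sup>2 - (1 - fst P - snd P) * t - snd P = snd P * side i * \<kappa> i * (1 + \<kappa> i) * excess \<kappa> i P"
proof -
  have "fst (vf \<kappa> i P (tangency \<kappa> i P)) = - side i * \<kappa> i * (1 + \<kappa> i) * excess \<kappa> i P"
    using vf_tangency[of \<kappa> i P] \<kappa>_pos[OF assms(1)] by simp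
  then have v: "1 - (1 + \<kappa> i) * t = - side i * \<kappa> i * (1 + \<kappa> i) * excess \<kappa> i P"
    by (simp add: vf_def split_beta t_def)
  have "t\<^sup>2 - (1 - fst P - snd P) * t - snd P = - snd P * (1 - (1 + \<kappa> i) * t)"
    unfolding t_def fst_tangency by (simp add: power2_eq_square algebra_simps)
  then show ?thesis unfolding v by simp
qed

lemma isCont_fst_tangency: "isCont (\<lambda>Q. fst (tangency \<kappa> i Q)) P"
  unfolding fst_tangency by (intro continuous_intros)

lemma isCont_fst_pseudo_eq: "isCont (\<lambda>Q. fst (pseudo_eq s Q)) P"
  using isCont_pseudo_eq by (intro continuous_intros)

text \<open>Admissibility is the sign of the product of the displacements from the two tangencies.
  Near \<open>P\<close> the one from the other tangency has constant sign; the one from tangency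
  \<open>i\<close> gets its sign from \<open>tangency_quadratic\<close>, because the second root
  stays away.\<close>

lemma pseudo_admissible_iff_near:
  assumes i: "i \<in> {1, 2}" and e: "excess \<kappa> i P = 0" and "snd P \<noteq> 0"
    and s: "s \<in> {1, -1}" "s * pseudo_gap i P > 0"
  shows "\<forall>\<^sub>F Q in nhds P. pseudo_admissible \<kappa> s Q \<longleftrightarrow> s * excess \<kappa> i Q > 0"
proof -
  have pos_iff: "0 < a * b \<longleftrightarrow> 0 < b" if "a > 0" for a b :: real
    using that by (simp add: zero_less_mult_iff)
  let ?j = "3 - i"
  define c where "c = (\<kappa> i - \<kappa> ?j) * snd P"
  have ks: "(\<kappa> i - \<kappa> ?j) * side i > 0" using i \<kappa>12 by auto
  then have "\<kappa> i - \<kappa> ?j \<noteq> 0" by auto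
  then have c: "c \<noteq> 0" using assms(3) by (simp add: c_def)
  have "excess \<kappa> i P = 0 \<Longrightarrow> fst (tangency \<kappa> i P) = 1 / (1 + \<kappa> i)"
    using boundary_equilibrium_iff[OF i, of P] by (metis boundary_equilibrium_def fst_equil)
  then have ti: "fst (tangency \<kappa> i P) = 1 / (1 + \<kappa> i)" using e by blast
  have sg0: "s * pseudo_gap i P \<ge> 0" using s(2) by simp
  note pb = pseudo_eq_boundary[OF i e s(1) sg0]
  have ev1: "\<forall>\<^sub>F Q in nhds P. snd Q * snd P > 0"
    by (rule eventually_nhds_isCont_pos) (use assms(3) in \<open>auto intro!: continuous_intros simp: zero_less_mult_iff\<close>)
  have ev2: "\<forall>\<^sub>F Q in nhds P. discr Q > 0"
    by (rule eventually_nhds_isCont_pos[OF isCont_discr]) (use discr_boundary(1)[OF i e] s(2) in auto)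
  \<comment> \<open>At \<open>P\<close> the tangency and the second root differ by exactly
    \<open>pseudo_gap i P\<close>.\<close>
  have ev3: "\<forall>\<^sub>F Q in nhds P. s * (fst (tangency \<kappa> i Q) - fst (pseudo_eq (- s) Q)) > 0"
  proof (rule eventually_nhds_isCont_pos)
    show "isCont (\<lambda>Q. s * (fst (tangency \<kappa> i Q) - fst (pseudo_eq (- s) Q))) P"
      by (intro continuous_intros isCont_fst_tangency isCont_fst_pseudo_eq)
    show "0 < s * (fst (tangency \<kappa> i P) - fst (pseudo_eq (- s) P))"
      using s(2) unfolding ti pb(3) by (simp add: pseudo_gap_def)
  qed
  \<comment> \<open>At \<open>P\<close> the pseudo-equilibrium is tangency \<open>i\<close>, so this
    difference is that of the two tangencies, which is \<open>c\<close>.\<close>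
  have ev4: "\<forall>\<^sub>F Q in nhds P. c * (fst (pseudo_eq s Q) - fst (tangency \<kappa> ?j Q)) > 0"
  proof (rule eventually_nhds_isCont_pos)
    show "isCont (\<lambda>Q. c * (fst (pseudo_eq s Q) - fst (tangency \<kappa> ?j Q))) P"
      by (intro continuous_intros isCont_fst_tangency isCont_fst_pseudo_eq)
    have "fst (pseudo_eq s P) - fst (tangency \<kappa> ?j P) = c"
      unfolding pb(1) by (simp add: fst_tangency c_def algebra_simps)
    then show "0 < c * (fst (pseudo_eq s P) - fst (tangency \<kappa> ?j P))"
      using c by (simp add: zero_less_mult_iff) linarith
  qed
  show ?thesis using ev1 ev2 ev3 ev4
  proof eventually_elim
    case (elim Q)
    define x where "x = fst (pseudo_eq s Q)"
    define ti tj where "ti = fst (tangency \<kappa> i Q)" and "tj = fst (tangency \<kappa> ?j Q)"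
    define w where "w = \<kappa> i * (1 + \<kappa> i)"
    have w: "w > 0" using \<kappa>_pos[OF i] by (simp add: w_def)
    have nz: "snd Q \<noteq> 0" using elim(1) by auto
    have pe: "pseudo_equilibrium \<kappa> Q (pseudo_eq s Q)"
      using pseudo_equilibrium_iff[of \<kappa> Q "pseudo_eq s Q"] nz elim(2) s(1) by auto
    then have sw: "pseudo_eq s Q \<in> switching Q" by (simp add: pseudo_equilibrium_def)
    have "(ti - x) * (ti - fst (pseudo_eq (- s) Q)) = snd Q * side i * \<kappa> i * (1 + \<kappa> i) * excess \<kappa> i Q"
      unfolding x_def ti_def using pseudo_eq_quadratic[OF _ s(1), of Q] elim(2) tangency_quadratic[OF i, of Q] by simp
    then have q: "(ti - x) * (ti - fst (pseudo_eq (- s) Q)) = w * (snd Q * (side i * excess \<kappa> i Q))"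
      by (simp add: w_def mult_ac)
    define g where "g = s * (ti - fst (pseudo_eq (- s) Q))"
    have g: "g > 0" using elim(3) by (simp add: g_def ti_def)
    have ss: "s * s = 1" using s(1) by auto
    have q': "(ti - x) * g = w * snd Q * side i * (s * excess \<kappa> i Q)"
      using q by (simp add: g_def mult_ac)
    have "pseudo_admissible \<kappa> s Q \<longleftrightarrow> (x - ti) * (x - tj) < 0"
      using i unfolding pseudo_admissible_def sliding_iff x_def ti_def tj_def using pe sw by (auto simp: mult.commute)
    also have "\<dots> \<longleftrightarrow> 0 < (ti - x) * g * c"
    proof -
      have cx: "c * (x - tj) > 0" using elim(4) by (simp add: x_def tj_def)
      have "(x - ti) * (x - tj) < 0 \<longleftrightarrow> (ti - x) * (x - tj) > 0"
        by (metis minus_diff_eq mult_minus_left neg_less_0_iff_less)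
      also have "\<dots> \<longleftrightarrow> 0 < (ti - x) * c" using cx by (auto simp: zero_less_mult_iff)
      also have "\<dots> \<longleftrightarrow> 0 < g * ((ti - x) * c)" using pos_iff[OF g] by simp
      also have "g * ((ti - x) * c) = (ti - x) * g * c" by simp
      finally show ?thesis .
    qed
    also have "(ti - x) * g * c = (w * (snd Q * snd P) * ((\<kappa> i - \<kappa> ?j) * side i)) * (s * excess \<kappa> i Q)"
      unfolding q' c_def by (simp add: mult_ac)
    also have "0 < \<dots> \<longleftrightarrow> s * excess \<kappa> i Q > 0"
    proof -
      have "w * (snd Q * snd P) * ((\<kappa> i - \<kappa> ?j) * side i) > 0" by (rule mult_pos_pos[OF mult_pos_pos[OF w elim(1)] ks])
      then show ?thesis by (rule pos_iff)
    qed
    finally show ?case .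
  qed
qed

text \<open>Above \<open>GB \<kappa> i\<close> the gap is positive and below it negative; this
  switches between the two pseudo-equilibria.\<close>

lemma pseudo_gap_GB: "i \<in> {1, 2} \<Longrightarrow> pseudo_gap i P = (1 + \<kappa> i) * (snd P - snd (GB \<kappa> i))"
proof -
  assume "i \<in> {1, 2}"
  then have k: "1 + \<kappa> i \<noteq> 0" using \<kappa>_pos by force
  define w where "w = 1 + \<kappa> i"
  have "w \<noteq> 0" using k by (simp add: w_def)
  then have eq: "1 / w + w * y = w * (y - - (1 / w\<^sup>2))" for y by (simp add: power2_eq_square field_simps)
  have "snd (GB \<kappa> i) = - (1 / w\<^sup>2)" by (simp add: GB_def w_def add.commute)
  then show ?thesis unfolding pseudo_gap_def w_def[symmetric] by (simp only: eq)
qed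

lemma
  assumes i: "i \<in> {1, 2}" and e: "excess \<kappa> i P = 0" and nz: "snd P \<noteq> 0"
  shows persistence_if: "snd P > snd (GB \<kappa> i) \<Longrightarrow> persistence \<kappa> i P"
    and nonsmooth_fold_if: "snd P < snd (GB \<kappa> i) \<Longrightarrow> nonsmooth_fold \<kappa> i P"
proof -
  have k: "1 + \<kappa> i > 0" using \<kappa>_pos[OF i] by simp
  have b: "boundary_equilibrium \<kappa> i P" using boundary_equilibrium_iff[OF i] e by simp
  have f1: "\<exists>\<^sub>F Q in at P. equil_admissible \<kappa> i Q"
    using frequently_excess(2)[OF e] by (simp add: equil_admissible_iff[OF i])
  have f2: "\<exists>\<^sub>F Q in at P. \<not> boundary_equilibrium \<kappa> i Q \<and> \<not> equil_admissible \<kappa> i Q"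
    using frequently_excess(1)[OF e]
    by (rule frequently_elim1) (simp add: equil_admissible_iff[OF i] boundary_equilibrium_iff[OF i])
  have main: "pseudo_eq s P = tangency \<kappa> i P \<and> isCont (pseudo_eq s) P \<and>
      (\<forall>\<^sub>F Q in at P. pseudo_admissible \<kappa> s Q \<longleftrightarrow> s * excess \<kappa> i Q > 0)"
    if s: "s \<in> {1, -1}" "s * pseudo_gap i P > 0" for s
    using pseudo_eq_boundary(1)[OF i e s(1)] s(2) isCont_pseudo_eq
      pseudo_admissible_iff_near[OF i e nz s] by (auto simp: eventually_at_filter elim!: eventually_mono)
  show "persistence \<kappa> i P" if "snd P > snd (GB \<kappa> i)"
  proof -
    \<comment> \<open>Above \<open>GB \<kappa> i\<close> it is q^+ that passes through the tangency,
      admissible for positive excess, in contrast to the equilibrium. Below, it is q^-, admissible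
      for negative excess, together with the equilibrium.\<close>
    have "1 * pseudo_gap i P > 0" using that k by (simp add: pseudo_gap_GB[OF i])
    note m = main[of 1, OF _ this, simplified]
    have "\<forall>\<^sub>F Q in at P. \<not> boundary_equilibrium \<kappa> i Q \<longrightarrow> (equil_admissible \<kappa> i Q \<longleftrightarrow> \<not> pseudo_admissible \<kappa> 1 Q)"
      using m by (auto simp: equil_admissible_iff[OF i] boundary_equilibrium_iff[OF i] elim!: eventually_mono)
    then show ?thesis unfolding persistence_def using b f1 f2 m by blast
  qed
  show "nonsmooth_fold \<kappa> i P" if "snd P < snd (GB \<kappa> i)"
  proof -
    have "- 1 * pseudo_gap i P > 0" using that k by (simp add: pseudo_gap_GB[OF i] mult_pos_neg)
    note m = main[of "-1", OF _ this, simplified]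
    have "\<forall>\<^sub>F Q in at P. \<not> boundary_equilibrium \<kappa> i Q \<longrightarrow> (equil_admissible \<kappa> i Q \<longleftrightarrow> pseudo_admissible \<kappa> (-1) Q)"
      using m by (auto simp: equil_admissible_iff[OF i] boundary_equilibrium_iff[OF i] elim!: eventually_mono)
    then show ?thesis unfolding nonsmooth_fold_def using b f1 f2 m by blast
  qed
qed

lemma node_equil:
  assumes "i \<in> {1, 2}" shows "node \<kappa> i P"
proof -
  have k: "\<kappa> i > 0" using \<kappa>_pos[OF assms] .
  have "- (1 + \<kappa> i) * - \<kappa> i > 0" unfolding minus_mult_minus using k by (intro mult_pos_pos) auto
  then have "- (1 + \<kappa> i) \<noteq> - \<kappa> i \<and> - (1 + \<kappa> i) * - \<kappa> i > 0 \<and>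
      (1, 0) \<noteq> (0 :: real \<times> real) \<and> (0, 1) \<noteq> (0 :: real \<times> real) \<and>
      (- (1 + \<kappa> i) * fst (1, 0 :: real), - \<kappa> i * snd (1 :: real, 0)) = (- (1 + \<kappa> i)) *\<^sub>R (1, 0) \<and>
      (- (1 + \<kappa> i) * fst (0, 1 :: real), - \<kappa> i * snd (0 :: real, 1)) = (- \<kappa> i) *\<^sub>R (0, 1)"
    by (simp add: zero_prod_def)
  then show ?thesis unfolding node_def frechet_derivative_vf by blast
qed

text \<open>Two positive excesses place a point above \<open>BB \<kappa>\<close> by
  \<open>excess_sum\<close>. So the region lies in a horizontal strip, and points strictly beyond it
  have a neighbourhood that misses the region.\<close>

lemma eventually_not_Gamma_region:
  assumes "snd P > 0 \<or> snd P < snd (BB \<kappa>)"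
  shows "\<forall>\<^sub>F Q in nhds P. Q \<notin> Gamma_region \<kappa>"
proof -
  have out: "Q \<notin> Gamma_region \<kappa>" if "snd Q > 0 \<or> snd Q < snd (BB \<kappa>)" for Q
  proof
    assume Q: "Q \<in> Gamma_region \<kappa>"
    then have "\<kappa> 1 * excess \<kappa> 1 Q + \<kappa> 2 * excess \<kappa> 2 Q > 0"
      using \<kappa>1_pos(1,2) by (auto simp: Gamma_region_iff intro!: add_pos_pos mult_pos_pos)
    then have "(\<kappa> 2 - \<kappa> 1) * (snd Q - snd (BB \<kappa>)) > 0"
      using BB_spread by (simp add: excess_sum right_diff_distrib)
    then have "snd Q > snd (BB \<kappa>)" using \<kappa>12 by (simp add: zero_less_mult_iff)
    then show False using Q that by (auto simp: Gamma_region_iff)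
  qed
  from assms show ?thesis
  proof
    assume "snd P > 0"
    then have "\<forall>\<^sub>F Q in nhds P. snd Q > 0"
      by (intro eventually_nhds_isCont_pos) (auto intro!: continuous_intros)
    then show ?thesis by eventually_elim (use out in blast)
  next
    assume "snd P < snd (BB \<kappa>)"
    then have "\<forall>\<^sub>F Q in nhds P. snd (BB \<kappa>) - snd Q > 0"
      by (intro eventually_nhds_isCont_pos) (auto intro!: continuous_intros)
    then show ?thesis by eventually_elim (use out in auto)
  qed
qed

text \<open>The two fields differ by \<open>\<kappa> i - \<kappa> (3 - i)\<close> times the position
  vector, so at the equilibrium of one field the other field is a multiple of
  \<open>(X, Y)\<close>.\<close>

lemma standard_nodal_if:
  assumes i: "i \<in> {1, 2}" and e: "excess \<kappa> i P = 0" and gb: "snd P \<noteq> snd (GB \<kappa> i)"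
    and out: "snd P > 0 \<or> snd P < snd (BB \<kappa>)" and nz: "snd P \<noteq> 0"
  shows "standard_nodal \<kappa> i P"
proof -
  let ?j = "3 - i" and ?p = "equil \<kappa> i P"
  define d where "d = \<kappa> i - \<kappa> ?j"
  define X where "X = 1 / (1 + \<kappa> i)"
  define Y where "Y = X + snd P"
  have k: "\<kappa> i > 0" "1 + \<kappa> i > 0" using \<kappa>_pos[OF i] by auto
  have X: "(1 + \<kappa> i) * X = 1" "X > 0" using k by (simp_all add: X_def)
  have d: "d \<noteq> 0" using i by (auto simp: d_def)
  have p: "?p = (X, Y)" using equil_sw_point(1)[OF i e] by (simp add: sw_point_def fst_equil X_def Y_def)
  have m: "fst P = \<kappa> i * Y" using excess_0_coords[OF i e] by (simp add: Y_def X_def add.commute)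
  have v: "vf \<kappa> ?j P ?p = (d * X, d * Y)"
    using X by (simp add: p vf_def split_beta m d_def algebra_simps)
  have t1: "vf \<kappa> ?j P ?p \<bullet> nvec \<noteq> 0"
    using d nz by (simp add: v nvec_def Y_def algebra_simps)
  \<comment> \<open>Preimage of the other field under the diagonal Jacobian, component by component.
    Its normal component is a nonzero multiple of the gap, so it vanishes only at
    \<open>GB \<kappa> i\<close>.\<close>
  let ?v = "(- (d * X) / (1 + \<kappa> i), - (d * Y) / \<kappa> i)"
  have t2: "frechet_derivative (vf \<kappa> i P) (at ?p) ?v = vf \<kappa> ?j P ?p"
  proof -
    have "- a * (- b / a) = b" if "a \<noteq> 0" for a b :: real using that by simp
    from this[of "1 + \<kappa> i" "d * X"] this[of "\<kappa> i" "d * Y"] show ?thesis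
      unfolding frechet_derivative_vf v fst_conv snd_conv using k by (simp only: less_imp_neq[symmetric] not_False_eq_True)
  qed
  have "?v \<bullet> nvec \<noteq> 0"
  proof
    assume "?v \<bullet> nvec = 0"
    then have "d * X / (1 + \<kappa> i) = d * Y / \<kappa> i" by (simp add: nvec_def)
    then have "d * (\<kappa> i * X - (1 + \<kappa> i) * Y) = 0" using k by (simp add: field_simps)
    then have "\<kappa> i * X = (1 + \<kappa> i) * Y" using d by simp
    then have "X + (1 + \<kappa> i) * snd P = 0" by (simp add: Y_def algebra_simps)
    then have "pseudo_gap i P = 0" by (simp add: pseudo_gap_def X_def)
    then show False using gb k by (simp add: pseudo_gap_GB[OF i])
  qed
  then have t3: "\<exists>v. frechet_derivative (vf \<kappa> i P) (at ?p) v = vf \<kappa> ?j P ?p \<and> v \<bullet> nvec \<noteq> 0"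
    using t2 by blast
  have eqn: "(\<lambda>Q. equil \<kappa> i Q \<bullet> nvec - snd Q) = (\<lambda>Q. fst Q * inverse (\<kappa> i) - X - snd Q)"
    by (simp add: fun_eq_iff equil_def nvec_def X_def divide_inverse)
  have "((\<lambda>Q. fst Q * inverse (\<kappa> i) - X - snd Q) has_derivative (\<lambda>v. fst v * inverse (\<kappa> i) - 0 - snd v)) (at P)"
    by (intro derivative_intros)
  moreover have "(\<lambda>v::real \<times> real. fst v * inverse (\<kappa> i) - 0 - snd v) \<noteq> (\<lambda>_. 0)"
    by (auto dest!: fun_cong[of _ _ "(0, 1)"])
  ultimately have t4: "\<exists>D. ((\<lambda>Q. equil \<kappa> i Q \<bullet> nvec - snd Q) has_derivative D) (at P) \<and> D \<noteq> (\<lambda>_. 0)"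
    unfolding eqn by blast
  have t5: "\<forall>\<^sub>F Q in nhds P. \<nexists>G. crossing_periodic_orbit \<kappa> Q G"
    using eventually_not_Gamma_region[OF out] by eventually_elim (use no_crossing_periodic_orbit in blast)
  show ?thesis unfolding standard_nodal_def
    using boundary_equilibrium_iff[OF i, of P] e node_equil[OF i] t1 t3 t4 t5 no_homoclinic_orbit[OF i e out] by blast
qed

end

section \<open>The bifurcation diagram\<close>

text \<open>A small ball meets the line in an interval of parameters. Removing its centre leaves two
  images of intervals, which are connected and separated by the sign of the parameter.\<close>

lemma divides_locally_line:
  fixes P v :: "real \<times> real"
  assumes v: "v \<noteq> 0" and C: "C = range (\<lambda>t. P + t *\<^sub>R v)" and c: "c > 0"
    and S: "S \<subseteq> C" "\<And>t. 0 < t \<Longrightarrow> t < c \<Longrightarrow> P + t *\<^sub>R v \<in> S" "\<And>t. P + t *\<^sub>R v \<in> S \<Longrightarrow> 0 < t"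
    and T: "T \<subseteq> C" "\<And>t. - c < t \<Longrightarrow> t < 0 \<Longrightarrow> P + t *\<^sub>R v \<in> T" "\<And>t. P + t *\<^sub>R v \<in> T \<Longrightarrow> t < 0"
  shows "divides_locally P C S T"
proof -
  define l where "l t = P + t *\<^sub>R v" for t
  note S = S[folded l_def] and T = T[folded l_def]
  have C: "C = range l" unfolding C l_def ..
  have nv: "norm v > 0" using v by simp
  have "S \<inter> ball P \<epsilon> \<noteq> T \<inter> ball P \<epsilon> \<and> components (C \<inter> ball P \<epsilon> - {P}) = {S \<inter> ball P \<epsilon>, T \<inter> ball P \<epsilon>}"
    if \<epsilon>: "0 < \<epsilon>" "\<epsilon> < c * norm v" for \<epsilon>
  proof -
    define r where "r = \<epsilon> / norm v"
    have r: "0 < r" "r < c" using \<epsilon> nv by (simp_all add: r_def pos_divide_less_eq)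
    have ball: "l t \<in> ball P \<epsilon> \<longleftrightarrow> \<bar>t\<bar> < r" for t
      using nv by (simp add: l_def r_def dist_norm pos_less_divide_eq)
    have l0: "l t = P \<longleftrightarrow> t = 0" for t using v by (simp add: l_def)
    define S' T' where "S' = l ` {0<..<r}" and "T' = l ` {-r<..<0}"
    have eqS: "S \<inter> ball P \<epsilon> = S'"
    proof
      show "S \<inter> ball P \<epsilon> \<subseteq> S'"
      proof
        fix z assume z: "z \<in> S \<inter> ball P \<epsilon>"
        then obtain t where t: "z = l t" using S(1) C by blast
        then show "z \<in> S'" using z S(3)[of t] ball[of t] unfolding S'_def by auto
      qed
      show "S' \<subseteq> S \<inter> ball P \<epsilon>" unfolding S'_def using S(2) ball r by (auto simp del: mem_ball)
    qed
    have eqT: "T \<inter> ball P \<epsilon> = T'"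
    proof
      show "T \<inter> ball P \<epsilon> \<subseteq> T'"
      proof
        fix z assume z: "z \<in> T \<inter> ball P \<epsilon>"
        then obtain t where t: "z = l t" using T(1) C by blast
        then show "z \<in> T'" using z T(3)[of t] ball[of t] unfolding T'_def by auto
      qed
      show "T' \<subseteq> T \<inter> ball P \<epsilon>" unfolding T'_def using T(2) ball r by (auto simp del: mem_ball)
    qed
    define U where "U = C \<inter> ball P \<epsilon> - {P}"
    have U: "U = S' \<union> T'"
    proof
      show "U \<subseteq> S' \<union> T'"
      proof
        fix z assume z: "z \<in> U"
        then obtain t where t: "z = l t" "\<bar>t\<bar> < r" "t \<noteq> 0" using ball l0 unfolding U_def C by blast
        then show "z \<in> S' \<union> T'" unfolding S'_def T'_def by (cases "t > 0") auto
      qed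
      show "S' \<union> T' \<subseteq> U"
      proof
        fix z assume "z \<in> S' \<union> T'"
        then obtain t where t: "z = l t" "\<bar>t\<bar> < r" "t \<noteq> 0" unfolding S'_def T'_def by auto
        then show "z \<in> U" using ball[of t] l0[of t] unfolding U_def C by blast
      qed
    qed
    \<comment> \<open>This functional recovers the parameter up to the factor
      \<open>v \<bullet> v\<close>, so the half-planes of its two signs are open sets separating the
      halves.\<close>
    define g where "g z = (z - P) \<bullet> v" for z
    have vv: "v \<bullet> v > 0" using v by simp
    have g: "g (l t) = t * (v \<bullet> v)" for t by (simp add: g_def l_def)
    have gS: "S' \<subseteq> {z. g z > 0}" unfolding S'_def using vv by (auto simp: g)
    have gT: "T' \<subseteq> {z. g z < 0}" unfolding T'_def using vv by (auto simp: g mult_neg_pos)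
    have op: "open {z. g z > 0}" "open {z. g z < 0}"
      unfolding g_def by (intro open_Collect_less continuous_intros)+
    have contl: "continuous_on A l" for A unfolding l_def[abs_def] by (intro continuous_intros)
    have conn: "connected S'" "connected T'"
      unfolding S'_def T'_def by (intro connected_continuous_image contl connected_Ioo)+
    have sep: "{z. g z > 0} \<inter> K = {} \<or> {z. g z < 0} \<inter> K = {}" if "connected K" "K \<subseteq> U" for K
    proof (rule connectedD[OF that(1) op])
      show "{z. 0 < g z} \<inter> {z. g z < 0} \<inter> K = {}" by auto
      show "K \<subseteq> {z. 0 < g z} \<union> {z. g z < 0}" using that(2) U gS gT by blast
    qed
    have compS: "connected_component_set U x = S'" if x: "x \<in> S'" for x
    proof
      show "S' \<subseteq> connected_component_set U x" by (rule connected_component_maximal[OF x conn(1)]) (simp add: U)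
      let ?K = "connected_component_set U x"
      have KU: "?K \<subseteq> U" by (rule connected_component_subset)
      have "x \<in> ?K" using x U by (auto intro: connected_component_refl)
      then have "{z. g z < 0} \<inter> ?K = {}" using sep[of ?K] KU gS x by auto
      then show "?K \<subseteq> S'" using KU U gT by blast
    qed
    have compT: "connected_component_set U x = T'" if x: "x \<in> T'" for x
    proof
      show "T' \<subseteq> connected_component_set U x" by (rule connected_component_maximal[OF x conn(2)]) (simp add: U)
      let ?K = "connected_component_set U x"
      have KU: "?K \<subseteq> U" by (rule connected_component_subset)
      have "x \<in> ?K" using x U by (auto intro: connected_component_refl)
      then have "{z. g z > 0} \<inter> ?K = {}" using sep[of ?K] KU gT x by auto
      then show "?K \<subseteq> T'" using KU U gS by blast
    qed
    have ne: "l (r / 2) \<in> S'" "l (- r / 2) \<in> T'" using r by (auto simp: S'_def T'_def)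
    have "components U = connected_component_set U ` S' \<union> connected_component_set U ` T'"
      unfolding components_def by (subst (2) U) (rule image_Un)
    also have "connected_component_set U ` S' = {S'}" using compS ne(1) by auto
    also have "connected_component_set U ` T' = {T'}" using compT ne(2) by auto
    finally have "components U = {S', T'}" by auto
    moreover have "S' \<noteq> T'" using ne gS gT by force
    ultimately show ?thesis unfolding eqS eqT U_def by blast
  qed
  then have "\<forall>\<^sub>F \<epsilon> in at_right 0. S \<inter> ball P \<epsilon> \<noteq> T \<inter> ball P \<epsilon> \<and>
      components (C \<inter> ball P \<epsilon> - {P}) = {S \<inter> ball P \<epsilon>, T \<inter> ball P \<epsilon>}"
    using eventually_at_right_0[of "c * norm v"] c nv by (auto elim!: eventually_mono)
  moreover have "P \<in> C" unfolding C l_def by (rule range_eqI[of _ _ 0]) simp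
  ultimately show ?thesis unfolding divides_locally_def by blast
qed

lemma divides_locally_sym: "divides_locally P C S T \<Longrightarrow> divides_locally P C T S"
  unfolding divides_locally_def by (simp add: insert_commute eq_commute)

context rates
begin

text \<open>The direction \<open>(\<kappa> i, 1)\<close> turns the parameter into the increment of
  the second coordinate, by which the segments are defined.\<close>

lemma BE_line:
  assumes i: "i \<in> {1, 2}" and P: "P \<in> BE \<kappa> i"
  shows "BE \<kappa> i = range (\<lambda>t. P + t *\<^sub>R (\<kappa> i, 1))"
proof -
  have k: "\<kappa> i \<noteq> 0" using \<kappa>_pos[OF i] by simp
  have coord: "Q \<in> BE \<kappa> i \<longleftrightarrow> fst Q = \<kappa> i * (snd Q + 1 / (1 + \<kappa> i))" for Q
  proof -
    have "Q \<in> BE \<kappa> i \<longleftrightarrow> snd Q + 1 / (1 + \<kappa> i) = fst Q / \<kappa> i" by (auto simp: BE_def split_beta)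
    also have "\<dots> \<longleftrightarrow> fst Q = \<kappa> i * (snd Q + 1 / (1 + \<kappa> i))" using k by (auto simp: nonzero_eq_divide_eq mult.commute)
    finally show ?thesis .
  qed
  show ?thesis
  proof
    show "BE \<kappa> i \<subseteq> range (\<lambda>t. P + t *\<^sub>R (\<kappa> i, 1))"
    proof
      fix Q assume "Q \<in> BE \<kappa> i"
      then have "Q = P + (snd Q - snd P) *\<^sub>R (\<kappa> i, 1)"
        using P unfolding coord by (simp add: prod_eq_iff algebra_simps)
      then show "Q \<in> range (\<lambda>t. P + t *\<^sub>R (\<kappa> i, 1))" by (rule range_eqI)
    qed
    show "range (\<lambda>t. P + t *\<^sub>R (\<kappa> i, 1)) \<subseteq> BE \<kappa> i"
      using P unfolding coord image_subset_iff by (simp add: algebra_simps)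
  qed
qed

text \<open>Division is a local matter: \<open>lo\<close> and \<open>hi\<close> mark a stretch
  around \<open>P\<close> on which the two segments are known to fill the line.\<close>

lemma BE_divides:
  assumes i: "i \<in> {1, 2}" and P: "P \<in> BE \<kappa> i" and lohi: "lo < snd P" "snd P < hi"
    and S: "S \<subseteq> BE \<kappa> i" "\<And>Q. Q \<in> BE \<kappa> i \<Longrightarrow> snd P < snd Q \<Longrightarrow> snd Q < hi \<Longrightarrow> Q \<in> S" "\<And>Q. Q \<in> S \<Longrightarrow> snd P < snd Q"
    and T: "T \<subseteq> BE \<kappa> i" "\<And>Q. Q \<in> BE \<kappa> i \<Longrightarrow> lo < snd Q \<Longrightarrow> snd Q < snd P \<Longrightarrow> Q \<in> T" "\<And>Q. Q \<in> T \<Longrightarrow> snd Q < snd P"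
  shows "divides_locally P (BE \<kappa> i) S T"
proof (rule divides_locally_line[OF _ BE_line[OF i P], of "min (hi - snd P) (snd P - lo)"])
  have mem: "P + t *\<^sub>R (\<kappa> i, 1) \<in> BE \<kappa> i" for t using BE_line[OF i P] by blast
  have snd_eq: "snd (P + t *\<^sub>R (\<kappa> i, 1)) = snd P + t" for t by simp
  show "(\<kappa> i, 1) \<noteq> (0 :: real \<times> real)" by (simp add: zero_prod_def)
  show "min (hi - snd P) (snd P - lo) > 0" using lohi by simp
  fix t
  show "P + t *\<^sub>R (\<kappa> i, 1) \<in> S" if "0 < t" "t < min (hi - snd P) (snd P - lo)"
    using that by (intro S(2) mem) auto
  show "P + t *\<^sub>R (\<kappa> i, 1) \<in> T" if "- min (hi - snd P) (snd P - lo) < t" "t < 0"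
    using that by (intro T(2) mem) auto
  show "0 < t" if "P + t *\<^sub>R (\<kappa> i, 1) \<in> S" using S(3)[OF that] by (simp only: snd_eq)
  show "t < 0" if "P + t *\<^sub>R (\<kappa> i, 1) \<in> T" using T(3)[OF that] by (simp only: snd_eq)
qed (use S T in auto)

lemma FF_divides:
  assumes P: "P \<in> FF" and lohi: "lo < fst P" "fst P < hi"
    and S: "S \<subseteq> FF" "\<And>Q. Q \<in> FF \<Longrightarrow> fst P < fst Q \<Longrightarrow> fst Q < hi \<Longrightarrow> Q \<in> S" "\<And>Q. Q \<in> S \<Longrightarrow> fst P < fst Q"
    and T: "T \<subseteq> FF" "\<And>Q. Q \<in> FF \<Longrightarrow> lo < fst Q \<Longrightarrow> fst Q < fst P \<Longrightarrow> Q \<in> T" "\<And>Q. Q \<in> T \<Longrightarrow> fst Q < fst P"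
  shows "divides_locally P FF S T"
proof (rule divides_locally_line[of "(1, 0)" FF P "min (hi - fst P) (fst P - lo)"])
  have FF_iff: "Q \<in> FF \<longleftrightarrow> snd Q = 0" for Q by (cases Q) (simp add: FF_def)
  have mem: "P + t *\<^sub>R (1, 0) \<in> FF" for t using P by (simp add: FF_iff)
  show "FF = range (\<lambda>t. P + t *\<^sub>R (1, 0))"
  proof
    show "FF \<subseteq> range (\<lambda>t. P + t *\<^sub>R (1, 0))"
    proof
      fix Q assume "Q \<in> FF"
      then have "Q = P + (fst Q - fst P) *\<^sub>R (1, 0)" using P by (simp add: FF_iff prod_eq_iff)
      then show "Q \<in> range (\<lambda>t. P + t *\<^sub>R (1, 0))" by (rule range_eqI)
    qed
    show "range (\<lambda>t. P + t *\<^sub>R (1, 0)) \<subseteq> FF" using mem by blast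
  qed
  have fst_eq: "fst (P + t *\<^sub>R (1, 0)) = fst P + t" for t by simp
  show "(1, 0) \<noteq> (0 :: real \<times> real)" by (simp add: zero_prod_def)
  show "min (hi - fst P) (fst P - lo) > 0" using lohi by simp
  fix t
  show "P + t *\<^sub>R (1, 0) \<in> S" if "0 < t" "t < min (hi - fst P) (fst P - lo)"
    using that by (intro S(2) mem) auto
  show "P + t *\<^sub>R (1, 0) \<in> T" if "- min (hi - fst P) (fst P - lo) < t" "t < 0"
    using that by (intro T(2) mem) auto
  show "0 < t" if "P + t *\<^sub>R (1, 0) \<in> S" using S(3)[OF that] by (simp only: fst_eq)
  show "t < 0" if "P + t *\<^sub>R (1, 0) \<in> T" using T(3)[OF that] by (simp only: fst_eq)
qed (use S T in auto)

lemma FB_BE: "i \<in> {1, 2} \<Longrightarrow> FB \<kappa> i \<in> BE \<kappa> i"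
  by (auto simp: FB_def BE_def)

lemma BB_BE: "i \<in> {1, 2} \<Longrightarrow> BB \<kappa> \<in> BE \<kappa> i"
proof -
  have "a * b / ((a + 1) * (b + 1)) / a - 1 / (1 + a) = - 1 / ((a + 1) * (b + 1))"
    if "a > 0" "b > 0" for a b :: real
  proof -
    have "a + 1 \<noteq> 0" "b + 1 \<noteq> 0" "1 + a \<noteq> 0" using that by auto
    then show ?thesis using that by (simp add: divide_simps) (simp add: algebra_simps)
  qed
  from this[of "\<kappa> 1" "\<kappa> 2"] this[of "\<kappa> 2" "\<kappa> 1"]
  show "i \<in> {1, 2} \<Longrightarrow> BB \<kappa> \<in> BE \<kappa> i" by (auto simp: BB_def BE_def mult.commute)
qed

lemma GB_BE: "i \<in> {1, 2} \<Longrightarrow> GB \<kappa> i \<in> BE \<kappa> i"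
proof -
  have *: "a\<^sup>2 / (a + 1)\<^sup>2 / a - 1 / (1 + a) = - (1 / (a + 1)\<^sup>2)" if "a > 0" for a :: real
  proof -
    have "a + 1 \<noteq> 0" "1 + a \<noteq> 0" using that by auto
    then show ?thesis using that by (simp add: divide_simps power2_eq_square) (simp add: algebra_simps)
  qed
  show "i \<in> {1, 2} \<Longrightarrow> GB \<kappa> i \<in> BE \<kappa> i"
    using *[OF \<kappa>_pos[of i]] by (auto simp: GB_def BE_def)
qed

lemma snd_order: "snd (GB \<kappa> 1) < snd (BB \<kappa>)" "snd (BB \<kappa>) < snd (GB \<kappa> 2)" "snd (GB \<kappa> 2) < 0"
proof -
  define a b where "a = \<kappa> 1 + 1" and "b = \<kappa> 2 + 1"
  have ab: "0 < a" "a < b" "0 < b" using \<kappa>1 \<kappa>12 unfolding a_def b_def by linarith+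
  have "a * a < a * b" "a * b < b * b" using ab by simp_all
  moreover have "0 < a * a" "0 < a * b" "0 < b * b" using ab by simp_all
  ultimately have "1 / (a * b) < 1 / (a * a)" "1 / (b * b) < 1 / (a * b)" "0 < 1 / (b * b)"
    by (simp_all add: frac_less2)
  then show "snd (GB \<kappa> 1) < snd (BB \<kappa>)" "snd (BB \<kappa>) < snd (GB \<kappa> 2)" "snd (GB \<kappa> 2) < 0"
    by (simp_all add: GB_def BB_def power2_eq_square flip: a_def b_def)
qed

lemma FB_order: "\<kappa> 1 / (1 + \<kappa> 1) < \<kappa> 2 / (1 + \<kappa> 2)"
proof -
  have "\<kappa> i / (1 + \<kappa> i) = 1 - 1 / (1 + \<kappa> i)" if "i \<in> {1, 2}" for i
    using \<kappa>_pos[OF that] by (simp add: field_simps)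
  from this[of 1] this[of 2] show ?thesis using spread_pos by (simp add: spread_def)
qed

lemma FF_excess:
  assumes "i \<in> {1, 2}" "P \<in> FF"
  shows "\<kappa> i * excess \<kappa> i P = side i * (\<kappa> i / (1 + \<kappa> i) - fst P)"
proof -
  have "snd P = 0" using assms(2) by (auto simp: FF_def)
  then show ?thesis using \<kappa>_pos[OF assms(1)] by (simp add: excess_eq algebra_simps)
qed

lemma excess_sign_mult:
  assumes "i \<in> {1, 2}"
  shows "excess \<kappa> i P > 0 \<longleftrightarrow> \<kappa> i * excess \<kappa> i P > 0" "excess \<kappa> i P < 0 \<longleftrightarrow> \<kappa> i * excess \<kappa> i P < 0"
  using \<kappa>_pos[OF assms] by (simp_all add: zero_less_mult_iff mult_less_0_iff)

lemma FF1_excess: "P \<in> FF1 \<kappa> \<Longrightarrow> excess \<kappa> 1 P < 0 \<and> excess \<kappa> 2 P > 0"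
  using FF_excess[of 1 P] FF_excess[of 2 P] FB_order excess_sign_mult[of 1 P] excess_sign_mult[of 2 P]
  by (simp add: FF1_def)

lemma FF2_excess: "P \<in> FF2 \<kappa> \<Longrightarrow> excess \<kappa> 1 P > 0 \<and> excess \<kappa> 2 P < 0"
  using FF_excess[of 1 P] FF_excess[of 2 P] FB_order excess_sign_mult[of 1 P] excess_sign_mult[of 2 P]
  by (simp add: FF2_def)

lemma FU_excess: "P \<in> FU \<kappa> \<Longrightarrow> excess \<kappa> 1 P > 0 \<and> excess \<kappa> 2 P > 0"
  using FF_excess[of 1 P] FF_excess[of 2 P] excess_sign_mult[of 1 P] excess_sign_mult[of 2 P]
  by (simp add: FU_def FB_def)

lemma FF_snd: "P \<in> FF \<Longrightarrow> snd P = 0"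
  by (auto simp: FF_def)

lemma Gamma_disappears_BE:
  assumes i: "i \<in> {1, 2}" and "P \<in> BE \<kappa> i" "snd (BB \<kappa>) < snd P" "snd P < 0"
  shows "Gamma_disappears \<kappa> P"
proof -
  have e: "excess \<kappa> i P = 0" using assms(2) BE_excess[OF i] by simp
  have "excess \<kappa> (3 - i) P > 0" using excess_other_sign(1)[OF i e] assms(3) by simp
  then have "excess \<kappa> 1 P \<ge> 0" "excess \<kappa> 2 P \<ge> 0" "P \<notin> Gamma_region \<kappa>"
    using e i by (auto simp: Gamma_region_iff)
  then show ?thesis using assms(4) by (intro Gamma_disappears_if_frontier frontier_Gamma_region) auto
qed

text \<open>The denominator of the sliding weight is a multiple of \<open>snd Q\<close> by
  \<open>tangency_diff\<close>; multiplying by \<open>snd Q\<close> leaves the quadratic of the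
  pseudo-equilibria.\<close>

lemma sliding_speed_eq:
  assumes "snd Q \<noteq> 0"
  shows "sliding_speed \<kappa> Q x = - (x\<^sup>2 - (1 - fst Q - snd Q) * x - snd Q) / snd Q"
proof -
  let ?z = "(x, x + snd Q)"
  define t1 where "t1 = fst (tangency \<kappa> 1 Q)"
  have z: "?z \<in> switching Q" by (simp add: switching_iff height_def)
  define w where "w = sliding_weight \<kappa> Q ?z"
  define D where "D = (\<kappa> 2 - \<kappa> 1) * snd Q"
  have D: "D \<noteq> 0" using assms by (simp add: D_def)
  have "w = (x - t1) / D"
    using tangency_diff[of Q] unfolding w_def sliding_weight_def inner_diff_left vf_nvec_switching[OF z] t1_def D_def by simp
  then have wD: "w * D = x - t1" using D by simp
  have f: "fst (vf \<kappa> i Q z) = 1 - (1 + \<kappa> i) * fst z" for i z by (simp add: vf_def split_beta)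
  have ss: "sliding_speed \<kappa> Q x = (1 - w) * (1 - (1 + \<kappa> 1) * x) + w * (1 - (1 + \<kappa> 2) * x)"
    unfolding sliding_speed_def sliding_vf_def w_def[symmetric] by (simp add: f)
  have "snd Q * sliding_speed \<kappa> Q x = snd Q * (1 - (1 + \<kappa> 1) * x) - (w * D) * x"
    unfolding ss by (simp add: D_def algebra_simps)
  also have "\<dots> = - (x\<^sup>2 - (1 - fst Q - snd Q) * x - snd Q)"
    unfolding wD t1_def fst_tangency by (simp add: power2_eq_square algebra_simps)
  finally show ?thesis using assms by (simp add: nonzero_eq_divide_eq mult.commute)
qed

text \<open>At its roots a monic quadratic has the derivatives plus and minus the root of its
  discriminant, whence the opposite stability of the two pseudo-equilibria.\<close>

lemma deriv_sliding_speed: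
  assumes "snd Q \<noteq> 0"
  shows "deriv (sliding_speed \<kappa> Q) (fst (pseudo_eq s Q)) = - (s * sqrt (discr Q)) / snd Q"
proof -
  have "((\<lambda>x. - (x\<^sup>2 - (1 - fst Q - snd Q) * x - snd Q) / snd Q) has_real_derivative
      - (2 * x - (1 - fst Q - snd Q)) / snd Q) (at x)" for x
    by (auto intro!: derivative_eq_intros simp: assms)
  then have d: "deriv (sliding_speed \<kappa> Q) x = - (2 * x - (1 - fst Q - snd Q)) / snd Q" for x
    using sliding_speed_eq[OF assms] by (intro DERIV_imp_deriv) (simp add: sliding_speed_eq[OF assms, abs_def])
  have "2 * fst (pseudo_eq s Q) - (1 - fst Q - snd Q) = s * sqrt (discr Q)"
  proof -
    have "2 * (1 / 2 * (b + c)) - b = c" for b c :: real by (simp add: field_simps)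
    then show ?thesis unfolding pseudo_eq_eq fst_conv .
  qed
  then show ?thesis unfolding d by (simp only:)
qed

lemma generalised_boundary_equilibrium_GB:
  assumes i: "i \<in> {1, 2}"
  shows "generalised_boundary_equilibrium \<kappa> i (GB \<kappa> i)"
proof -
  let ?P = "GB \<kappa> i" and ?z = "tangency \<kappa> i (GB \<kappa> i)"
  have e: "excess \<kappa> i ?P = 0" using GB_BE[OF i] BE_excess[OF i] by simp
  have gap: "pseudo_gap i ?P = 0" by (simp add: pseudo_gap_GB[OF i])
  have d0: "discr ?P = 0" using discr_boundary(1)[OF i e] gap by simp
  have nz: "snd ?P \<noteq> 0" using snd_order i by auto
  have pe: "pseudo_eq 1 ?P = ?z" "pseudo_eq (-1) ?P = ?z"
    using pseudo_eq_boundary(1)[OF i e] gap by simp_all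
  \<comment> \<open>The discriminant vanishes at \<open>GB \<kappa> i\<close>; varying only the
    second parameter leaves a linear and a quadratic term in \<open>t * c\<close>.\<close>
  have move: "discr (?P + t *\<^sub>R (0, c)) = t * c * (2 * (snd ?P + fst ?P + 1) + t * c)" for t c
  proof -
    have "discr (?P + t *\<^sub>R (0, c)) = discr ?P + t * c * (2 * (snd ?P + fst ?P + 1) + t * c)"
      by (simp add: discr_def split_beta power2_eq_square algebra_simps)
    then show ?thesis using d0 by simp
  qed
  \<comment> \<open>Derivative of the discriminant in the second parameter. It also bounds the
    downward steps for which the quadratic term cannot reverse the sign.\<close>
  define a where "a = 2 * (snd ?P + fst ?P + 1)"
  have k: "\<kappa> i > 0" using \<kappa>_pos[OF i] .
  have a: "a > 0"
  proof -
    have "(\<kappa> i + 1)\<^sup>2 > 1" using k by (simp add: one_less_power)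
    then have "1 / (\<kappa> i + 1)\<^sup>2 < 1" by (simp add: divide_less_eq)
    moreover have "fst ?P > 0" using k by (simp add: GB_def)
    ultimately show ?thesis by (simp add: a_def GB_def)
  qed
  have v: "(0, 1) \<noteq> (0 :: real \<times> real)" "(0, - 1) \<noteq> (0 :: real \<times> real)" by (simp_all add: zero_prod_def)
  have neg: "\<exists>\<^sub>F Q in at ?P. discr Q < 0"
  proof (rule frequently_at_line[OF v(2)])
    show "\<forall>\<^sub>F t in at_right 0. discr (?P + t *\<^sub>R (0, - 1)) < 0"
      using eventually_at_right_0[OF a]
      by eventually_elim (unfold move, fold a_def, auto simp: mult_neg_pos)
  qed
  have pos: "\<exists>\<^sub>F Q in at ?P. discr Q > 0"
  proof (rule frequently_at_line[OF v(1)])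
    show "\<forall>\<^sub>F t in at_right 0. discr (?P + t *\<^sub>R (0, 1)) > 0"
      using eventually_at_right_0[OF a]
      by eventually_elim (unfold move, fold a_def, use a in simp)
  qed
  have near: "\<forall>\<^sub>F Q in at ?P. (discr Q < 0 \<longrightarrow> {w \<in> ball ?z \<epsilon>. pseudo_equilibrium \<kappa> Q w} = {}) \<and>
        (discr Q > 0 \<longrightarrow>
           {w \<in> ball ?z \<epsilon>. pseudo_equilibrium \<kappa> Q w} = {pseudo_eq 1 Q, pseudo_eq (-1) Q} \<and>
           pseudo_eq 1 Q \<noteq> pseudo_eq (-1) Q \<and>
           deriv (sliding_speed \<kappa> Q) (fst (pseudo_eq 1 Q)) *
             deriv (sliding_speed \<kappa> Q) (fst (pseudo_eq (-1) Q)) < 0)" if "\<epsilon> > 0" for \<epsilon>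
  proof -
    have b: "\<forall>\<^sub>F Q in at ?P. pseudo_eq s Q \<in> ball ?z \<epsilon>" if "pseudo_eq s ?P = ?z" for s
    proof -
      have "(pseudo_eq s \<longlongrightarrow> ?z) (at ?P)" using isCont_pseudo_eq[of ?P s] that by (simp add: isCont_def)
      from tendstoD[OF this \<open>\<epsilon> > 0\<close>] show ?thesis by (simp add: dist_commute)
    qed
    have "(snd \<longlongrightarrow> snd ?P) (at ?P)" by (intro tendsto_intros)
    then have n: "\<forall>\<^sub>F Q in at ?P. snd Q \<noteq> 0" using nz by (rule tendsto_imp_eventually_ne)
    show ?thesis using b[OF pe(1)] b[OF pe(2)] n
    proof eventually_elim
      case (elim Q)
      note iff = pseudo_equilibrium_iff[of \<kappa> Q, OF \<kappa>1_pos(3) elim(3)]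
      have "deriv (sliding_speed \<kappa> Q) (fst (pseudo_eq 1 Q)) * deriv (sliding_speed \<kappa> Q) (fst (pseudo_eq (-1) Q)) < 0"
        and "pseudo_eq 1 Q \<noteq> pseudo_eq (-1) Q" if "discr Q > 0"
      proof -
        define q where "q = sqrt (discr Q)"
        have q: "q > 0" using that by (simp add: q_def)
        have "- (1 * q) / snd Q * (- (- 1 * q) / snd Q) = - (q / snd Q)\<^sup>2" by (simp add: power2_eq_square)
        also have "\<dots> < 0" using q elim(3) by simp
        finally show "deriv (sliding_speed \<kappa> Q) (fst (pseudo_eq 1 Q)) * deriv (sliding_speed \<kappa> Q) (fst (pseudo_eq (-1) Q)) < 0"
          unfolding deriv_sliding_speed[OF elim(3)] q_def .
        show "pseudo_eq 1 Q \<noteq> pseudo_eq (-1) Q" using q by (simp add: pseudo_eq_eq flip: q_def)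
      qed
      then show ?case using elim(1,2) by (auto simp: iff simp del: mem_ball)
    qed
  qed
  have "pseudo_equilibrium \<kappa> ?P ?z"
    using pseudo_equilibrium_iff[of \<kappa> ?P ?z, OF \<kappa>1_pos(3) nz] d0 pe(1) by simp
  then show ?thesis
    unfolding generalised_boundary_equilibrium_def pseudo_saddle_node_def
    using pe neg pos near boundary_equilibrium_iff[OF i, of ?P] e by blast
qed

text \<open>The curve is an injective continuous image of an open interval. The compact image of the
  closed interval is its closure, and the added points are the images of the two ends.\<close>

lemma PS_boundary: "closure (PS \<kappa>) - PS \<kappa> = {GB \<kappa> 1, GB \<kappa> 2}" "GB \<kappa> 1 \<noteq> GB \<kappa> 2"
proof -
  define m where "m i = (\<kappa> i)\<^sup>2 / (\<kappa> i + 1)\<^sup>2" for i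
  define g where "g \<mu> = (\<mu>, - (\<mu> + 1) + 2 * sqrt \<mu>)" for \<mu> :: real
  have sq: "m i = (\<kappa> i / (1 + \<kappa> i))\<^sup>2" for i by (simp add: m_def power_divide add.commute)
  have gm: "g (m i) = GB \<kappa> i" if i: "i \<in> {1, 2}" for i
  proof -
    define y where "y = \<kappa> i / (1 + \<kappa> i)"
    have k: "\<kappa> i > 0" using \<kappa>_pos[OF i] .
    have y: "y \<ge> 0" "1 - y = 1 / (\<kappa> i + 1)" using k by (simp_all add: y_def field_simps)
    \<comment> \<open>With \<open>m i\<close> the square of \<open>y\<close> the ordinate is minus a
      perfect square, whose base is \<open>1 / (\<kappa> i + 1)\<close>.\<close>
    have "- (m i + 1) + 2 * sqrt (m i) = - ((1 - y)\<^sup>2)"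
      unfolding sq y_def[symmetric] using y(1) by (simp add: power2_eq_square algebra_simps)
    also have "\<dots> = - (1 / (\<kappa> i + 1)\<^sup>2)" unfolding y(2) by (simp add: power_divide)
    finally show ?thesis by (simp add: g_def GB_def m_def)
  qed
  have "0 \<le> \<kappa> 1 / (1 + \<kappa> 1)" using \<kappa>1 by (intro divide_nonneg_pos; linarith)
  then have m12: "m 1 < m 2" unfolding sq using FB_order by (intro power_strict_mono) auto
  have PS: "PS \<kappa> = g ` {m 1<..<m 2}" by (auto simp: PS_def g_def m_def image_iff)
  have cont: "continuous_on A g" for A unfolding g_def[abs_def] by (intro continuous_intros)
  have clo: "closure {m 1<..<m 2} = {m 1..m 2}" using m12 by simp
  have "closure (PS \<kappa>) = g ` {m 1..m 2}"
  proof
    have "closed (g ` {m 1..m 2})"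
      by (intro compact_imp_closed compact_continuous_image cont compact_Icc)
    then show "closure (PS \<kappa>) \<subseteq> g ` {m 1..m 2}" unfolding PS by (intro closure_minimal) auto
    show "g ` {m 1..m 2} \<subseteq> closure (PS \<kappa>)"
      unfolding clo[symmetric] PS by (intro image_closure_subset cont closed_closure closure_subset)
  qed
  moreover have "inj g" by (auto simp: inj_def g_def)
  ultimately have "closure (PS \<kappa>) - PS \<kappa> = g ` ({m 1..m 2} - {m 1<..<m 2})"
    unfolding PS by (simp add: image_set_diff)
  also have "{m 1..m 2} - {m 1<..<m 2} = {m 1, m 2}" using m12 by auto
  finally show "closure (PS \<kappa>) - PS \<kappa> = {GB \<kappa> 1, GB \<kappa> 2}" using gm[of 1] gm[of 2] by simp
  show "GB \<kappa> 1 \<noteq> GB \<kappa> 2" using snd_order by auto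
qed

end

theorem proposition4:
  fixes \<kappa> :: "nat \<Rightarrow> real"
  assumes "0 < \<kappa> 1" and "\<kappa> 1 < \<kappa> 2"
  shows
    "((\<forall>i\<in>{1, 2}. FF \<inter> BE \<kappa> i = {FB \<kappa> i} \<and> fold_boundary_equilibrium \<kappa> i (FB \<kappa> i)) \<and>
      divides_locally (FB \<kappa> 1) FF (FF1 \<kappa>) (FU \<kappa>) \<and>
      divides_locally (FB \<kappa> 2) FF (FU \<kappa>) (FF2 \<kappa>) \<and>
      (\<forall>P\<in>FF1 \<kappa> \<union> FF2 \<kappa>. fold_fold_VI1 \<kappa> P \<and> sliding_reversal \<kappa> P) \<and>
      (\<forall>P\<in>FU \<kappa>. fused_focus \<kappa> P \<and> Gamma_disappears \<kappa> P \<and> sliding_reversal \<kappa> P) \<and>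
      (\<forall>i\<in>{1, 2}. divides_locally (FB \<kappa> i) (BE \<kappa> i) (BE_P \<kappa> i) (BE_hat_P \<kappa> i) \<and>
         (\<forall>P\<in>BE_P \<kappa> i. persistence \<kappa> i P \<and> standard_nodal \<kappa> i P) \<and>
         (\<forall>P\<in>BE_hat_P \<kappa> i. persistence \<kappa> i P \<and> homoclinic_like \<kappa> i P \<and> Gamma_disappears \<kappa> P)))
     \<and>
     (BE \<kappa> 1 \<inter> BE \<kappa> 2 = {BB \<kappa>} \<and>
      double_boundary_equilibrium \<kappa> (BB \<kappa>) \<and>
      tangency \<kappa> 1 (BB \<kappa>) \<noteq> tangency \<kappa> 2 (BB \<kappa>) \<and>
      (\<forall>i\<in>{1, 2}. collides_with_quadratic_tangency \<kappa> i (BB \<kappa>)) \<and>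
      divides_locally (BB \<kappa>) (BE \<kappa> 1) (BE_hat_P \<kappa> 1) (BE1_tilde_P \<kappa>) \<and>
      (\<forall>P\<in>BE_hat_P \<kappa> 1. persistence \<kappa> 1 P \<and> Gamma_disappears \<kappa> P) \<and>
      (\<forall>P\<in>BE1_tilde_P \<kappa>. persistence \<kappa> 1 P \<and> standard_nodal \<kappa> 1 P) \<and>
      divides_locally (BB \<kappa>) (BE \<kappa> 2) (BE2_hat_F \<kappa>) (BE2_F \<kappa>) \<and>
      (\<forall>P\<in>BE2_hat_F \<kappa>. nonsmooth_fold \<kappa> 2 P \<and> Gamma_disappears \<kappa> P) \<and>
      (\<forall>P\<in>BE2_F \<kappa>. nonsmooth_fold \<kappa> 2 P \<and> standard_nodal \<kappa> 2 P))
     \<and>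
     (closure (PS \<kappa>) - PS \<kappa> = {GB \<kappa> 1, GB \<kappa> 2} \<and> GB \<kappa> 1 \<noteq> GB \<kappa> 2 \<and>
      (\<forall>i\<in>{1, 2}. GB \<kappa> i \<in> BE \<kappa> i \<and> collides_with_quadratic_tangency \<kappa> i (GB \<kappa> i) \<and>
         generalised_boundary_equilibrium \<kappa> i (GB \<kappa> i)) \<and>
      divides_locally (GB \<kappa> 1) (BE \<kappa> 1) (BE1_tilde_P \<kappa>) (BE1_F \<kappa>) \<and>
      (\<forall>P\<in>BE1_tilde_P \<kappa>. persistence \<kappa> 1 P) \<and>
      (\<forall>P\<in>BE1_F \<kappa>. nonsmooth_fold \<kappa> 1 P) \<and>
      divides_locally (GB \<kappa> 2) (BE \<kappa> 2) (BE_hat_P \<kappa> 2) (BE2_hat_F \<kappa>) \<and>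
      (\<forall>P\<in>BE_hat_P \<kappa> 2. persistence \<kappa> 2 P) \<and>
      (\<forall>P\<in>BE2_hat_F \<kappa>. nonsmooth_fold \<kappa> 2 P))"
proof -
  interpret rates \<kappa> by unfold_locales (fact assms)+
  note ord = snd_order
  have snd_FB: "snd (FB \<kappa> i) = 0" "FB \<kappa> i \<in> FF" for i by (simp_all add: FB_def FF_def)
  have FFe: "excess \<kappa> 1 P \<noteq> 0 \<Longrightarrow> excess \<kappa> 2 P \<noteq> 0 \<Longrightarrow> P \<in> FF \<Longrightarrow> sliding_reversal \<kappa> P" for P
    using sliding_reversal_if FF_snd by blast
  have FF_sub: "FF1 \<kappa> \<subseteq> FF" "FU \<kappa> \<subseteq> FF" "FF2 \<kappa> \<subseteq> FF" by (auto simp: FF1_def FU_def FF2_def)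
  have BE_fixed: "excess \<kappa> i P = 0" if "i \<in> {1, 2}" "P \<in> BE \<kappa> i" for i P using BE_excess that by blast
  have BE_eq: "P = Q" if i: "i \<in> {1, 2}" and "P \<in> BE \<kappa> i" "Q \<in> BE \<kappa> i" "snd P = snd Q" for i P Q
    using excess_0_coords[OF i BE_fixed[OF i that(2)]] excess_0_coords[OF i BE_fixed[OF i that(3)]] that(4)
    by (simp add: prod_eq_iff)
  have A1: "FF \<inter> BE \<kappa> i = {FB \<kappa> i} \<and> fold_boundary_equilibrium \<kappa> i (FB \<kappa> i)" if i: "i \<in> {1, 2}" for i
  proof
    show "FF \<inter> BE \<kappa> i = {FB \<kappa> i}"
      using FB_BE[OF i] snd_FB BE_eq[OF i _ FB_BE[OF i]] FF_snd by fastforce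
    show "fold_boundary_equilibrium \<kappa> i (FB \<kappa> i)"
      using FF_iff[of \<kappa> "FB \<kappa> i"] snd_FB boundary_equilibrium_iff[OF i] BE_fixed[OF i FB_BE[OF i]]
      by (simp add: fold_boundary_equilibrium_def boundary_equilibrium_def)
  qed
  \<comment> \<open>The segment \<open>FF1 \<kappa>\<close> is unbounded to the left, so the lower
    end is an arbitrary number below \<open>FB \<kappa> 1\<close>; the upper end is where
    \<open>FU \<kappa>\<close> stops.\<close>
  have A2: "divides_locally (FB \<kappa> 1) FF (FF1 \<kappa>) (FU \<kappa>)"
    by (rule divides_locally_sym, rule FF_divides[OF snd_FB(2), of "fst (FB \<kappa> 1) - 1" _ "fst (FB \<kappa> 2)"])
       (use FB_order in \<open>auto simp: FF1_def FU_def FB_def\<close>)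
  have A3: "divides_locally (FB \<kappa> 2) FF (FU \<kappa>) (FF2 \<kappa>)"
    by (rule divides_locally_sym, rule FF_divides[OF snd_FB(2), of "fst (FB \<kappa> 1)" _ "fst (FB \<kappa> 2) + 1"])
       (use FB_order in \<open>auto simp: FF2_def FU_def FB_def\<close>)
  have A4: "fold_fold_VI1 \<kappa> P \<and> sliding_reversal \<kappa> P" if "P \<in> FF1 \<kappa> \<union> FF2 \<kappa>" for P
  proof -
    have P: "P \<in> FF" and s: "excess \<kappa> 1 P * excess \<kappa> 2 P < 0"
      using that FF_sub FF1_excess[of P] FF2_excess[of P] by (auto simp: mult_less_0_iff)
    have "excess \<kappa> 1 P \<noteq> 0" "excess \<kappa> 2 P \<noteq> 0" using s by auto
    then show ?thesis using fold_fold_VI1_if[OF P s] FFe P by blast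
  qed
  have A5: "fused_focus \<kappa> P \<and> Gamma_disappears \<kappa> P \<and> sliding_reversal \<kappa> P" if "P \<in> FU \<kappa>" for P
  proof (intro conjI)
    have P: "P \<in> FF" using that FF_sub by blast
    then have "snd P = 0" by (rule FF_snd)
    note P = P this
    have e: "excess \<kappa> 1 P > 0" "excess \<kappa> 2 P > 0" using FU_excess[OF that] by auto
    show "fused_focus \<kappa> P" using fused_focus_if P e by blast
    show "Gamma_disappears \<kappa> P"
      using e P by (intro Gamma_disappears_if_frontier frontier_Gamma_region) (auto simp: Gamma_region_iff)
    show "sliding_reversal \<kappa> P" by (rule FFe) (use e P in auto)
  qed
  have A6: "divides_locally (FB \<kappa> i) (BE \<kappa> i) (BE_P \<kappa> i) (BE_hat_P \<kappa> i)" if i: "i \<in> {1, 2}" for i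
  \<comment> \<open>\<open>BE_P\<close> is unbounded upward, which makes the upper end 1 an
    arbitrary choice; the lower end is that of \<open>BE_hat_P\<close>.\<close>
  proof (rule BE_divides[OF i FB_BE[OF i], of "snd (if i = 1 then BB \<kappa> else GB \<kappa> 2)" 1])
  qed (use ord in \<open>auto simp: BE_P_def BE_hat_P_def snd_FB split: if_splits\<close>)
  have A7: "persistence \<kappa> i P \<and> standard_nodal \<kappa> i P" if i: "i \<in> {1, 2}" and P: "P \<in> BE_P \<kappa> i" for i P
  proof -
    have e: "excess \<kappa> i P = 0" and pos: "snd P > 0" using P BE_fixed[OF i, of P] by (auto simp: BE_P_def)
    have "snd (GB \<kappa> i) < 0" using i ord by auto
    then have gt: "snd (GB \<kappa> i) < snd P" and nz: "snd P \<noteq> 0" and neq: "snd P \<noteq> snd (GB \<kappa> i)"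
      using pos by linarith+
    show ?thesis
      using persistence_if[OF i e nz gt] standard_nodal_if[OF i e neq disjI1[OF pos] nz] by blast
  qed
  have A8: "persistence \<kappa> i P \<and> homoclinic_like \<kappa> i P \<and> Gamma_disappears \<kappa> P" if i: "i \<in> {1, 2}" and P: "P \<in> BE_hat_P \<kappa> i" for i P
  proof -
    \<comment> \<open>The lower end of this segment is \<open>BB \<kappa>\<close> on the first line
      and \<open>GB \<kappa> 2\<close> on the second, in either case the higher of
      \<open>BB \<kappa>\<close> and \<open>GB \<kappa> i\<close>.\<close>
    have B: "P \<in> BE \<kappa> i" and neg: "snd P < 0" and gt: "snd (GB \<kappa> i) < snd P" "snd (BB \<kappa>) < snd P"
      using i P ord by (auto simp: BE_hat_P_def snd_FB)
    note e = BE_fixed[OF i B]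
    have nz: "snd P \<noteq> 0" using neg by simp
    show ?thesis
      using persistence_if[OF i e nz gt(1)] homoclinic_like_if[OF i e gt(2) neg] Gamma_disappears_BE[OF i B gt(2) neg]
      by blast
  qed
  have B1: "BE \<kappa> 1 \<inter> BE \<kappa> 2 = {BB \<kappa>}"
  proof -
    have "P = BB \<kappa>" if P: "P \<in> BE \<kappa> 1" "P \<in> BE \<kappa> 2" for P
    proof -
      \<comment> \<open>On both lines both excesses vanish, so \<open>excess_other\<close> leaves
        only the height of \<open>BB \<kappa>\<close>.\<close>
      have "(\<kappa> 2 - \<kappa> 1) * (snd P - snd (BB \<kappa>)) = 0"
        using excess_other(1)[of 1 P] BE_fixed[of 1 P] BE_fixed[of 2 P] P by simp
      then show ?thesis using BE_eq[of 1 P "BB \<kappa>"] P BB_BE[of 1] by simp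
    qed
    moreover have "BB \<kappa> \<in> BE \<kappa> 1" "BB \<kappa> \<in> BE \<kappa> 2" using BB_BE by simp_all
    ultimately show ?thesis by blast
  qed
  have BBe: "excess \<kappa> i (BB \<kappa>) = 0" if "i \<in> {1, 2}" for i using BE_fixed[OF that BB_BE[OF that]] .
  have GBe: "excess \<kappa> i (GB \<kappa> i) = 0" if "i \<in> {1, 2}" for i using BE_fixed[OF that GB_BE[OF that]] .
  have B2: "double_boundary_equilibrium \<kappa> (BB \<kappa>)"
  proof -
    have "equil \<kappa> 1 (BB \<kappa>) \<noteq> equil \<kappa> 2 (BB \<kappa>)"
    proof
      assume "equil \<kappa> 1 (BB \<kappa>) = equil \<kappa> 2 (BB \<kappa>)"
      then have "1 / (1 + \<kappa> 1) = 1 / (1 + \<kappa> 2)" by (metis fst_equil)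
      then show False using spread_pos by (simp add: spread_def)
    qed
    then show ?thesis
      using BBe[of 1] BBe[of 2] boundary_equilibrium_iff[of 1 "BB \<kappa>"] boundary_equilibrium_iff[of 2 "BB \<kappa>"]
      by (simp add: double_boundary_equilibrium_def)
  qed
  have B3: "tangency \<kappa> 1 (BB \<kappa>) \<noteq> tangency \<kappa> 2 (BB \<kappa>)"
    using FF_iff[of \<kappa> "BB \<kappa>"] FF_snd[of "BB \<kappa>"] ord by auto
  have B4: "divides_locally (BB \<kappa>) (BE \<kappa> 1) (BE_hat_P \<kappa> 1) (BE1_tilde_P \<kappa>)"
    by (rule BE_divides[OF _ BB_BE, of _ "snd (GB \<kappa> 1)" 0])
       (use ord in \<open>auto simp: BE_hat_P_def BE1_tilde_P_def snd_FB\<close>)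
  have B5: "persistence \<kappa> 1 P \<and> standard_nodal \<kappa> 1 P" if "P \<in> BE1_tilde_P \<kappa>" for P
    using persistence_if[of 1 P] standard_nodal_if[of 1 P] BE_fixed[of 1 P] that ord by (auto simp: BE1_tilde_P_def)
  have B6: "divides_locally (BB \<kappa>) (BE \<kappa> 2) (BE2_hat_F \<kappa>) (BE2_F \<kappa>)"
    by (rule BE_divides[OF _ BB_BE, of _ "snd (BB \<kappa>) - 1" "snd (GB \<kappa> 2)"])
       (use ord in \<open>auto simp: BE2_hat_F_def BE2_F_def\<close>)
  have B7: "nonsmooth_fold \<kappa> 2 P \<and> Gamma_disappears \<kappa> P" if "P \<in> BE2_hat_F \<kappa>" for P
    using nonsmooth_fold_if[of 2 P] Gamma_disappears_BE[of 2 P] BE_fixed[of 2 P] that ord by (auto simp: BE2_hat_F_def)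
  have B8: "nonsmooth_fold \<kappa> 2 P \<and> standard_nodal \<kappa> 2 P" if "P \<in> BE2_F \<kappa>" for P
    using nonsmooth_fold_if[of 2 P] standard_nodal_if[of 2 P] BE_fixed[of 2 P] that ord by (auto simp: BE2_F_def)
  have C1: "divides_locally (GB \<kappa> 1) (BE \<kappa> 1) (BE1_tilde_P \<kappa>) (BE1_F \<kappa>)"
    by (rule BE_divides[OF _ GB_BE, of _ "snd (GB \<kappa> 1) - 1" "snd (BB \<kappa>)"])
       (use ord in \<open>auto simp: BE1_F_def BE1_tilde_P_def\<close>)
  have C2: "nonsmooth_fold \<kappa> 1 P" if "P \<in> BE1_F \<kappa>" for P
    using nonsmooth_fold_if[of 1 P] BE_fixed[of 1 P] that ord by (auto simp: BE1_F_def)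
  have C3: "divides_locally (GB \<kappa> 2) (BE \<kappa> 2) (BE_hat_P \<kappa> 2) (BE2_hat_F \<kappa>)"
    by (rule BE_divides[OF _ GB_BE, of _ "snd (BB \<kappa>)" 0])
       (use ord in \<open>auto simp: BE_hat_P_def BE2_hat_F_def snd_FB\<close>)
  have B9: "collides_with_quadratic_tangency \<kappa> i (BB \<kappa>)" if "i \<in> {1, 2}" for i
    using collides_if[OF that BBe[OF that]] .
  have C4: "collides_with_quadratic_tangency \<kappa> i (GB \<kappa> i)" if "i \<in> {1, 2}" for i
    using collides_if[OF that GBe[OF that]] .
  have F1: "\<forall>i\<in>{1, 2}. FF \<inter> BE \<kappa> i = {FB \<kappa> i} \<and> fold_boundary_equilibrium \<kappa> i (FB \<kappa> i)"
    by (rule ballI) (rule A1)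
  have F4: "\<forall>P\<in>FF1 \<kappa> \<union> FF2 \<kappa>. fold_fold_VI1 \<kappa> P \<and> sliding_reversal \<kappa> P"
    by (rule ballI) (rule A4)
  have F5: "\<forall>P\<in>FU \<kappa>. fused_focus \<kappa> P \<and> Gamma_disappears \<kappa> P \<and> sliding_reversal \<kappa> P"
    by (rule ballI) (rule A5)
  have F6: "\<forall>i\<in>{1, 2}. divides_locally (FB \<kappa> i) (BE \<kappa> i) (BE_P \<kappa> i) (BE_hat_P \<kappa> i) \<and>
      (\<forall>P\<in>BE_P \<kappa> i. persistence \<kappa> i P \<and> standard_nodal \<kappa> i P) \<and>
      (\<forall>P\<in>BE_hat_P \<kappa> i. persistence \<kappa> i P \<and> homoclinic_like \<kappa> i P \<and> Gamma_disappears \<kappa> P)"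
    by (intro ballI conjI) (rule A6 A7 A7[THEN conjunct1] A7[THEN conjunct2] A8[THEN conjunct1]
      A8[THEN conjunct2, THEN conjunct1] A8[THEN conjunct2, THEN conjunct2], assumption+)+
  have G4: "\<forall>i\<in>{1, 2}. collides_with_quadratic_tangency \<kappa> i (BB \<kappa>)"
    by (rule ballI) (rule B9)
  have G6: "\<forall>P\<in>BE_hat_P \<kappa> 1. persistence \<kappa> 1 P \<and> Gamma_disappears \<kappa> P"
    using A8[of 1] by simp
  have G7: "\<forall>P\<in>BE1_tilde_P \<kappa>. persistence \<kappa> 1 P \<and> standard_nodal \<kappa> 1 P"
    by (rule ballI) (rule B5)
  have G9: "\<forall>P\<in>BE2_hat_F \<kappa>. nonsmooth_fold \<kappa> 2 P \<and> Gamma_disappears \<kappa> P"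
    by (rule ballI) (rule B7)
  have G10: "\<forall>P\<in>BE2_F \<kappa>. nonsmooth_fold \<kappa> 2 P \<and> standard_nodal \<kappa> 2 P"
    by (rule ballI) (rule B8)
  have H3: "\<forall>i\<in>{1, 2}. GB \<kappa> i \<in> BE \<kappa> i \<and> collides_with_quadratic_tangency \<kappa> i (GB \<kappa> i) \<and>
      generalised_boundary_equilibrium \<kappa> i (GB \<kappa> i)"
    by (intro ballI conjI GB_BE C4 generalised_boundary_equilibrium_GB)
  have H5: "\<forall>P\<in>BE1_tilde_P \<kappa>. persistence \<kappa> 1 P" using G7 by simp
  have H6: "\<forall>P\<in>BE1_F \<kappa>. nonsmooth_fold \<kappa> 1 P" by (rule ballI) (rule C2)
  have H8: "\<forall>P\<in>BE_hat_P \<kappa> 2. persistence \<kappa> 2 P" using A8[of 2] by simp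
  have H9: "\<forall>P\<in>BE2_hat_F \<kappa>. nonsmooth_fold \<kappa> 2 P" using G9 by simp
  show ?thesis
    by (intro conjI) (fact F1 A2 A3 F4 F5 F6 B1 B2 B3 G4 B4 G6 G7 B6 G9 G10 PS_boundary H3 C1 H5 H6 C3 H8 H9)+
qed

end
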